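(* Let $k$ be a field, let $V$ be a $K_\infty$-vector space of finite dimension $d$, let $\Lambda\subset V$ be an $A$-lattice and let $\Lambda_\infty\subset V$ be an $\mathcal{O}_\infty$-lattice. Then there exist an $\mathcal{O}_\infty$-basis $v_1,\ldots,v_d\in V$ of $\Lambda_\infty$ and integers $n_1,\ldots,n_d\in\mathbb{Z}$ such that $\pi^{n_1}v_1,\ldots,\pi^{n_d}v_d$ is an $A$-basis of $\Lambda$. Moreover, if $\mathcal{E}$ is the vector bundle on $\mathbb{P}^1_k$ associated with the pair $(\Lambda,\Lambda_\infty)$, then it splits into line bundles $$\mathcal{E}\cong\mathcal{O}(n_1)\oplus\cdots\oplus\mathcal{O}(n_d).$$
   Context: Notation: $A=k[T]$ is the polynomial ring and $K=k(T)$ the rational function field. The place $\infty$ is the discrete valuation $-\deg$ on $K$, with uniformizer $\pi=T^{-1}$. $K_\infty=k((\pi))$ is the completion of $K$ at $\infty$, and $\mathcal{O}_\infty=k[[\pi]]$ is its valuation ring. An $A$-lattice in the $d$-dimensional $K_\infty$-vector space $V$ is the $A$-submodule $\Lambda\subset V$ generated over $A$ by some $K_\infty$-basis of $V$. An $\mathcal{O}_\infty$-lattice in $V$ is the $\mathcal{O}_\infty$-submodule of $V$ generated over $\mathcal{O}_\infty$ by some $K_\infty$-basis of $V$. A vector bundle on $\mathbb{P}^1_k$ is a locally free sheaf of finite rank. Here $\mathbb{P}^1_k=\operatorname{Spec}(A)\cup\{\infty\}$, and vector bundles are described via the faithfully flat covering $(\operatorname{Spec}(A),\operatorname{Spec}(\mathcal{O}_\infty))$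 of $\mathbb{P}^1_k$. A rank $d$ bundle $\mathcal{E}$ gives the $A$-module $\mathcal{E}(\operatorname{Spec}(A))$ and the $\mathcal{O}_\infty$-module $\widehat{\mathcal{E}}_\infty$ (the completed stalk at $\infty$), both of which embed as lattices in $K_\infty\otimes_{\mathcal{O}_\infty}\widehat{\mathcal{E}}_\infty\cong K_\infty\otimes_A\mathcal{E}(\operatorname{Spec}(A))$. The vector bundle associated with $(\Lambda,\Lambda_\infty)$ is the bundle $\mathcal{E}$ (unique up to isomorphism) for which there is a $K_\infty$-linear isomorphism of this space with $V$ carrying $\mathcal{E}(\operatorname{Spec}(A))$ onto $\Lambda$ and $\widehat{\mathcal{E}}_\infty$ onto $\Lambda_\infty$. $\mathcal{O}(n)$ denotes the usual degree $n$ line bundle on $\mathbb{P}^1_k$. *)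

theory Defs
  imports
    "HOL-Computational_Algebra.Formal_Laurent_Series"
    "HOL-Computational_Algebra.Fraction_Field"
    "HOL-Algebra.Module"
    "HOL-Algebra.Ideal"
begin

section \<open>The rings A, K and their completions at infinity\<close>

text \<open>
  For a field \<open>'k\<close>, the ring \<open>A = k[T]\<close> is \<open>'k poly\<close>, \<open>K = k(T)\<close> is \<open>'k poly fract\<close>, the completion
  of \<open>K\<close> at infinity is \<open>'k fls\<close> and its valuation ring is \<open>'k fps\<close>. The variable of the last two is the
  uniformizer \<open>\<pi> = 1/T\<close>, so \<open>K\<close> embeds into the Laurent series by \<open>T \<mapsto> fls_X_inv\<close>.
\<close>

definition poly_to_fls :: "'k::field poly \<Rightarrow> 'k fls" where
  "poly_to_fls a = poly (map_poly fls_const a) fls_X_inv"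

definition fract_to_fls :: "'k::field poly fract \<Rightarrow> 'k fls" where
  "fract_to_fls f =
     (THE z. \<exists>a b. b \<noteq> 0 \<and> f = Fract a b \<and> z = poly_to_fls a / poly_to_fls b)"

definition unif :: "'k::field poly fract" where
  "unif = Fract 1 [:0, 1:]"


section \<open>Lattices\<close>

text \<open>
  Throughout, \<open>scale\<close> is the scalar multiplication of a vector space over the Laurent series field, and
  \<open>A\<close> and the power series ring act by restriction of scalars. \<open>Modules.module\<close> is the type class
  based notion of a module, \<open>Module.module\<close> (used for sheaves below) the carrier based one.
\<close>

definition scale_A :: "('k::field fls \<Rightarrow> 'v \<Rightarrow> 'v) \<Rightarrow> 'k poly \<Rightarrow> 'v \<Rightarrow> 'v" where
  "scale_A scale a = scale (poly_to_fls a)"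

definition scale_O :: "('k::field fls \<Rightarrow> 'v \<Rightarrow> 'v) \<Rightarrow> 'k fps \<Rightarrow> 'v \<Rightarrow> 'v" where
  "scale_O scale c = scale (fps_to_fls c)"

definition A_lattice :: "('k::field fls \<Rightarrow> 'v::ab_group_add \<Rightarrow> 'v) \<Rightarrow> 'v set \<Rightarrow> bool" where
  "A_lattice scale L \<longleftrightarrow>
     (\<exists>B. \<not> module.dependent scale B \<and> module.span scale B = UNIV \<and>
          L = module.span (scale_A scale) B)"

definition O_lattice :: "('k::field fls \<Rightarrow> 'v::ab_group_add \<Rightarrow> 'v) \<Rightarrow> 'v set \<Rightarrow> bool" where
  "O_lattice scale L \<longleftrightarrow>
     (\<exists>B. \<not> module.dependent scale B \<and> module.span scale B = UNIV \<and>
          L = module.span (scale_O scale) B)"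

text \<open>The family \<open>v 0, \<dots>, v (d - 1)\<close> is a basis of the submodule \<open>L\<close>.\<close>

definition family_basis ::
  "('r::comm_ring_1 \<Rightarrow> 'v::ab_group_add \<Rightarrow> 'v) \<Rightarrow> nat \<Rightarrow> (nat \<Rightarrow> 'v) \<Rightarrow> 'v set \<Rightarrow> bool" where
  "family_basis sc d v L \<longleftrightarrow>
     inj_on v {..<d} \<and> \<not> module.dependent sc (v ` {..<d}) \<and> module.span sc (v ` {..<d}) = L"


section \<open>The projective line\<close>

definition poly_ring :: "'k::field poly ring" where
  "poly_ring = \<lparr>carrier = UNIV, mult = (*), one = 1, zero = 0, add = (+)\<rparr>"

definition Spec_A :: "'k::field poly set set" where
  "Spec_A = {P. primeideal P poly_ring}"

datatype 'a add_infty = Fin "'a set" | Infty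

type_synonym 'k point = "'k poly add_infty"

definition affine_line :: "'k::field point set" where
  "affine_line = Fin ` Spec_A"

definition P1 :: "'k::field point set" where
  "P1 = insert Infty affine_line"

abbreviation generic :: "'k::field point" where
  "generic \<equiv> Fin {0}"

text \<open>
  The nonempty Zariski open subsets of \<open>Spec A\<close> are cofinite, and likewise for the chart
  \<open>Spec k[\<pi>]\<close>. Hence gluing the two charts amounts to the following: a neighbourhood of infinity
  is open iff its trace on \<open>Spec A\<close> is open and not empty.
\<close>

definition P1_open :: "'k::field point set \<Rightarrow> bool" where
  "P1_open U \<longleftrightarrow>
     U \<subseteq> P1 \<and>
     (\<exists>S. U \<inter> affine_line = Fin ` {P \<in> Spec_A. \<not> S \<subseteq> P}) \<and>
     (Infty \<in> U \<longrightarrow> U \<inter> affine_line \<noteq> {})"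

text \<open>At infinity the local ring is the valuation ring of \<open>- deg\<close>.\<close>

fun local_set :: "'k::field point \<Rightarrow> 'k poly fract set" where
  "local_set (Fin P) = {Fract a b | a b. b \<notin> P}"
| "local_set Infty = {Fract a b | a b. b \<noteq> 0 \<and> degree a \<le> degree b}"

text \<open>
  The projective line is integral, so its structure sheaf and the line bundles \<open>\<O>(n)\<close> are subsheaves
  of the constant sheaf \<open>K\<close>, given by a condition at each point. On the empty set the only section
  is \<open>0\<close>, and the ring of sections there is the zero ring, whose unit is \<open>0\<close>.
\<close>

definition K_sections ::
  "('k::field point \<Rightarrow> 'k poly fract set) \<Rightarrow> 'k point set \<Rightarrow> 'k poly fract set" where
  "K_sections L U = (if U = {} then {0} else {f. \<forall>p\<in>U. f \<in> L p})"

definition K_restr :: "'k::field point set \<Rightarrow> 'k poly fract \<Rightarrow> 'k poly fract" where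
  "K_restr W f = (if W = {} then 0 else f)"

definition O_ring :: "'k::field point set \<Rightarrow> 'k poly fract ring" where
  "O_ring U = \<lparr>carrier = K_sections local_set U, mult = (*), one = K_restr U 1,
               zero = 0, add = (+)\<rparr>"


section \<open>Sheaves of modules and vector bundles\<close>

text \<open>
  The \<open>mult\<close> and \<open>one\<close> fields of a module record are never used; they are set to \<open>undefined\<close>.
\<close>

record ('p, 'f, 's) module_sheaf =
  sec :: "'p set \<Rightarrow> ('f, 's) module"
  res :: "'p set \<Rightarrow> 'p set \<Rightarrow> 's \<Rightarrow> 's"  \<comment> \<open>\<open>res E U W\<close> restricts from \<open>U\<close> to \<open>W\<close>\<close>

type_synonym ('k, 's) omod = "('k point, 'k poly fract, 's) module_sheaf"

definition O_presheaf :: "('k::field, 's) omod \<Rightarrow> bool" where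
  "O_presheaf E \<longleftrightarrow>
     (\<forall>U. P1_open U \<longrightarrow> Module.module (O_ring U) (sec E U)) \<and>
     (\<forall>U W. P1_open U \<and> P1_open W \<and> W \<subseteq> U \<longrightarrow>
        (\<forall>s \<in> carrier (sec E U). res E U W s \<in> carrier (sec E W)) \<and>
        (\<forall>s \<in> carrier (sec E U). \<forall>t \<in> carrier (sec E U).
           res E U W (s \<oplus>\<^bsub>sec E U\<^esub> t) = res E U W s \<oplus>\<^bsub>sec E W\<^esub> res E U W t) \<and>
        (\<forall>f \<in> carrier (O_ring U). \<forall>s \<in> carrier (sec E U).
           res E U W (f \<odot>\<^bsub>sec E U\<^esub> s) = K_restr W f \<odot>\<^bsub>sec E W\<^esub> res E U W s)) \<and>
     (\<forall>U. P1_open U \<longrightarrow> (\<forall>s \<in> carrier (sec E U). res E U U s = s)) \<and>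
     (\<forall>U W X. P1_open U \<and> P1_open W \<and> P1_open X \<and> X \<subseteq> W \<and> W \<subseteq> U \<longrightarrow>
        (\<forall>s \<in> carrier (sec E U). res E W X (res E U W s) = res E U X s))"

definition O_sheaf :: "('k::field, 's) omod \<Rightarrow> bool" where
  "O_sheaf E \<longleftrightarrow>
     O_presheaf E \<and>
     (\<forall>C. (\<forall>U\<in>C. P1_open U) \<longrightarrow>
        (\<forall>s \<in> carrier (sec E (\<Union>C)). \<forall>t \<in> carrier (sec E (\<Union>C)).
           (\<forall>U\<in>C. res E (\<Union>C) U s = res E (\<Union>C) U t) \<longrightarrow> s = t) \<and>
        (\<forall>\<sigma>. (\<forall>U\<in>C. \<sigma> U \<in> carrier (sec E U)) \<and>
             (\<forall>U\<in>C. \<forall>W\<in>C. res E U (U \<inter> W) (\<sigma> U) = res E W (U \<inter> W) (\<sigma> W)) \<longrightarrow>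
             (\<exists>s \<in> carrier (sec E (\<Union>C)). \<forall>U\<in>C. res E (\<Union>C) U s = \<sigma> U)))"

text \<open>The restrictions of \<open>E\<close> and \<open>F\<close> to the open set \<open>U\<close> are isomorphic.\<close>

definition iso_on :: "'k::field point set \<Rightarrow> ('k, 's) omod \<Rightarrow> ('k, 't) omod \<Rightarrow> bool" where
  "iso_on U E F \<longleftrightarrow>
     (\<exists>\<phi>. (\<forall>W. P1_open W \<and> W \<subseteq> U \<longrightarrow>
             bij_betw (\<phi> W) (carrier (sec E W)) (carrier (sec F W)) \<and>
             (\<forall>s \<in> carrier (sec E W). \<forall>t \<in> carrier (sec E W).
                \<phi> W (s \<oplus>\<^bsub>sec E W\<^esub> t) = \<phi> W s \<oplus>\<^bsub>sec F W\<^esub> \<phi> W t) \<and>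
             (\<forall>f \<in> carrier (O_ring W). \<forall>s \<in> carrier (sec E W).
                \<phi> W (f \<odot>\<^bsub>sec E W\<^esub> s) = f \<odot>\<^bsub>sec F W\<^esub> \<phi> W s)) \<and>
          (\<forall>W X. P1_open W \<and> P1_open X \<and> X \<subseteq> W \<and> W \<subseteq> U \<longrightarrow>
             (\<forall>s \<in> carrier (sec E W). \<phi> X (res E W X s) = res F W X (\<phi> W s))))"

definition omod_iso :: "('k::field, 's) omod \<Rightarrow> ('k, 't) omod \<Rightarrow> bool" where
  "omod_iso E F \<longleftrightarrow> iso_on P1 E F"

definition K_subsheaf ::
  "('k::field point \<Rightarrow> 'k poly fract set) \<Rightarrow> ('k, 'k poly fract) omod" where
  "K_subsheaf L =
     \<lparr>sec = (\<lambda>U. \<lparr>carrier = K_sections L U, mult = undefined, one = undefined,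
                 zero = 0, add = (+), smult = (*)\<rparr>),
      res = (\<lambda>U W. K_restr W)\<rparr>"

definition structure_sheaf :: "('k::field, 'k poly fract) omod" where
  "structure_sheaf = K_subsheaf local_set"

text \<open>\<open>\<O>(n)\<close>, realised as the sheaf of the divisor \<open>n \<cdot> \<infinity>\<close>: poles of order at most \<open>n\<close> at infinity.\<close>

definition O_twist :: "int \<Rightarrow> ('k::field, 'k poly fract) omod" where
  "O_twist n = K_subsheaf (\<lambda>p. if p = Infty then {f. unif powi n * f \<in> local_set Infty}
                               else local_set p)"

definition direct_sum :: "nat \<Rightarrow> (nat \<Rightarrow> ('k::field, 's) omod) \<Rightarrow> ('k, nat \<Rightarrow> 's) omod" where
  "direct_sum d F =
     \<lparr>sec = (\<lambda>U. \<lparr>carrier = (\<Pi>\<^sub>E i\<in>{..<d}. carrier (sec (F i) U)),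
                 mult = undefined, one = undefined,
                 zero = (\<lambda>i\<in>{..<d}. \<zero>\<^bsub>sec (F i) U\<^esub>),
                 add = (\<lambda>s t. \<lambda>i\<in>{..<d}. s i \<oplus>\<^bsub>sec (F i) U\<^esub> t i),
                 smult = (\<lambda>f s. \<lambda>i\<in>{..<d}. f \<odot>\<^bsub>sec (F i) U\<^esub> s i)\<rparr>),
      res = (\<lambda>U W s. \<lambda>i\<in>{..<d}. res (F i) U W (s i))\<rparr>"

definition vector_bundle :: "('k::field, 's) omod \<Rightarrow> bool" where
  "vector_bundle E \<longleftrightarrow>
     O_sheaf E \<and>
     (\<forall>p\<in>P1. \<exists>U r. P1_open U \<and> p \<in> U \<and> iso_on U E (direct_sum r (\<lambda>_. structure_sheaf)))"


section \<open>Stalks and the completed stalk at infinity\<close>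

type_synonym ('k, 's) germ = "('k point set \<times> 's) set"

definition germ :: "('k::field, 's) omod \<Rightarrow> 'k point \<Rightarrow> 'k point set \<Rightarrow> 's \<Rightarrow> ('k, 's) germ" where
  "germ E p U s =
     {(W, t). P1_open W \<and> p \<in> W \<and> t \<in> carrier (sec E W) \<and>
        (\<exists>X. P1_open X \<and> p \<in> X \<and> X \<subseteq> U \<inter> W \<and> res E U X s = res E W X t)}"

definition stalk :: "('k::field, 's) omod \<Rightarrow> 'k point \<Rightarrow> ('k poly fract, ('k, 's) germ) module" where
  "stalk E p =
     \<lparr>carrier = {germ E p U s | U s. P1_open U \<and> p \<in> U \<and> s \<in> carrier (sec E U)},
      mult = undefined, one = undefined,
      zero = germ E p P1 \<zero>\<^bsub>sec E P1\<^esub>,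
      add = (\<lambda>x y. THE z. \<exists>U s t. P1_open U \<and> p \<in> U \<and>
               s \<in> carrier (sec E U) \<and> t \<in> carrier (sec E U) \<and>
               x = germ E p U s \<and> y = germ E p U t \<and> z = germ E p U (s \<oplus>\<^bsub>sec E U\<^esub> t)),
      smult = (\<lambda>f x. THE z. \<exists>U s. P1_open U \<and> p \<in> U \<and>
               s \<in> carrier (sec E U) \<and> f \<in> carrier (O_ring U) \<and>
               x = germ E p U s \<and> z = germ E p U (f \<odot>\<^bsub>sec E U\<^esub> s))\<rparr>"

text \<open>
  The \<open>\<pi>\<close>-adic completion of a module \<open>M\<close> over the local ring at infinity, as the inverse limit of
  the quotients \<open>M / \<pi>\<^sup>n M\<close>. Elements are compatible sequences of cosets. A power series acts on
  \<open>M / \<pi>\<^sup>n M\<close> through its truncation modulo \<open>\<pi>\<^sup>n\<close>, which is an element of \<open>K\<close>.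
\<close>

definition unif_mult :: "('k::field poly fract, 'm) module \<Rightarrow> nat \<Rightarrow> 'm set" where
  "unif_mult M n = {unif ^ n \<odot>\<^bsub>M\<^esub> m | m. m \<in> carrier M}"

definition truncate :: "nat \<Rightarrow> 'k::field fps \<Rightarrow> 'k poly fract" where
  "truncate n c = (\<Sum>i<n. Fract [:fps_nth c i:] 1 * unif ^ i)"

definition completion ::
  "('k::field poly fract, 'm) module \<Rightarrow> ('k fps, nat \<Rightarrow> 'm set) module" where
  "completion M =
     \<lparr>carrier = {x. \<forall>n. x n \<in> a_rcosets\<^bsub>M\<^esub> (unif_mult M n) \<and> x (Suc n) \<subseteq> x n},
      mult = undefined, one = undefined,
      zero = (\<lambda>n. unif_mult M n),
      add = (\<lambda>x y n. x n <+>\<^bsub>M\<^esub> y n),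
      smult = (\<lambda>c x n. \<Union>m \<in> x n. unif_mult M n +>\<^bsub>M\<^esub> (truncate n c \<odot>\<^bsub>M\<^esub> m))\<rparr>"

definition to_completion :: "('k::field poly fract, 'm) module \<Rightarrow> 'm \<Rightarrow> nat \<Rightarrow> 'm set" where
  "to_completion M m = (\<lambda>n. unif_mult M n +>\<^bsub>M\<^esub> m)"

definition completed_stalk ::
  "('k::field, 's) omod \<Rightarrow> ('k fps, nat \<Rightarrow> ('k, 's) germ set) module" where
  "completed_stalk E = completion (stalk E Infty)"


section \<open>The vector bundle associated with a pair of lattices\<close>

definition linear_to ::
  "'r set \<Rightarrow> ('r, 'm) module \<Rightarrow> ('r \<Rightarrow> 'v::ab_group_add \<Rightarrow> 'v) \<Rightarrow> ('m \<Rightarrow> 'v) \<Rightarrow> bool" where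
  "linear_to R M sc h \<longleftrightarrow>
     (\<forall>x \<in> carrier M. \<forall>y \<in> carrier M. h (x \<oplus>\<^bsub>M\<^esub> y) = h x + h y) \<and>
     (\<forall>r \<in> R. \<forall>x \<in> carrier M. h (r \<odot>\<^bsub>M\<^esub> x) = sc r (h x))"

text \<open>
  Write \<open>F\<close> for the Laurent series field, \<open>R\<close> for the power series ring, \<open>E\<^sub>\<eta>\<close> and \<open>E\<^sub>\<infinity>\<close> for the
  stalks at the generic point and at infinity, and \<open>C\<close> for the completed stalk. The space
  \<open>F \<otimes>\<^sub>R C \<cong> F \<otimes>\<^sub>A E(Spec A)\<close> of the pair is identified through \<open>F \<otimes>\<^sub>K E\<^sub>\<eta>\<close>, since
  \<open>E\<^sub>\<eta> = K \<otimes>\<^sub>A E(Spec A)\<close> is also the localisation of \<open>E\<^sub>\<infinity>\<close>. By the universal property of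
  the tensor product, an \<open>F\<close>-linear map from this space to \<open>V\<close> is a \<open>K\<close>-linear map \<open>g\<close> on \<open>E\<^sub>\<eta>\<close>, or equally
  an \<open>R\<close>-linear map \<open>h\<close> on \<open>C\<close>; the two descriptions belong to the same map iff they agree on
  \<open>E\<^sub>\<infinity>\<close>. The map carries \<open>E(Spec A)\<close> and \<open>C\<close> isomorphically onto the two lattices iff the
  two bijectivity conditions hold, and then it is an isomorphism onto \<open>V\<close>, because the lattices
  are generated by bases of \<open>V\<close>.
\<close>

definition associated_bundle ::
  "('k::field fls \<Rightarrow> 'v::ab_group_add \<Rightarrow> 'v) \<Rightarrow> 'v set \<Rightarrow> 'v set \<Rightarrow> ('k, 's) omod \<Rightarrow> bool" where
  "associated_bundle scale L Linf E \<longleftrightarrow>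
     vector_bundle E \<and>
     (\<exists>g h.
        linear_to UNIV (stalk E generic) (\<lambda>f. scale (fract_to_fls f)) g \<and>
        linear_to UNIV (completed_stalk E) (scale_O scale) h \<and>
        (\<forall>U t. P1_open U \<and> Infty \<in> U \<and> t \<in> carrier (sec E U) \<longrightarrow>
           h (to_completion (stalk E Infty) (germ E Infty U t)) = g (germ E generic U t)) \<and>
        bij_betw (\<lambda>s. g (germ E generic affine_line s)) (carrier (sec E affine_line)) L \<and>
        bij_betw h (carrier (completed_stalk E)) Linf)"

end

(*
Reduction theory: consider the A-bases w of the lattice together with exponents n such that all
pi^(-n_i) w_i lie in the lattice at infinity. The sum of the n_i is bounded. If it is maximal, then the
vectors v_i = pi^(-n_i) w_i are independent modulo pi over k, because a relation would allow to change
the w_i with least n_i in it and to increase that n_i; hence they form a basis of the lattice at infinity.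

Splitting: a section of E over a nonempty open U is determined by its image in V, and local freeness
shows that a multiple of it by a power of a function vanishing on the complement of U extends across
that complement. Therefore the image of E(U) consists of the combinations of the w_i with coefficients
f_i in K that are regular at the finite points of U and, if U contains infinity, satisfy
pi^(n_i) f_i in O_infinity. This is the sheaf O(n_1) + ... + O(n_d).
*)
theory Submission
  imports Defs
begin

section \<open>Embeddings into the Laurent series field\<close>

text \<open>The exponents are bounded one at a time. A nonzero element of the A-lattice has
  polynomial coordinates in a fixed A-basis, and a nonzero one among them has valuation at most 0;
  elements of the lattice at infinity have coordinates of valuation at least -m in that basis, for a
  fixed m. This forces n_i \<le> m. Independence modulo \<pi> gives generation by looking at the
  coordinates of lowest valuation: were it negative, their leading coefficients would form a
  relation modulo \<pi>. In the splitting the obstacle is the point at infinity. There the pair is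
  tied to the bundle only through the completed stalk, so a vector of the lattice comes from an
  element x of an inverse limit, which need not be a germ. But the vector also comes from a section
  with a pole. If \<pi>^k clears the pole, the resulting germ equals \<pi>^k x in the completion; at
  level k of the inverse limit this says that the germ is divisible by \<pi>^k in the stalk itself,
  and the quotient is the section wanted.\<close>

lemma poly_to_fls_0 [simp]: "poly_to_fls 0 = 0"
  by (simp add: poly_to_fls_def)

lemma poly_to_fls_pCons: "poly_to_fls (pCons c a) = fls_const c + fls_X_inv * poly_to_fls a"
  by (simp add: poly_to_fls_def map_poly_pCons)

lemma poly_to_fls_1 [simp]: "poly_to_fls 1 = 1"
  by (simp add: poly_to_fls_def)

lemma poly_to_fls_const: "poly_to_fls [:c:] = fls_const c"
  by (simp add: poly_to_fls_pCons)

text \<open>T goes to the inverse of \<pi>, so the coefficient of T^j sits in degree -j. Additivity,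
  injectivity and the degree formula are read off from this.\<close>

lemma poly_to_fls_nth:
  "fls_nth (poly_to_fls a) n = (if n \<le> 0 then coeff a (nat (- n)) else 0)"
proof (induction a arbitrary: n)
  case 0
  then show ?case by simp
next
  case (pCons c a)
  have "fls_nth (poly_to_fls (pCons c a)) n = (if n = 0 then c else 0) + fls_nth (poly_to_fls a) (n + 1)"
    by (simp add: poly_to_fls_pCons fls_X_inv_times_conv_shift)
  also have "\<dots> = (if n \<le> 0 then coeff (pCons c a) (nat (- n)) else 0)"
  proof (cases "n < 0")
    case True
    then have "nat (- n) = Suc (nat (- (n + 1)))" by linarith
    then show ?thesis using True by (simp add: pCons.IH)
  qed (auto simp: pCons.IH)
  finally show ?case .
qed

lemma poly_to_fls_add: "poly_to_fls (a + b) = poly_to_fls a + poly_to_fls b"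
  by (rule fls_eqI) (simp add: poly_to_fls_nth)

lemma poly_to_fls_smult: "poly_to_fls (Polynomial.smult c a) = fls_const c * poly_to_fls a"
  by (rule fls_eqI) (simp add: poly_to_fls_nth)

lemma poly_to_fls_mult: "poly_to_fls (a * b) = poly_to_fls a * poly_to_fls b"
  by (induction a)
    (simp_all add: poly_to_fls_pCons poly_to_fls_add poly_to_fls_smult algebra_simps)

lemma poly_to_fls_power: "poly_to_fls (a ^ n) = poly_to_fls a ^ n"
  by (induction n) (simp_all add: poly_to_fls_mult)

lemma poly_to_fls_eq_0_iff [simp]: "poly_to_fls a = 0 \<longleftrightarrow> a = 0"
proof
  assume "poly_to_fls a = 0"
  then have "coeff a n = 0" for n
    using poly_to_fls_nth[of a "- int n"] by simp
  then show "a = 0" by (simp add: poly_eq_iff)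
qed simp

lemma poly_to_fls_T: "poly_to_fls [:0, 1:] = fls_X_inv"
  by (simp add: poly_to_fls_pCons poly_to_fls_const)

lemma poly_to_fls_T_power: "poly_to_fls (monom 1 n) = fls_X powi (- int n)"
proof -
  have "poly_to_fls (monom 1 n) = fls_X_inv ^ n"
    by (simp add: monom_altdef poly_to_fls_power poly_to_fls_T)
  also have "\<dots> = fls_X powi (- int n)"
    by (simp add: fls_inverse_X' power_int_minus power_int_of_nat flip: power_inverse
          del: fls_X_power_int)
  finally show ?thesis .
qed

text \<open>Identifies \<open>fls_subdegree\<close> with the valuation -deg; for the zero polynomial
  both sides are 0 by convention. That no nonzero polynomial has positive valuation is what bounds
  the exponents in the reduction.\<close>

lemma subdegree_poly_to_fls: "fls_subdegree (poly_to_fls a) = - int (degree a)"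
proof (cases "a = 0")
  case False
  show ?thesis
    by (rule fls_subdegree_eqI) (use False in \<open>auto simp: poly_to_fls_nth coeff_eq_0\<close>)
qed simp

text \<open>Independence of the representative is cross-multiplication in the Laurent series field,
  where nonzero denominators stay nonzero. This resolves the \<open>THE\<close> once and for
  all.\<close>

lemma fract_to_fls_Fract:
  assumes "b \<noteq> 0"
  shows "fract_to_fls (Fract a b) = poly_to_fls a / poly_to_fls b"
  unfolding fract_to_fls_def
proof (rule the_equality)
  show "\<exists>a' b'. b' \<noteq> 0 \<and> Fract a b = Fract a' b' \<and>
    poly_to_fls a / poly_to_fls b = poly_to_fls a' / poly_to_fls b'"
    using assms by blast
next
  fix z assume "\<exists>a' b'. b' \<noteq> 0 \<and> Fract a b = Fract a' b' \<and> z = poly_to_fls a' / poly_to_fls b'"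
  then obtain a' b' where *: "b' \<noteq> 0" "Fract a b = Fract a' b'"
    and z: "z = poly_to_fls a' / poly_to_fls b'" by blast
  then have "a * b' = a' * b" using assms by (simp add: eq_fract)
  then have "poly_to_fls a * poly_to_fls b' = poly_to_fls a' * poly_to_fls b"
    by (metis poly_to_fls_mult)
  then show "z = poly_to_fls a / poly_to_fls b"
    using assms * by (simp add: z frac_eq_eq)
qed

lemma fract_to_fls_add: "fract_to_fls (f + g) = fract_to_fls f + fract_to_fls g"
  by (cases f; cases g)
    (simp add: fract_to_fls_Fract poly_to_fls_add poly_to_fls_mult add_frac_eq mult.commute)

lemma fract_to_fls_mult: "fract_to_fls (f * g) = fract_to_fls f * fract_to_fls g"
  by (cases f; cases g) (simp add: fract_to_fls_Fract poly_to_fls_mult)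

lemma fract_to_fls_poly: "fract_to_fls (Fract a 1) = poly_to_fls a"
  by (simp add: fract_to_fls_Fract)

lemma fract_to_fls_0 [simp]: "fract_to_fls 0 = 0"
  by (simp add: Zero_fract_def fract_to_fls_Fract)

lemma fract_to_fls_1 [simp]: "fract_to_fls 1 = 1"
  by (simp add: One_fract_def fract_to_fls_Fract)

lemma fract_to_fls_eq_0_iff [simp]: "fract_to_fls f = 0 \<longleftrightarrow> f = 0"
proof (cases f)
  case (Fract a b)
  then show ?thesis
    by (simp add: fract_to_fls_Fract eq_fract Zero_fract_def)
qed

lemma fract_to_fls_uminus: "fract_to_fls (- f) = - fract_to_fls f"
  by (metis add_eq_0_iff fract_to_fls_0 fract_to_fls_add)

lemma fract_to_fls_inject: "fract_to_fls f = fract_to_fls g \<longleftrightarrow> f = g"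
proof
  assume "fract_to_fls f = fract_to_fls g"
  then have "fract_to_fls (f - g) = 0"
    by (metis add_uminus_conv_diff fract_to_fls_add fract_to_fls_uminus right_minus_eq)
  then show "f = g" by simp
qed simp

lemma fract_to_fls_inverse: "fract_to_fls (inverse f) = inverse (fract_to_fls f)"
proof (cases "f = 0")
  case False
  then have "fract_to_fls f * fract_to_fls (inverse f) = 1"
    by (simp flip: fract_to_fls_mult)
  then show ?thesis by (metis inverse_unique)
qed simp

lemma fract_to_fls_unif: "fract_to_fls unif = fls_X"
  by (simp add: unif_def fract_to_fls_Fract poly_to_fls_T fls_inverse_X_inv fls_X_conv_shift_1
      flip: inverse_eq_divide)

lemma unif_nonzero [simp]: "unif \<noteq> 0"
  by (metis fls_X_nonzero fract_to_fls_eq_0_iff fract_to_fls_unif)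

lemma fract_to_fls_power: "fract_to_fls (f ^ n) = fract_to_fls f ^ n"
  by (induction n) (simp_all add: fract_to_fls_mult)

lemma fract_to_fls_unif_power: "fract_to_fls (unif ^ n) = fls_X powi (int n)"
  by (simp only: fract_to_fls_power fract_to_fls_unif power_int_of_nat)

lemma fract_to_fls_unif_power_int: "fract_to_fls (unif powi n) = fls_X powi n"
proof (cases "n \<ge> 0")
  case True
  then show ?thesis
    by (metis fract_to_fls_power fract_to_fls_unif nonneg_int_cases power_int_of_nat)
next
  case False
  then have "n = - int (nat (- n))" by simp
  then obtain m where "n = - int m" ..
  then show ?thesis
    by (simp only: power_int_of_nat power_int_minus fract_to_fls_inverse
      fract_to_fls_power fract_to_fls_unif)
qed

text \<open>The power series are handled as a subset of the Laurent series field, so that they can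
  serve as a set of coefficients beside the polynomials and the whole field.\<close>

abbreviation O_inf :: "'k::field fls set" where
  "O_inf \<equiv> range fps_to_fls"

lemma O_inf_iff: "f \<in> O_inf \<longleftrightarrow> 0 \<le> fls_subdegree f"
proof
  assume "0 \<le> fls_subdegree f"
  then have "f = fps_to_fls (fls_regpart f)"
    by (simp add: fls_regpart_to_fls_trivial)
  then show "f \<in> O_inf" by blast
qed (auto simp: fls_subdegree_fls_to_fps_gt0)

lemma O_inf_0 [simp]: "0 \<in> O_inf" and O_inf_1 [simp]: "1 \<in> O_inf"
  by (simp_all add: O_inf_iff)

lemma O_inf_const [simp]: "fls_const c \<in> O_inf"
  by (simp add: O_inf_iff)

lemma O_inf_add: "f \<in> O_inf \<Longrightarrow> g \<in> O_inf \<Longrightarrow> f + g \<in> O_inf"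
  by (auto simp flip: fps_to_fls_plus)

lemma O_inf_uminus: "f \<in> O_inf \<Longrightarrow> - f \<in> O_inf"
  by (auto simp flip: fps_to_fls_uminus)

lemma O_inf_mult: "f \<in> O_inf \<Longrightarrow> g \<in> O_inf \<Longrightarrow> f * g \<in> O_inf"
  by (auto simp: image_iff simp flip: fls_times_fps_to_fls)

lemma subdegree_fls_X_powi_mult:
  fixes f :: "'k::field fls"
  shows "f \<noteq> 0 \<Longrightarrow> fls_subdegree (fls_X powi n * f) = n + fls_subdegree f"
  by (simp add: fls_subdegree_mult)

lemma fls_X_powi_nonzero: "(fls_X powi n :: 'k::field fls) \<noteq> 0"
  by simp

lemma fls_X_powi_add: "(fls_X powi (m + n) :: 'k::field fls) = fls_X powi m * fls_X powi n"
  by (rule power_int_add) simp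

lemma O_inf_X_powi: "(fls_X powi n :: 'k::field fls) \<in> O_inf \<longleftrightarrow> 0 \<le> n"
  by (simp add: O_inf_iff)

text \<open>A common bound for the poles of finitely many series; the individual exponents are
  simply added up, since surplus factors \<pi> stay in \<open>O_inf\<close>.\<close>

lemma ex_X_powi_O_inf:
  fixes f :: "'i \<Rightarrow> 'k::field fls"
  assumes "finite I"
  shows "\<exists>m. \<forall>i\<in>I. fls_X powi (int m) * f i \<in> O_inf"
  using assms
proof (induction rule: finite_induct)
  case (insert i I)
  then obtain m where m: "\<forall>i\<in>I. fls_X powi (int m) * f i \<in> O_inf" by blast
  let ?n = "nat (- fls_subdegree (f i))"
  have "fls_X powi (int ?n) * f i \<in> O_inf"
    by (cases "f i = 0") (simp_all add: O_inf_iff subdegree_fls_X_powi_mult del: fls_X_power_int)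
  then have "fls_X powi (int m) * (fls_X powi (int ?n) * f i) \<in> O_inf"
    by (rule O_inf_mult[OF O_inf_X_powi[THEN iffD2, OF of_nat_0_le_iff]])
  moreover have "fls_X powi (int ?n) * (fls_X powi (int m) * f j) \<in> O_inf" if "j \<in> I" for j
    using m that by (rule_tac O_inf_mult[OF O_inf_X_powi[THEN iffD2, OF of_nat_0_le_iff]]) blast
  ultimately have "\<forall>j\<in>insert i I. fls_X powi (int (m + ?n)) * f j \<in> O_inf"
    by (metis (no_types, lifting) fls_X_powi_add insertE mult.assoc mult.commute of_nat_add)
  then show ?case by blast
qed simp

section \<open>Bases of lattices\<close>

text \<open>Independence and span of a set of vectors are traded for statements on coefficient
  families indexed below \<open>d\<close>. Injectivity of the family is absorbed into independence:
  two equal members give the relation v i - v j = 0.\<close>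

lemma (in Modules.module) family_basis_iff:
  "family_basis scale d v L \<longleftrightarrow>
     (\<forall>c. (\<Sum>i<d. scale (c i) (v i)) = 0 \<longrightarrow> (\<forall>i<d. c i = 0)) \<and>
     L = {\<Sum>i<d. scale (c i) (v i) | c. True}"
proof -
  have reindex: "(\<Sum>x\<in>v ` {..<d}. scale (u x) x) = (\<Sum>i<d. scale (u (v i)) (v i))"
    if "inj_on v {..<d}" for u
    using that by (simp add: sum.reindex)
  have coeffs: "\<exists>u. \<forall>i<d. u (v i) = c i" if "inj_on v {..<d}" for c :: "nat \<Rightarrow> 'a"
    by (rule exI[of _ "\<lambda>x. c (inv_into {..<d} v x)"]) (use that in auto)
  have span_eq: "span (v ` {..<d}) = {\<Sum>i<d. scale (c i) (v i) | c. True}"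
    if inj: "inj_on v {..<d}"
  proof -
    have "span (v ` {..<d}) = range (\<lambda>u. \<Sum>i<d. scale (u (v i)) (v i))"
      by (simp add: span_finite reindex[OF inj])
    also have "\<dots> = {\<Sum>i<d. scale (c i) (v i) | c. True}"
    proof (intro equalityI subsetI)
      fix x assume "x \<in> {\<Sum>i<d. scale (c i) (v i) | c. True}"
      then obtain c where c: "x = (\<Sum>i<d. scale (c i) (v i))" by blast
      obtain u where "\<forall>i<d. u (v i) = c i" using coeffs[OF inj] by blast
      then have "x = (\<Sum>i<d. scale (u (v i)) (v i))" by (simp add: c)
      then show "x \<in> range (\<lambda>u. \<Sum>i<d. scale (u (v i)) (v i))" by blast
    qed auto
    finally show ?thesis .
  qed
  have dep_eq: "\<not> dependent (v ` {..<d}) \<longleftrightarrow>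
      (\<forall>c. (\<Sum>i<d. scale (c i) (v i)) = 0 \<longrightarrow> (\<forall>i<d. c i = 0))"
    if inj: "inj_on v {..<d}"
  proof
    assume ind: "\<not> dependent (v ` {..<d})"
    show "\<forall>c. (\<Sum>i<d. scale (c i) (v i)) = 0 \<longrightarrow> (\<forall>i<d. c i = 0)"
    proof (intro allI impI)
      fix c i assume *: "(\<Sum>i<d. scale (c i) (v i)) = 0" "i < d"
      obtain u where u: "\<forall>i<d. u (v i) = c i" using coeffs[OF inj] by blast
      then have "(\<Sum>x\<in>v ` {..<d}. scale (u x) x) = 0"
        using * by (simp add: reindex[OF inj])
      then have "u (v i) = 0"
        using ind \<open>i < d\<close> by (auto simp: dependent_finite)
      then show "c i = 0" using u \<open>i < d\<close> by simp
    qed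
  qed (auto simp: dependent_finite reindex[OF inj])
  have "inj_on v {..<d}"
    if "\<forall>c. (\<Sum>i<d. scale (c i) (v i)) = 0 \<longrightarrow> (\<forall>i<d. c i = 0)"
  proof (rule inj_onI, rule ccontr)
    fix i j assume ij: "i \<in> {..<d}" "j \<in> {..<d}" "v i = v j" "i \<noteq> j"
    let ?c = "\<lambda>k. if k = i then 1 else if k = j then - 1 else 0 :: 'a"
    have "(\<Sum>k<d. scale (?c k) (v k)) = (\<Sum>k\<in>{i, j}. scale (?c k) (v k))"
      by (rule sum.mono_neutral_right) (use ij in auto)
    also have "\<dots> = 0" using ij by simp
    finally have "?c i = 0" using that[THEN spec, of ?c] ij by blast
    then show False by simp
  qed
  then show ?thesis
    unfolding family_basis_def using span_eq dep_eq by blast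
qed

section \<open>Linear combinations with coefficients in a subring of the Laurent series
  field\<close>

locale fls_space = vector_space scale
  for scale :: "'k::field fls \<Rightarrow> 'v::ab_group_add \<Rightarrow> 'v"
begin

definition comb :: "nat \<Rightarrow> (nat \<Rightarrow> 'k fls) \<Rightarrow> (nat \<Rightarrow> 'v) \<Rightarrow> 'v" where
  "comb d c w = (\<Sum>i<d. scale (c i) (w i))"

text \<open>With \<open>R\<close> the polynomials, the power series or all Laurent series, this is
  the A-module, the module over the valuation ring or the subspace generated by \<open>w\<close>.
  One set of lemmas serves all three.\<close>

definition combs :: "'k fls set \<Rightarrow> nat \<Rightarrow> (nat \<Rightarrow> 'v) \<Rightarrow> 'v set" where
  "combs R d w = {comb d c w | c. \<forall>i<d. c i \<in> R}"

definition indep :: "nat \<Rightarrow> (nat \<Rightarrow> 'v) \<Rightarrow> bool" where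
  "indep d w \<longleftrightarrow> (\<forall>c. comb d c w = 0 \<longrightarrow> (\<forall>i<d. c i = 0))"

definition is_subring :: "'k fls set \<Rightarrow> bool" where
  "is_subring R \<longleftrightarrow> 0 \<in> R \<and> 1 \<in> R \<and> (\<forall>a\<in>R. \<forall>b\<in>R. a + b \<in> R \<and> a * b \<in> R) \<and> (\<forall>a\<in>R. - a \<in> R)"

lemma is_subring_UNIV [simp]: "is_subring UNIV"
  by (simp add: is_subring_def)

lemma is_subring_O [simp]: "is_subring O_inf"
  unfolding is_subring_def using O_inf_add O_inf_mult O_inf_uminus by (metis O_inf_0 O_inf_1)

lemma is_subring_A [simp]: "is_subring (range poly_to_fls)"
proof -
  have "- poly_to_fls a = poly_to_fls (- a)" for a :: "'k poly"
    by (metis add_eq_0_iff add.right_inverse poly_to_fls_0 poly_to_fls_add)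
  moreover have "0 = poly_to_fls (0 :: 'k poly)" "1 = poly_to_fls (1 :: 'k poly)" by simp_all
  ultimately show ?thesis
    unfolding is_subring_def by (auto simp flip: poly_to_fls_add poly_to_fls_mult simp del: poly_to_fls_0 poly_to_fls_1)
qed

lemma comb_cong: "(\<And>i. i < d \<Longrightarrow> c i = c' i) \<Longrightarrow> comb d c w = comb d c' w"
  by (simp add: comb_def)

lemma comb_add: "comb d (\<lambda>i. c i + c' i) w = comb d c w + comb d c' w"
  by (simp add: comb_def scale_left_distrib sum.distrib)

lemma comb_diff: "comb d (\<lambda>i. c i - c' i) w = comb d c w - comb d c' w"
  by (simp add: comb_def scale_left_diff_distrib sum_subtractf)

lemma comb_scale: "comb d (\<lambda>i. a * c i) w = scale a (comb d c w)"
  by (simp add: comb_def scale_sum_right)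

lemma comb_rescale: "comb d c (\<lambda>i. scale (a i) (w i)) = comb d (\<lambda>i. c i * a i) w"
  by (simp add: comb_def)

lemma comb_unique:
  assumes "indep d w" "comb d c w = comb d c' w" "i < d"
  shows "c i = c' i"
proof -
  have "comb d (\<lambda>i. c i - c' i) w = 0" using assms by (simp add: comb_diff)
  then show ?thesis using assms unfolding indep_def by fastforce
qed

lemma combsI: "(\<And>i. i < d \<Longrightarrow> c i \<in> R) \<Longrightarrow> comb d c w \<in> combs R d w"
  unfolding combs_def by blast

lemma combs_0: "is_subring R \<Longrightarrow> 0 \<in> combs R d w"
  using combsI[of d "\<lambda>_. 0" R w] by (simp add: is_subring_def comb_def)

lemma combs_add:
  assumes "is_subring R" "x \<in> combs R d w" "y \<in> combs R d w"
  shows "x + y \<in> combs R d w"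
proof -
  obtain a b where "x = comb d a w" "y = comb d b w" "\<forall>i<d. a i \<in> R \<and> b i \<in> R"
    using assms unfolding combs_def by blast
  then show ?thesis
    using assms(1) combsI[of d "\<lambda>i. a i + b i" R w] by (simp add: comb_add is_subring_def)
qed

lemma combs_scale:
  assumes "is_subring R" "r \<in> R" "x \<in> combs R d w"
  shows "scale r x \<in> combs R d w"
proof -
  obtain a where "x = comb d a w" "\<forall>i<d. a i \<in> R"
    using assms unfolding combs_def by blast
  then show ?thesis
    using assms combsI[of d "\<lambda>i. r * a i" R w] by (simp add: comb_scale is_subring_def)
qed

lemma combs_diff:
  assumes "is_subring R" "x \<in> combs R d w" "y \<in> combs R d w"
  shows "x - y \<in> combs R d w"
proof -
  have "scale (- 1) y \<in> combs R d w"
    by (rule combs_scale) (use assms in \<open>auto simp: is_subring_def\<close>)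
  then show ?thesis using combs_add[OF assms(1,2)] by fastforce
qed

lemma combs_generator:
  assumes "is_subring R" "i < d"
  shows "w i \<in> combs R d w"
proof -
  have "comb d (\<lambda>j. if j = i then 1 else 0) w = (\<Sum>j<d. if j = i then w j else 0)"
    unfolding comb_def by (rule sum.cong) auto
  also have "\<dots> = w i" using assms by simp
  finally show ?thesis
    using combsI[of d "\<lambda>j. if j = i then 1 else 0" R w] assms by (simp add: is_subring_def)
qed

lemma combs_closed:
  assumes R: "is_subring R" and "\<And>i. i < d \<Longrightarrow> c i \<in> R" "\<And>i. i < d \<Longrightarrow> x i \<in> combs R e w"
  shows "comb d c x \<in> combs R e w"
proof -
  have "n \<le> d \<Longrightarrow> (\<Sum>i<n. scale (c i) (x i)) \<in> combs R e w" for n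
  proof (induction n)
    case 0
    then show ?case by (simp add: combs_0 R)
  next
    case (Suc n)
    then show ?case
      using assms(2,3)[of n] by (simp add: combs_add combs_scale R)
  qed
  then show ?thesis by (simp add: comb_def)
qed

lemma combs_mono:
  assumes "is_subring R" "\<And>i. i < d \<Longrightarrow> x i \<in> combs R e w"
  shows "combs R d x \<subseteq> combs R e w"
proof
  fix y assume "y \<in> combs R d x"
  then obtain c where "y = comb d c x" "\<forall>i<d. c i \<in> R" unfolding combs_def by blast
  then show "y \<in> combs R e w" using assms by (simp add: combs_closed)
qed

section \<open>Exchanging one vector of a basis\<close>

lemma comb_update:
  assumes "j < d"
  shows "comb d c (w(j := u)) = scale (c j) u + comb d (c(j := 0)) w"
proof -
  have "comb d c (w(j := u)) = scale (c j) u + (\<Sum>i\<in>{..<d} - {j}. scale (c i) (w i))"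
    unfolding comb_def using assms by (simp add: sum.remove[of "{..<d}" j])
  also have "(\<Sum>i\<in>{..<d} - {j}. scale (c i) (w i)) = comb d (c(j := 0)) w"
    unfolding comb_def using assms by (simp add: sum.remove[of "{..<d}" j])
  finally show ?thesis .
qed

text \<open>A relation \<open>c\<close> of the new family is the relation c_j a + c of the old one,
  with entry j of the summand c removed. Its entry j reads c_j a_j = 0, which kills c_j and then
  everything else.\<close>

lemma indep_update:
  assumes "indep d w" "j < d" "a j \<noteq> 0"
  shows "indep d (w(j := comb d a w))"
  unfolding indep_def
proof (intro allI impI)
  fix c i assume *: "comb d c (w(j := comb d a w)) = 0" "i < d"
  then have "comb d (\<lambda>i. c j * a i + (c(j := 0)) i) w = 0"
    by (simp add: comb_update assms comb_add comb_scale del: fun_upd_apply)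
  then have **: "c j * a i + (c(j := 0)) i = 0" if "i < d" for i
    using assms(1) that unfolding indep_def by blast
  then have "c j = 0" using **[OF assms(2)] assms(3) by simp
  then show "c i = 0" using **[OF \<open>i < d\<close>] by (cases "i = j") auto
qed

text \<open>The change of basis is invertible over \<open>R\<close> because a_j is a unit of
  \<open>R\<close>. In the reduction \<open>R\<close> consists of the polynomials and a_j is a
  nonzero constant.\<close>

lemma combs_update:
  assumes R: "is_subring R" and j: "j < d" "a j \<noteq> 0"
    and a: "\<And>i. i < d \<Longrightarrow> a i \<in> R" and inv: "inverse (a j) \<in> R"
  shows "combs R d (w(j := comb d a w)) = combs R d w"
proof
  let ?w = "w(j := comb d a w)"
  show "combs R d ?w \<subseteq> combs R d w"
    by (rule combs_mono) (use R a in \<open>auto intro: combs_generator combsI\<close>)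
  show "combs R d w \<subseteq> combs R d ?w"
  proof (rule combs_mono[OF R])
    fix i assume i: "i < d"
    show "w i \<in> combs R d ?w"
    proof (cases "i = j")
      case False
      then show ?thesis using combs_generator[OF R i, of ?w] by simp
    next
      case True
      \<comment> \<open>These coefficients solve u = a_0 w_0 + ... for w_j, where u is the new
        vector: w_j is the inverse of a_j times (u - the sum of a_i w_i over i different from
        j).\<close>
      define c where "c = (\<lambda>i. if i = j then inverse (a j) else - inverse (a j) * a i)"
      have "comb d c ?w = scale (inverse (a j)) (comb d a w) + comb d (c(j := 0)) w"
        by (simp add: comb_update j c_def)
      also have "\<dots> = comb d (\<lambda>i. inverse (a j) * a i + (c(j := 0)) i) w"
        by (simp add: comb_add comb_scale del: fun_upd_apply)
      also have "\<dots> = comb d (\<lambda>i. if i = j then 1 else 0) w"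
        by (rule comb_cong) (use j in \<open>auto simp: c_def\<close>)
      also have "\<dots> = (\<Sum>i<d. if i = j then w i else 0)"
        unfolding comb_def by (rule sum.cong) auto
      also have "\<dots> = w j" using j by simp
      finally have "w j = comb d c ?w" ..
      moreover have "c i \<in> R" if "i < d" for i
        using R a[OF that] inv by (auto simp: c_def is_subring_def)
      ultimately show ?thesis using combsI[of d c R ?w] True by simp
    qed
  qed
qed

text \<open>Expanding the generators \<open>b'\<close> in the basis \<open>b\<close> involves
  finitely many Laurent series, so one power of \<pi> clears all their poles, and with them those of
  every integral combination. This \<open>m\<close> is the bound for the exponents in the
  reduction.\<close>

lemma O_coords_bounded:
  assumes b: "combs UNIV d b = UNIV" and ind: "indep d b"
  shows "\<exists>m. \<forall>c i. comb d c b \<in> combs O_inf d b' \<longrightarrow> i < d \<longrightarrow> fls_X powi (int m) * c i \<in> O_inf"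
proof -
  have "\<exists>g. \<forall>j. b' j = comb d (g j) b"
    by (rule choice) (use b in \<open>auto simp: combs_def\<close>)
  then obtain g where g: "\<And>j. b' j = comb d (g j) b" by blast
  obtain m where "\<forall>(i, j)\<in>{..<d} \<times> {..<d}. fls_X powi (int m) * g j i \<in> O_inf"
    using ex_X_powi_O_inf[of "{..<d} \<times> {..<d}" "\<lambda>(i, j). g j i"] by (auto simp: case_prod_beta)
  then have m: "fls_X powi (int m) * g j i \<in> O_inf" if "i < d" "j < d" for i j
    using that by blast
  have "fls_X powi (int m) * c i \<in> O_inf" if c: "comb d c b \<in> combs O_inf d b'" and i: "i < d" for c i
  proof -
    obtain f where f: "comb d c b = comb d f b'" "\<forall>j<d. f j \<in> O_inf"
      using c unfolding combs_def by blast
    have "scale (fls_X powi (int m)) (comb d f b') = comb d f (\<lambda>j. comb d (\<lambda>i. fls_X powi (int m) * g j i) b)"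
      by (simp add: comb_scale comb_def[of d f] scale_sum_right mult.commute flip: g
          del: fls_X_power_int)
    also have "\<dots> \<in> combs O_inf d b"
      by (rule combs_closed) (use f m in \<open>auto intro!: combsI\<close>)
    finally obtain e where "comb d (\<lambda>i. fls_X powi (int m) * c i) b = comb d e b" "\<forall>i<d. e i \<in> O_inf"
      using f by (auto simp only: comb_scale combs_def)
    then show ?thesis using comb_unique[OF ind] i by metis
  qed
  then show ?thesis by blast
qed

text \<open>In terms of matrices this is Birkhoff factorisation: the matrix relating
  \<open>b\<close> and \<open>b'\<close> becomes a diagonal matrix of powers of \<pi> after base
  changes invertible over the polynomials on one side and over the power series on the
  other.\<close>

lemma exists_adapted_family:
  fixes b b' :: "nat \<Rightarrow> 'v"
  assumes b: "indep d b" "combs UNIV d b = UNIV"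
    and b': "combs UNIV d b' = UNIV"
  shows "\<exists>w n. indep d w \<and> combs UNIV d w = UNIV \<and>
    combs (range poly_to_fls) d w = combs (range poly_to_fls) d b \<and>
    combs O_inf d (\<lambda>i. scale (fls_X powi - n i) (w i)) = combs O_inf d b'"
proof -
  define L where "L = combs (range poly_to_fls) d b"
  define M where "M = combs O_inf d b'"
  define P where "P = (\<lambda>(w, n). indep d w \<and> combs UNIV d w = UNIV \<and>
    combs (range poly_to_fls) d w = L \<and> (\<forall>i<d. scale (fls_X powi - n i) (w i) \<in> M))"
  obtain m where m: "\<And>c i. comb d c b \<in> M \<Longrightarrow> i < d \<Longrightarrow> fls_X powi (int m) * c i \<in> O_inf"
    using O_coords_bounded[OF b(2,1)] unfolding M_def by blast
  \<comment> \<open>Since w_i is nonzero, it has a nonzero polynomial coordinate in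
    \<open>b\<close>, of valuation at most 0. The corresponding coordinate of \<pi>^(-n_i) w_i has
    valuation at least -m by the choice of m, whence n_i \<le> m.\<close>
  have bounded: "n i \<le> int m" if P: "P (w, n)" and i: "i < d" for w n i
  proof -
    have "w i \<in> L" using P i combs_generator[OF is_subring_A i, of w] by (auto simp: P_def)
    then obtain a where a: "w i = comb d a b" "\<forall>j<d. a j \<in> range poly_to_fls"
      unfolding L_def combs_def by blast
    have "\<exists>j<d. a j \<noteq> 0"
    proof (rule ccontr)
      assume "\<not> ?thesis"
      then have "w i = 0" by (simp add: a comb_def)
      then have "comb d (\<lambda>k. if k = i then 1 else 0) w = 0"
        by (auto simp: comb_def intro!: sum.neutral)
      then have "(if i = i then 1 else 0 :: 'k fls) = 0"
        using P i unfolding P_def indep_def by fast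
      then show False by simp
    qed
    then obtain j where j: "j < d" "a j \<noteq> 0" by blast
    have "comb d (\<lambda>j. fls_X powi - n i * a j) b \<in> M"
      using P i by (simp add: P_def comb_scale del: fls_X_power_int flip: a(1))
    then have "fls_X powi (int m) * (fls_X powi - n i * a j) \<in> O_inf"
      using m j by blast
    moreover have "fls_subdegree (a j) \<le> 0"
      using a(2) j by (auto simp: subdegree_poly_to_fls)
    ultimately show ?thesis
      using j by (simp add: O_inf_iff subdegree_fls_X_powi_mult del: fls_X_power_int)
  qed
  \<comment> \<open>A starting point: \<open>b\<close> itself, with all exponents equal to -k, where
    \<pi>^k clears the poles of the coordinates of \<open>b\<close> in \<open>b'\<close>.\<close>
  have "\<exists>n. P (b, n)"
  proof -
    have "\<exists>g. \<forall>i. b i = comb d (g i) b'"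
      by (rule choice) (use b' in \<open>auto simp: combs_def\<close>)
    then obtain g where g: "\<And>i. b i = comb d (g i) b'" by blast
    obtain k where "\<forall>(i, j)\<in>{..<d} \<times> {..<d}. fls_X powi (int k) * g i j \<in> O_inf"
      using ex_X_powi_O_inf[of "{..<d} \<times> {..<d}" "\<lambda>(i, j). g i j"] by (auto simp: case_prod_beta)
    then have "scale (fls_X powi (int k)) (b i) \<in> M" if "i < d" for i
      using that unfolding M_def
      by (subst g, subst comb_scale[symmetric]) (blast intro!: combsI)
    then have "P (b, \<lambda>_. - int k)" by (simp add: P_def b L_def del: fls_X_power_int)
    then show ?thesis by blast
  qed
  \<comment> \<open>Maximising the sum of the exponents is minimising the natural number d m - sum;
    on pairs satisfying \<open>P\<close> this difference is nonnegative, so \<open>nat\<close> loses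
    nothing.\<close>
  then obtain x where "P x" "\<And>y. P y \<Longrightarrow> nat (int (d * m) - sum (snd x) {..<d}) \<le> nat (int (d * m) - sum (snd y) {..<d})"
    using ex_has_least_nat[of P _ "\<lambda>x. nat (int (d * m) - sum (snd x) {..<d})"] by metis
  then obtain w n where P: "P (w, n)"
    and least: "\<And>w' n'. P (w', n') \<Longrightarrow>
      nat (int (d * m) - sum n {..<d}) \<le> nat (int (d * m) - sum n' {..<d})"
    by (metis snd_conv surj_pair)
  have maximal: "sum n' {..<d} \<le> sum n {..<d}" if P': "P (w', n')" for w' n'
  proof -
    have "sum n' {..<d} \<le> (\<Sum>i<d. int m)"
      by (rule sum_mono) (use bounded[OF P'] in auto)
    then show ?thesis using least[OF P'] by simp
  qed
  from P have w: "indep d w" "combs UNIV d w = UNIV" "combs (range poly_to_fls) d w = L"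
    and wM: "\<And>i. i < d \<Longrightarrow> scale (fls_X powi - n i) (w i) \<in> M"
    by (auto simp: P_def)
  define v where "v = (\<lambda>i. scale (fls_X powi - n i) (w i))"
  have no_relation: "c i = 0"
    if rel: "comb d (\<lambda>i. fls_const (c i)) v = scale fls_X z" and z: "z \<in> M" and i: "i < d" for c z i
  proof (rule ccontr)
    assume "c i \<noteq> 0"
    define S where "S = {i. i < d \<and> c i \<noteq> 0}"
    have "finite S" "S \<noteq> {}" using \<open>c i \<noteq> 0\<close> i by (auto simp: S_def)
    then obtain j where j: "j \<in> S" and min: "\<And>i. i \<in> S \<Longrightarrow> n j \<le> n i"
      using ex_is_arg_min_if_finite[of S n] by (force simp: is_arg_min_linorder)
    \<comment> \<open>Scaled so that \<pi>^(-n_j) times the combination of the w_i with coefficients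
      a_i is the combination of the v_i with coefficients c_i. As n_j is least on the support of c,
      a_i is c_i T^(n_i - n_j), a polynomial, and a_j = c_j is a unit.\<close>
    define a where "a = (\<lambda>i. fls_const (c i) * fls_X powi (n j - n i))"
    have aA: "a i \<in> range poly_to_fls" if "i < d" for i
    proof (cases "c i = 0")
      case True
      then have "a i = poly_to_fls 0" by (simp add: a_def)
      then show ?thesis by blast
    next
      case False
      then have "n j \<le> n i" using min that by (simp add: S_def)
      then have "a i = poly_to_fls (Polynomial.smult (c i) (monom 1 (nat (n i - n j))))"
        by (simp add: a_def poly_to_fls_smult poly_to_fls_T_power del: fls_X_power_int)
      then show ?thesis by blast
    qed
    have aj: "a j = fls_const (c j)" by (simp add: a_def)
    then have aj0: "a j \<noteq> 0" using j by (simp add: S_def)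
    have ajinv: "inverse (a j) \<in> range poly_to_fls"
    proof -
      have "inverse (a j) = poly_to_fls [:inverse (c j):]"
        by (simp add: aj poly_to_fls_const fls_inverse_const)
      then show ?thesis by blast
    qed
    have jd: "j < d" using j by (simp add: S_def)
    \<comment> \<open>The relation says that the combination of the v_i is \<pi> z, so the new
      vector admits one further division by \<pi>: the result is z, which lies in \<open>M\<close>.
      The exponent at j grows by one, against maximality.\<close>
    let ?w = "w(j := comb d a w)" and ?n = "n(j := n j + 1)"
    have "scale (fls_X powi - (n j + 1)) (comb d a w) = z"
    proof -
      have "scale (fls_X powi - (n j + 1)) (comb d a w)
          = comb d (\<lambda>i. fls_X powi - (n j + 1) * a i) w" by (simp only: comb_scale)
      also have "\<dots> = comb d (\<lambda>i. fls_X powi - 1 * (fls_const (c i) * fls_X powi - n i)) w"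
      proof (rule comb_cong)
        fix i
        have "(fls_X powi - (n j + 1) * fls_X powi (n j - n i) :: 'k fls) = fls_X powi - 1 * fls_X powi - n i"
          by (simp only: fls_X_powi_add[symmetric]) simp
        then show "fls_X powi - (n j + 1) * a i = fls_X powi - 1 * (fls_const (c i) * fls_X powi - n i)"
          unfolding a_def by (metis mult.left_commute)
      qed
      also have "\<dots> = scale (fls_X powi - 1) (comb d (\<lambda>i. fls_const (c i)) v)"
        by (simp only: comb_scale v_def comb_rescale)
      also have "\<dots> = scale (fls_X powi - 1 * fls_X) z" by (simp only: rel scale_scale)
      also have "(fls_X powi - 1 * fls_X :: 'k fls) = 1"
        by (simp add: power_int_minus del: fls_X_power_int)
      finally show ?thesis by simp
    qed
    then have "P (?w, ?n)"
      unfolding P_def using w wM z jd aj0 aA ajinv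
      by (simp add: indep_update combs_update del: fls_X_power_int)
    then have "sum ?n {..<d} \<le> sum n {..<d}" by (rule maximal)
    moreover have "sum ?n {..<d} = sum n {..<d} + 1"
      using jd by (simp add: sum.remove[of "{..<d}" j])
    ultimately show False by simp
  qed
  \<comment> \<open>Let -r be the least valuation of a coordinate of y, and suppose r \<ge> 1. Then
    \<pi>^r f has integral entries, one of them a unit, while \<pi>^(r-1) y still lies in
    \<open>M\<close>; so the constant terms give a forbidden relation modulo \<pi>.\<close>
  have coords: "f i \<in> O_inf" if y: "comb d f v \<in> M" and i: "i < d" for f i
  proof (rule ccontr)
    assume "f i \<notin> O_inf"
    define S where "S = {i. i < d \<and> f i \<noteq> 0}"
    have "i \<in> S" using i \<open>f i \<notin> O_inf\<close> by (auto simp: S_def)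
    moreover have "finite S" by (simp add: S_def)
    ultimately obtain j where j: "j \<in> S"
      and min: "\<And>i. i \<in> S \<Longrightarrow> fls_subdegree (f j) \<le> fls_subdegree (f i)"
      using ex_is_arg_min_if_finite[of S "\<lambda>i. fls_subdegree (f i)"]
      by (force simp: is_arg_min_linorder)
    define r where "r = - fls_subdegree (f j)"
    have "r \<ge> 1"
      using min[OF \<open>i \<in> S\<close>] \<open>f i \<notin> O_inf\<close> by (simp add: r_def O_inf_iff)
    have jd: "j < d" "f j \<noteq> 0" using j by (simp_all add: S_def)
    define e where "e = (\<lambda>i. fls_X powi r * f i)"
    have eO: "e i \<in> O_inf" if "i < d" for i
      using min[of i] that unfolding O_inf_iff r_def e_def S_def
      by (cases "f i = 0") (simp_all add: subdegree_fls_X_powi_mult del: fls_X_power_int)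
    define c where "c = (\<lambda>i. fls_nth (e i) 0)"
    have "e j \<noteq> 0" "fls_subdegree (e j) = 0"
      using jd by (simp_all add: e_def r_def subdegree_fls_X_powi_mult del: fls_X_power_int)
    then have "c j \<noteq> 0" unfolding c_def by (metis nth_fls_subdegree_nonzero)
    \<comment> \<open>What remains of \<pi>^r f_i after removal of the constant term is divisible by
      \<pi>, and q_i is the quotient. Therefore \<pi> z, for the z defined below, is the combination
      of the v_i with the constant terms as coefficients.\<close>
    define q where "q = (\<lambda>i. fls_X powi - 1 * (e i - fls_const (c i)))"
    have qO: "q i \<in> O_inf" if "i < d" for i
    proof (cases "e i - fls_const (c i) = 0")
      case False
      have "0 < fls_subdegree (e i - fls_const (c i))"
      proof (rule fls_subdegree_greaterI[OF False])
        fix k :: int assume "k \<le> 0"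
        then show "fls_nth (e i - fls_const (c i)) k = 0"
          using eO[OF that] by (cases "k = 0") (auto simp: c_def)
      qed
      then show ?thesis
        using False by (simp add: q_def O_inf_iff subdegree_fls_X_powi_mult del: fls_X_power_int)
    qed (simp add: q_def)
    define z where "z = scale (fls_X powi (r - 1)) (comb d f v) - comb d q v"
    have "z \<in> M"
    proof -
      have "scale (fls_X powi (r - 1)) (comb d f v) \<in> M"
        using y \<open>r \<ge> 1\<close> unfolding M_def
        by (intro combs_scale is_subring_O O_inf_X_powi[THEN iffD2]) simp_all
      moreover have "comb d q v \<in> M"
        unfolding M_def
        by (rule combs_closed) (use qO wM in \<open>auto simp: M_def v_def\<close>)
      ultimately show ?thesis
        unfolding z_def M_def by (intro combs_diff is_subring_O)
    qed
    moreover have "comb d (\<lambda>i. fls_const (c i)) v = scale fls_X z"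
    proof -
      have "scale fls_X z = comb d (\<lambda>i. fls_X * (fls_X powi (r - 1) * f i - q i)) v"
        by (simp only: z_def comb_scale comb_diff)
      also have "\<dots> = comb d (\<lambda>i. fls_const (c i)) v"
      proof (rule comb_cong)
        fix i
        have "fls_X * fls_X powi (r - 1) = (fls_X powi r :: 'k fls)"
          using fls_X_powi_add[of 1 "r - 1", where ?'k = 'k] by (simp del: fls_X_power_int)
        moreover have "fls_X * fls_X powi - 1 = (1 :: 'k fls)"
          by (simp add: power_int_minus del: fls_X_power_int)
        ultimately show "fls_X * (fls_X powi (r - 1) * f i - q i) = fls_const (c i)"
          by (simp add: q_def e_def right_diff_distrib del: fls_X_power_int flip: mult.assoc)
      qed
      finally show ?thesis ..
    qed
    ultimately show False using no_relation jd \<open>c j \<noteq> 0\<close> by blast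
  qed
  have "combs O_inf d v = M"
  proof
    show "combs O_inf d v \<subseteq> M"
      unfolding M_def by (rule combs_mono) (use wM in \<open>auto simp: M_def v_def\<close>)
    show "M \<subseteq> combs O_inf d v"
    proof
      fix y assume y: "y \<in> M"
      obtain c where c: "y = comb d c w" using w(2) unfolding combs_def by blast
      have "y = comb d (\<lambda>i. c i * fls_X powi n i) v"
        unfolding c v_def comb_rescale
        by (rule comb_cong) (simp add: power_int_minus field_simps del: fls_X_power_int)
      then show "y \<in> combs O_inf d v" using coords y combsI by metis
    qed
  qed
  then show ?thesis using w unfolding v_def L_def M_def by blast
qed

section \<open>From coefficient families back to bases of lattices\<close>

lemma module_scale_A: "Modules.module (scale_A scale)"
  by unfold_locales
    (simp_all add: scale_A_def poly_to_fls_add poly_to_fls_mult scale_left_distrib scale_right_distrib)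

lemma module_scale_O: "Modules.module (scale_O scale)"
  by unfold_locales
    (simp_all add: scale_O_def fls_times_fps_to_fls scale_left_distrib scale_right_distrib)

lemma combs_range:
  "{\<Sum>i<d. scale (e (c i)) (w i) | c. True} = combs (range e) d w"
proof (intro equalityI subsetI)
  fix x assume "x \<in> combs (range e) d w"
  then obtain a where a: "x = comb d a w" "\<forall>i<d. a i \<in> range e" unfolding combs_def by blast
  then have "\<forall>i. \<exists>c. i < d \<longrightarrow> a i = e c" by blast
  then obtain c where "\<And>i. i < d \<Longrightarrow> a i = e (c i)" by metis
  then have "x = (\<Sum>i<d. scale (e (c i)) (w i))" by (simp add: a comb_def)
  then show "x \<in> {\<Sum>i<d. scale (e (c i)) (w i) | c. True}" by blast
qed (auto simp: combs_def comb_def)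

lemma family_basis_iff_indep: "family_basis scale d w UNIV \<longleftrightarrow> indep d w \<and> combs UNIV d w = UNIV"
  unfolding family_basis_iff using combs_range[where e = "\<lambda>x. x" and d = d and w = w] by (auto simp: indep_def comb_def)

lemma family_basis_A: "indep d w \<Longrightarrow> family_basis (scale_A scale) d w (combs (range poly_to_fls) d w)"
  unfolding module.family_basis_iff[OF module_scale_A] unfolding scale_A_def combs_range
proof (intro conjI allI impI refl)
  fix c i assume "indep d w" "(\<Sum>i<d. scale (poly_to_fls (c i)) (w i)) = 0" "i < d"
  then have "poly_to_fls (c i) = 0"
    unfolding indep_def comb_def by (elim allE[of _ "\<lambda>i. poly_to_fls (c i)"]) blast
  then show "c i = 0" by simp
qed

lemma family_basis_O: "indep d w \<Longrightarrow> family_basis (scale_O scale) d w (combs O_inf d w)"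
  unfolding module.family_basis_iff[OF module_scale_O] unfolding scale_O_def combs_range
proof (intro conjI allI impI refl)
  fix c i assume "indep d w" "(\<Sum>i<d. scale (fps_to_fls (c i)) (w i)) = 0" "i < d"
  then have "fps_to_fls (c i) = 0"
    unfolding indep_def comb_def by (elim allE[of _ "\<lambda>i. fps_to_fls (c i)"]) blast
  then show "c i = 0" by simp
qed

lemma indep_rescale:
  assumes "indep d w" "\<And>i. i < d \<Longrightarrow> a i \<noteq> 0"
  shows "indep d (\<lambda>i. scale (a i) (w i))"
  unfolding indep_def comb_rescale
proof (intro allI impI)
  fix c i assume *: "comb d (\<lambda>i. c i * a i) w = 0" "i < d"
  then have "c i * a i = 0"
    using assms(1)[unfolded indep_def, rule_format, of "\<lambda>i. c i * a i" i] by blast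
  then show "c i = 0" using assms(2) * by simp
qed

end

text \<open>The lattice predicates supply an arbitrary set as basis; it is independent, hence
  finite, and all bases have the same cardinality, so it can be enumerated by the indices below the
  dimension.\<close>

lemma (in finite_dimensional_vector_space) basis_as_family:
  assumes "independent B" "span B = UNIV"
  obtains b where "family_basis scale (card Basis) b UNIV" "B = b ` {..<card Basis}"
    "inj_on b {..<card Basis}"
proof -
  have "finite B" using assms(1) by (rule finiteI_independent)
  have "card B = card Basis"
    using assms dim_eq_card[of B UNIV] by (simp add: dim_UNIV dimension_def)
  then obtain b where "bij_betw b {..<card Basis} B"
    using ex_bij_betw_nat_finite[OF \<open>finite B\<close>] by (metis atLeast0LessThan)
  then have b: "inj_on b {..<card Basis}" "b ` {..<card Basis} = B"
    by (simp_all add: bij_betw_def)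
  have "family_basis scale (card Basis) b UNIV"
    unfolding family_basis_def b(2) using b(1) assms by blast
  then show thesis using that b by blast
qed

lemma exists_adapted_basis:
  fixes scale :: "'k::field fls \<Rightarrow> 'v::ab_group_add \<Rightarrow> 'v"
  assumes "finite_dimensional_vector_space scale Basis"
    and d: "card Basis = d"
    and L: "A_lattice scale L"
    and M: "O_lattice scale M"
  shows "\<exists>w n. fls_space.indep scale d w \<and> fls_space.combs scale UNIV d w = UNIV \<and>
    L = fls_space.combs scale (range poly_to_fls) d w \<and>
    M = fls_space.combs scale O_inf d (\<lambda>i. scale (fls_X powi - n i) (w i))"
proof -
  interpret finite_dimensional_vector_space scale Basis by fact
  interpret fls_space scale by unfold_locales
  obtain B where B: "independent B" "span B = UNIV" "L = module.span (scale_A scale) B"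
    using L unfolding A_lattice_def by blast
  obtain b where b: "family_basis scale d b UNIV" "B = b ` {..<d}"
    using basis_as_family[OF B(1,2)] unfolding d by metis
  have L': "L = combs (range poly_to_fls) d b"
    using family_basis_A b B(3) unfolding family_basis_iff_indep by (metis family_basis_def)
  obtain C where C: "independent C" "span C = UNIV" "M = module.span (scale_O scale) C"
    using M unfolding O_lattice_def by blast
  obtain c where c: "family_basis scale d c UNIV" "C = c ` {..<d}"
    using basis_as_family[OF C(1,2)] unfolding d by metis
  have M': "M = combs O_inf d c"
    using family_basis_O c C(3) unfolding family_basis_iff_indep by (metis family_basis_def)
  obtain w n where "indep d w" "combs UNIV d w = UNIV"
    "combs (range poly_to_fls) d w = combs (range poly_to_fls) d b"
    "combs O_inf d (\<lambda>i. scale (fls_X powi - n i) (w i)) = combs O_inf d c"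
    using exists_adapted_family[of d b c] b(1) c(1) unfolding family_basis_iff_indep by blast
  then show ?thesis
    unfolding L' M' by (intro exI[of _ w] exI[of _ n]) simp
qed

section \<open>Open sets and local rings of the projective line\<close>

lemma cring_poly_ring: "cring (poly_ring :: 'k::field poly ring)"
proof (intro cringI abelian_groupI comm_monoidI)
  fix x :: "'k poly" assume "x \<in> carrier poly_ring"
  show "\<exists>y\<in>carrier poly_ring. y \<oplus>\<^bsub>poly_ring\<^esub> x = \<zero>\<^bsub>poly_ring\<^esub>"
    by (rule bexI[of _ "- x"]) (simp_all add: poly_ring_def)
qed (simp_all add: poly_ring_def algebra_simps)

lemma poly_ring_uminus: "\<ominus>\<^bsub>poly_ring\<^esub> x = - (x :: 'k::field poly)"
proof -
  interpret cring "poly_ring :: 'k poly ring" by (rule cring_poly_ring)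
  show ?thesis by (rule minus_equality) (simp_all add: poly_ring_def)
qed

text \<open>Unfolds the carrier-based notion of a prime ideal of \<open>poly_ring\<close> into plain
  polynomial arithmetic; later arguments on points of Spec A rest on this form.\<close>

lemma Spec_A_iff:
  "P \<in> Spec_A \<longleftrightarrow> 0 \<in> P \<and> 1 \<notin> P \<and> (\<forall>a\<in>P. \<forall>b\<in>P. a + b \<in> P) \<and> (\<forall>a\<in>P. \<forall>c. c * a \<in> P) \<and>
     (\<forall>a b. a * b \<in> P \<longrightarrow> a \<in> P \<or> b \<in> P)"
proof
  assume "P \<in> Spec_A"
  then interpret primeideal P poly_ring by (simp add: Spec_A_def)
  show "0 \<in> P \<and> 1 \<notin> P \<and> (\<forall>a\<in>P. \<forall>b\<in>P. a + b \<in> P) \<and> (\<forall>a\<in>P. \<forall>c. c * a \<in> P) \<and>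
     (\<forall>a b. a * b \<in> P \<longrightarrow> a \<in> P \<or> b \<in> P)"
    using additive_subgroup.zero_closed[OF additive_subgroup_axioms]
      additive_subgroup.a_closed[OF additive_subgroup_axioms] I_l_closed I_prime I_notcarr one_imp_carrier
    by (auto simp: poly_ring_def)
next
  assume *: "0 \<in> P \<and> 1 \<notin> P \<and> (\<forall>a\<in>P. \<forall>b\<in>P. a + b \<in> P) \<and> (\<forall>a\<in>P. \<forall>c. c * a \<in> P) \<and>
     (\<forall>a b. a * b \<in> P \<longrightarrow> a \<in> P \<or> b \<in> P)"
  interpret cring "poly_ring :: 'a poly ring" by (rule cring_poly_ring)
  have neg: "- a \<in> P" if "a \<in> P" for a using * that by (metis mult_minus1)
  have "ideal P poly_ring"
  proof (rule idealI)
    show "subgroup P (add_monoid poly_ring)"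
    proof
      fix a assume a: "a \<in> P"
      have "inv\<^bsub>add_monoid poly_ring\<^esub> a = - a"
        using poly_ring_uminus[of a] unfolding a_inv_def .
      then show "inv\<^bsub>add_monoid poly_ring\<^esub> a \<in> P" using neg[OF a] by simp
    qed (use * in \<open>auto simp: poly_ring_def\<close>)
    show "ring poly_ring" using cring_poly_ring by (rule cring.axioms(1))
  qed (use * in \<open>auto simp: poly_ring_def mult.commute\<close>)
  then have "primeideal P poly_ring"
    by (rule primeidealI) (use * cring_poly_ring in \<open>auto simp: poly_ring_def\<close>)
  then show "P \<in> Spec_A" by (simp add: Spec_A_def)
qed

lemma zero_ideal_in_Spec_A [simp]: "{0} \<in> Spec_A"
  by (simp add: Spec_A_iff)

lemma Spec_A_0 [simp]: "P \<in> Spec_A \<Longrightarrow> 0 \<in> P" and Spec_A_1 [simp]: "P \<in> Spec_A \<Longrightarrow> 1 \<notin> P"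
  by (simp_all add: Spec_A_iff)

lemma Spec_A_uminus: "P \<in> Spec_A \<Longrightarrow> a \<in> P \<Longrightarrow> - a \<in> P"
  by (metis Spec_A_iff mult_minus1)

lemma Spec_A_mult: "P \<in> Spec_A \<Longrightarrow> a * b \<in> P \<longleftrightarrow> a \<in> P \<or> b \<in> P"
  by (metis Spec_A_iff mult.commute)

text \<open>The principal open subset D(b) of Spec A.\<close>

definition basic_open :: "'k::field poly \<Rightarrow> 'k point set" where
  "basic_open b = {Fin P | P. P \<in> Spec_A \<and> b \<notin> P}"

lemma Fin_in_P1: "Fin P \<in> P1 \<longleftrightarrow> P \<in> Spec_A"
  by (auto simp: P1_def affine_line_def)

lemma Fin_in_affine_line: "Fin P \<in> affine_line \<longleftrightarrow> P \<in> Spec_A"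
  by (auto simp: affine_line_def)

lemma Infty_notin_affine_line [simp]: "Infty \<notin> affine_line"
  by (auto simp: affine_line_def)

lemma Infty_in_P1 [simp]: "Infty \<in> P1"
  by (simp add: P1_def)

lemma generic_in_P1 [simp]: "generic \<in> P1"
  by (simp add: Fin_in_P1)

lemma affine_line_subset: "affine_line \<subseteq> P1"
  by (auto simp: P1_def)

lemma Fin_in_basic_open: "Fin P \<in> basic_open b \<longleftrightarrow> P \<in> Spec_A \<and> b \<notin> P"
  by (simp add: basic_open_def)

lemma Infty_notin_basic_open [simp]: "Infty \<notin> basic_open b"
  by (simp add: basic_open_def)

lemma basic_open_subset: "basic_open b \<subseteq> affine_line"
  by (auto simp: basic_open_def affine_line_def)

lemma generic_in_basic_open: "b \<noteq> 0 \<Longrightarrow> generic \<in> basic_open b"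
  by (simp add: Fin_in_basic_open)

lemma basic_open_mult: "basic_open (a * b) = basic_open a \<inter> basic_open b"
proof (rule Set.set_eqI)
  fix p show "p \<in> basic_open (a * b) \<longleftrightarrow> p \<in> basic_open a \<inter> basic_open b"
    by (cases p) (auto simp: Fin_in_basic_open Spec_A_mult)
qed

text \<open>Every finite point of an open set has a principal neighbourhood D(b) inside it, with b
  nonzero; thus a nonempty trace on Spec A contains the generic point. Conversely, all b with D(b)
  inside \<open>U\<close> together serve as the set \<open>S\<close> of the definition.\<close>

lemma P1_open_iff:
  "P1_open U \<longleftrightarrow> U \<subseteq> P1 \<and> (\<forall>P. Fin P \<in> U \<longrightarrow> (\<exists>b. b \<notin> P \<and> basic_open b \<subseteq> U)) \<and>
     (Infty \<in> U \<longrightarrow> generic \<in> U)"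
proof
  assume "P1_open U"
  then obtain S where U: "U \<subseteq> P1" "U \<inter> affine_line = Fin ` {P \<in> Spec_A. \<not> S \<subseteq> P}"
    "Infty \<in> U \<longrightarrow> U \<inter> affine_line \<noteq> {}"
    unfolding P1_open_def by blast
  have *: "\<exists>b. b \<notin> P \<and> b \<in> S \<and> basic_open b \<subseteq> U" if "Fin P \<in> U" for P
  proof -
    have "Fin P \<in> U \<inter> affine_line" using that U(1) by (auto simp: P1_def)
    then have "\<not> S \<subseteq> P" unfolding U(2) by blast
    then obtain b where "b \<in> S" "b \<notin> P" by blast
    moreover have "basic_open b \<subseteq> U \<inter> affine_line"
      unfolding U(2) basic_open_def using \<open>b \<in> S\<close> by blast
    ultimately show ?thesis by blast
  qed
  moreover have "generic \<in> U" if inf: "Infty \<in> U"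
  proof -
    obtain P where P: "Fin P \<in> U" "P \<in> Spec_A"
      using U(3) inf unfolding affine_line_def by blast
    then obtain b where "b \<notin> P" "basic_open b \<subseteq> U" using * by blast
    moreover from this have "b \<noteq> 0" using P by auto
    ultimately show ?thesis using generic_in_basic_open[of b] by blast
  qed
  ultimately show "U \<subseteq> P1 \<and> (\<forall>P. Fin P \<in> U \<longrightarrow> (\<exists>b. b \<notin> P \<and> basic_open b \<subseteq> U)) \<and>
     (Infty \<in> U \<longrightarrow> generic \<in> U)"
    using U(1) by blast
next
  assume *: "U \<subseteq> P1 \<and> (\<forall>P. Fin P \<in> U \<longrightarrow> (\<exists>b. b \<notin> P \<and> basic_open b \<subseteq> U)) \<and>
     (Infty \<in> U \<longrightarrow> generic \<in> U)"
  have "U \<inter> affine_line = Fin ` {P \<in> Spec_A. \<not> {b. basic_open b \<subseteq> U} \<subseteq> P}"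
  proof (rule Set.set_eqI)
    fix p show "p \<in> U \<inter> affine_line \<longleftrightarrow> p \<in> Fin ` {P \<in> Spec_A. \<not> {b. basic_open b \<subseteq> U} \<subseteq> P}"
    proof (cases p)
      case (Fin P)
      have "Fin P \<in> U" if "P \<in> Spec_A" "b \<notin> P" "basic_open b \<subseteq> U" for b
        using that Fin_in_basic_open by blast
      then have "(Fin P \<in> U \<and> P \<in> Spec_A) \<longleftrightarrow> (P \<in> Spec_A \<and> (\<exists>b. basic_open b \<subseteq> U \<and> b \<notin> P))"
        using * by blast
      moreover have "Fin P \<in> U \<inter> affine_line \<longleftrightarrow> Fin P \<in> U \<and> P \<in> Spec_A"
        by (simp add: Fin_in_affine_line)
      moreover have "Fin P \<in> Fin ` {P \<in> Spec_A. \<not> {b. basic_open b \<subseteq> U} \<subseteq> P} \<longleftrightarrow>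
          P \<in> Spec_A \<and> (\<exists>b. basic_open b \<subseteq> U \<and> b \<notin> P)"
        by (simp add: image_iff subset_iff)
      ultimately show ?thesis unfolding Fin by (simp only:)
    qed (simp add: image_iff)
  qed
  moreover have "generic \<in> affine_line" by (simp add: Fin_in_affine_line)
  ultimately show "P1_open U" unfolding P1_open_def using * by blast
qed

lemma ex_basic_open: "P1_open U \<Longrightarrow> Fin P \<in> U \<Longrightarrow> \<exists>b. b \<notin> P \<and> basic_open b \<subseteq> U"
  by (simp add: P1_open_iff)

lemma P1_open_subset: "P1_open U \<Longrightarrow> U \<subseteq> P1"
  by (simp add: P1_open_def)

lemma P1_open_P1 [simp]: "P1_open P1"
proof -
  have "basic_open 1 \<subseteq> P1" by (auto simp: basic_open_def Fin_in_P1)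
  then show ?thesis by (auto simp: P1_open_iff Fin_in_P1 intro!: exI[of _ 1])
qed

lemma P1_open_basic_open [simp]: "P1_open (basic_open b)"
  unfolding P1_open_iff by (auto simp: basic_open_def Fin_in_P1)

lemma basic_open_1: "basic_open 1 = affine_line"
proof (rule Set.set_eqI)
  fix p show "p \<in> basic_open 1 \<longleftrightarrow> p \<in> affine_line"
    by (cases p) (auto simp: Fin_in_basic_open Fin_in_affine_line)
qed

lemma P1_open_affine_line [simp]: "P1_open affine_line"
  by (metis P1_open_basic_open basic_open_1)

lemma P1_open_empty [simp]: "P1_open {}"
  by (simp add: P1_open_iff)

lemma P1_open_Int [intro]:
  assumes "P1_open U" "P1_open W"
  shows "P1_open (U \<inter> W)"
  unfolding P1_open_iff
proof (intro conjI allI impI)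
  fix P assume P: "Fin P \<in> U \<inter> W"
  then obtain a b where "a \<notin> P" "b \<notin> P" "basic_open a \<subseteq> U" "basic_open b \<subseteq> W"
    using assms ex_basic_open by (metis IntD1 IntD2)
  moreover have "P \<in> Spec_A" using P assms by (auto simp: P1_open_iff Fin_in_P1)
  ultimately have "a * b \<notin> P \<and> basic_open (a * b) \<subseteq> U \<inter> W"
    by (auto simp: basic_open_mult Spec_A_mult)
  then show "\<exists>b. b \<notin> P \<and> basic_open b \<subseteq> U \<inter> W" by blast
qed (use assms in \<open>auto simp: P1_open_iff\<close>)

text \<open>Irreducibility of the projective line. It allows sections over any nonempty open set to
  be compared in the generic stalk.\<close>

lemma generic_in_open:
  assumes "P1_open U" "p \<in> U"
  shows "generic \<in> U"
proof (cases p)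
  case (Fin P)
  then obtain b where b: "b \<notin> P" "basic_open b \<subseteq> U" using assms by (auto simp: P1_open_iff)
  have "P \<in> Spec_A" using Fin assms by (auto simp: P1_open_iff Fin_in_P1)
  then have "b \<noteq> 0" using b by auto
  then show ?thesis using b generic_in_basic_open by blast
qed (use assms in \<open>simp add: P1_open_iff\<close>)

lemma open_Int_nonempty: "P1_open U \<Longrightarrow> P1_open W \<Longrightarrow> U \<noteq> {} \<Longrightarrow> W \<noteq> {} \<Longrightarrow> U \<inter> W \<noteq> {}"
  using generic_in_open by blast

text \<open>Induction on the degree: a prime P containing b is generated by an element p of least
  degree. Apart from P itself, a prime containing b = p q must contain q, which has smaller degree.
  Finiteness is used to choose one exponent for all points outside D(b).\<close>

lemma finite_zeros:
  assumes "b \<noteq> 0"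
  shows "finite {P \<in> Spec_A. (b :: 'k::field poly) \<in> P}"
  using assms
proof (induction "degree b" arbitrary: b rule: less_induct)
  case less
  show ?case
  proof (cases "{P \<in> Spec_A. b \<in> P} = {}")
    case True
    then show ?thesis by (simp only: finite.emptyI)
  next
    case False
    then obtain P where P: "P \<in> Spec_A" "b \<in> P" by blast
    \<comment> \<open>Division with remainder by an element of least degree.\<close>
    have gen: "\<exists>q. q \<in> Q \<and> q \<noteq> 0 \<and> (\<forall>a\<in>Q. q dvd a)" if Q: "Q \<in> Spec_A" "c \<in> Q" "c \<noteq> 0"
      for Q and c :: "'k poly"
    proof -
      obtain q where q: "q \<in> Q \<and> q \<noteq> 0"
        and min: "\<And>a. a \<in> Q \<and> a \<noteq> 0 \<Longrightarrow> degree q \<le> degree a"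
        using ex_has_least_nat[of "\<lambda>a. a \<in> Q \<and> a \<noteq> 0" c degree] Q by blast
      have "q dvd a" if "a \<in> Q" for a
      proof -
        have "a mod q = a + - (a div q * q)"
          by (simp add: minus_div_mult_eq_mod)
        then have "a mod q \<in> Q" using that q Q(1) by (metis Spec_A_iff Spec_A_uminus)
        then have "a mod q = 0"
          using min[of "a mod q"] degree_mod_less'[of q a] q by fastforce
        then show ?thesis by (simp add: mod_eq_0_iff_dvd)
      qed
      then show ?thesis using q by blast
    qed
    obtain p where p: "p \<in> P" "p \<noteq> 0" "\<And>a. a \<in> P \<Longrightarrow> p dvd a" using gen P less.prems by blast
    then obtain q where q: "b = p * q" using P by (metis dvd_def)
    have "degree p \<noteq> 0"
    proof
      assume "degree p = 0"
      then have "p dvd 1" using p(2) by (simp add: is_unit_iff_degree)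
      then show False using p(1) P(1) unfolding Spec_A_iff by (metis dvdE mult.commute)
    qed
    then have "degree q < degree b" "q \<noteq> 0"
      using q less.prems by (auto simp: degree_mult_eq)
    then have "finite {P \<in> Spec_A. q \<in> P}" using less.hyps by blast
    \<comment> \<open>Nonzero primes are maximal. With r a generator of Q and p = r s, an r outside
      P would put s into P, so p would divide s and r would be a unit.\<close>
    moreover have "Q = P" if Q: "Q \<in> Spec_A" "p \<in> Q" for Q
    proof -
      obtain r where r: "r \<in> Q" "r \<noteq> 0" "\<And>a. a \<in> Q \<Longrightarrow> r dvd a" using gen Q p by blast
      have "P \<subseteq> Q" using p(3) Q unfolding Spec_A_iff by (metis dvdE mult.commute subsetI)
      moreover obtain s where s: "p = r * s" using r(3) Q(2) by (metis dvd_def)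
      have "r \<in> P"
      proof (rule ccontr)
        assume "r \<notin> P"
        then have "s \<in> P" using p(1) P(1) s by (metis Spec_A_mult)
        then have "p dvd s" by (rule p(3))
        then have "r dvd 1" using s p(2)
          by (metis dvd_mult_cancel_left dvd_triv_left mult.commute mult.right_neutral mult_eq_0_iff
              dvd_times_left_cancel_iff)
        then show False using r(1) Q(1) unfolding Spec_A_iff by (metis dvdE mult.commute)
      qed
      then have "Q \<subseteq> P" using r(3) P(1) unfolding Spec_A_iff by (metis dvdE mult.commute subsetI)
      ultimately show ?thesis by blast
    qed
    then have "{P \<in> Spec_A. b \<in> P} \<subseteq> insert P {P \<in> Spec_A. q \<in> P}"
      by (auto simp: q Spec_A_mult)
    ultimately show ?thesis by (meson finite_insert finite_subset)
  qed
qed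

section \<open>The local rings as subrings of the function field\<close>

lemma local_set_generic [simp]: "local_set generic = UNIV"
proof -
  have "f \<in> local_set generic" for f :: "'k::field poly fract" by (cases f) auto
  then show ?thesis by blast
qed

text \<open>The degree condition on a representative is the valuation condition on the Laurent
  series, hence the same for all representatives.\<close>

lemma local_set_Infty_iff: "f \<in> local_set Infty \<longleftrightarrow> fract_to_fls f \<in> O_inf"
proof -
  have *: "fract_to_fls (Fract a b) \<in> O_inf \<longleftrightarrow> degree a \<le> degree b" if "b \<noteq> 0" for a b :: "'k::field poly"
    using that
    by (cases "a = 0")
      (simp_all add: fract_to_fls_Fract O_inf_iff fls_divide_subdegree subdegree_poly_to_fls)
  show ?thesis
  proof (cases f)
    case (Fract a b)
    have "fract_to_fls f \<in> O_inf" if f: "f \<in> local_set Infty"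
    proof -
      from f obtain a b where "b \<noteq> 0" "f = Fract a b" "degree a \<le> degree b"
        unfolding local_set.simps by blast
      then show ?thesis using *[of b a] by simp
    qed
    moreover have "f \<in> local_set Infty" if "fract_to_fls f \<in> O_inf"
      using that Fract *[of b a] unfolding local_set.simps by blast
    ultimately show ?thesis by blast
  qed
qed

declare local_set.simps(2) [simp del]

lemma local_set_Infty [simp]: "local_set Infty = {f. fract_to_fls f \<in> O_inf}"
  using local_set_Infty_iff by blast

lemma local_set_add:
  assumes "p \<in> P1" "f \<in> local_set p" "g \<in> local_set p"
  shows "f + g \<in> local_set p"
proof (cases p)
  case (Fin P)
  then have P: "P \<in> Spec_A" using assms by (simp add: Fin_in_P1)
  obtain a b c d where "f = Fract a b" "g = Fract c d" "b \<notin> P" "d \<notin> P"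
    using assms Fin by auto
  moreover from this have "b \<noteq> 0" "d \<noteq> 0" "b * d \<notin> P" using P by (auto simp: Spec_A_mult)
  ultimately show ?thesis using Fin by auto
qed (use assms in \<open>simp add: fract_to_fls_add O_inf_add\<close>)

lemma local_set_mult:
  assumes "p \<in> P1" "f \<in> local_set p" "g \<in> local_set p"
  shows "f * g \<in> local_set p"
proof (cases p)
  case (Fin P)
  then have P: "P \<in> Spec_A" using assms by (simp add: Fin_in_P1)
  obtain a b c d where "f = Fract a b" "g = Fract c d" "b \<notin> P" "d \<notin> P"
    using assms Fin by auto
  moreover from this have "b * d \<notin> P" using P by (auto simp: Spec_A_mult)
  ultimately show ?thesis using Fin by auto
qed (use assms in \<open>simp add: fract_to_fls_mult O_inf_mult\<close>)

lemma Fract_in_local_set: "P \<in> Spec_A \<Longrightarrow> Fract a 1 \<in> local_set (Fin P)"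
  using Spec_A_1 by auto

lemma local_set_const:
  assumes "p \<in> P1" shows "0 \<in> local_set p" "1 \<in> local_set p" "- 1 \<in> local_set p"
proof -
  have "0 \<in> local_set p \<and> 1 \<in> local_set p \<and> - 1 \<in> local_set p"
  proof (cases p)
    case (Fin P)
    then have "Fract 0 1 \<in> local_set p \<and> Fract 1 1 \<in> local_set p \<and> Fract (- 1) 1 \<in> local_set p"
      using assms Fract_in_local_set Fin_in_P1 by blast
    then show ?thesis by (simp add: Zero_fract_def One_fract_def)
  qed (simp add: fract_to_fls_uminus O_inf_uminus)
  then show "0 \<in> local_set p" "1 \<in> local_set p" "- 1 \<in> local_set p" by simp_all
qed

lemma local_set_uminus: "p \<in> P1 \<Longrightarrow> f \<in> local_set p \<Longrightarrow> - f \<in> local_set p"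
  using local_set_mult[of p "- 1" f] local_set_const[of p] by simp

lemma local_set_power: "p \<in> P1 \<Longrightarrow> f \<in> local_set p \<Longrightarrow> f ^ n \<in> local_set p"
  by (induction n) (simp_all add: local_set_const local_set_mult del: local_set.simps local_set_Infty)

definition regular_locus :: "'k::field poly fract \<Rightarrow> 'k point set" where
  "regular_locus f = {p \<in> P1. f \<in> local_set p}"

text \<open>A denominator that avoids P works on all of D(b); and every rational function is regular
  at the generic point, as the condition at infinity demands.\<close>

lemma P1_open_regular_locus: "P1_open (regular_locus f)"
  unfolding P1_open_iff
proof (intro conjI allI impI)
  fix P assume "Fin P \<in> regular_locus f"
  then obtain a b where "f = Fract a b" "b \<notin> P" by (auto simp: regular_locus_def)
  moreover from this have "f \<in> local_set (Fin Q)" if "b \<notin> Q" for Q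
    using that by auto
  ultimately have "basic_open b \<subseteq> regular_locus f"
    by (auto simp: basic_open_def regular_locus_def Fin_in_P1 simp del: local_set.simps)
  then show "\<exists>b. b \<notin> P \<and> basic_open b \<subseteq> regular_locus f" using \<open>b \<notin> P\<close> by blast
qed (auto simp: regular_locus_def simp del: local_set.simps)

lemma carrier_O_ring: "U \<noteq> {} \<Longrightarrow> f \<in> carrier (O_ring U) \<longleftrightarrow> (\<forall>p\<in>U. f \<in> local_set p)"
  by (simp add: O_ring_def K_sections_def)

lemma carrier_O_ring_mono:
  "f \<in> carrier (O_ring U) \<Longrightarrow> W \<subseteq> U \<Longrightarrow> W \<noteq> {} \<Longrightarrow> f \<in> carrier (O_ring W)"
  by (metis carrier_O_ring subsetD subset_empty)

lemma ex_open_regular: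
  assumes "finite I" "p \<in> P1" "\<And>i. i \<in> I \<Longrightarrow> f i \<in> local_set p"
  shows "\<exists>W. P1_open W \<and> p \<in> W \<and> (\<forall>i\<in>I. f i \<in> carrier (O_ring W))"
  using assms
proof (induction rule: finite_induct)
  case empty
  then show ?case using P1_open_P1 by blast
next
  case (insert i I)
  then obtain W where W: "P1_open W" "p \<in> W" "\<forall>i\<in>I. f i \<in> carrier (O_ring W)" by blast
  let ?W = "W \<inter> regular_locus (f i)"
  have "p \<in> ?W" using insert.prems W by (auto simp: regular_locus_def)
  moreover from this have "f j \<in> carrier (O_ring ?W)" if "j \<in> I" for j
    using W that by (intro carrier_O_ring_mono[of "f j" W ?W]) auto
  moreover have "f i \<in> carrier (O_ring ?W)"
    using \<open>p \<in> ?W\<close> by (subst carrier_O_ring) (auto simp: regular_locus_def simp del: local_set.simps)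
  ultimately show ?case
    using W(1) P1_open_regular_locus by (intro exI[of _ ?W]) blast
qed

text \<open>Stands in for "c vanishes at p": powers of c clear every pole there. Both \<pi> at
  infinity and b at a prime containing b have this property, so that extension across infinity and
  across a finite point is one argument.\<close>

definition absorbs_poles :: "'k::field poly fract \<Rightarrow> 'k point \<Rightarrow> bool" where
  "absorbs_poles c p \<longleftrightarrow> c \<in> local_set p \<and> (\<forall>f. \<exists>k. c ^ k * f \<in> local_set p)"

lemma absorbs_poles_unif: "absorbs_poles unif Infty"
  unfolding absorbs_poles_def
proof (intro conjI allI)
  show "unif \<in> local_set Infty"
    by (simp add: fract_to_fls_unif O_inf_iff)
  fix f :: "'a poly fract"
  obtain m where "fls_X powi (int m) * fract_to_fls f \<in> O_inf"
    using ex_X_powi_O_inf[of "{()}" "\<lambda>_. fract_to_fls f"] by auto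
  then have "unif ^ m * f \<in> local_set Infty"
    by (simp add: fract_to_fls_mult fract_to_fls_unif_power del: fls_X_power_int)
  then show "\<exists>k. unif ^ k * f \<in> local_set Infty" by blast
qed

text \<open>Each denominator q divides some b^k d with d outside P when b is nonzero: a generator p
  of P divides both b and, as long as q lies in P, also q, and every factor p of q is traded for a
  factor b. For b = 0 the product is 0.\<close>

lemma absorbs_poles_Fin:
  assumes P: "P \<in> Spec_A" and b: "b \<in> P"
  shows "absorbs_poles (Fract b 1) (Fin P)"
proof -
  have *: "\<exists>k c d. d \<notin> P \<and> q * c = b ^ k * d" if "q \<noteq> 0" "b \<noteq> 0" for q
    using that
  proof (induction "degree q" arbitrary: q rule: less_induct)
    case less
    show ?case
    proof (cases "q \<in> P")
      case False
      then show ?thesis by (intro exI[of _ 0] exI[of _ 1] exI[of _ q]) simp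
    next
      case True
      obtain p where p: "p \<in> P \<and> p \<noteq> 0"
        and min: "\<And>a. a \<in> P \<and> a \<noteq> 0 \<Longrightarrow> degree p \<le> degree a"
        using ex_has_least_nat[of "\<lambda>a. a \<in> P \<and> a \<noteq> 0" b degree] b less.prems by blast
      have dvd: "p dvd a" if "a \<in> P" for a
      proof -
        have "a mod p = a + - (a div p * p)"
          by (simp add: minus_div_mult_eq_mod)
        then have "a mod p \<in> P" using that p P by (metis Spec_A_iff Spec_A_uminus)
        then have "a mod p = 0"
          using min[of "a mod p"] degree_mod_less'[of p a] p by fastforce
        then show ?thesis by (simp add: mod_eq_0_iff_dvd)
      qed
      obtain q1 b1 where q1: "q = p * q1" and b1: "b = p * b1"
        using dvd True b by (metis dvd_def)
      have "degree p \<noteq> 0"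
      proof
        assume "degree p = 0"
        then have "p dvd 1" using p by (simp add: is_unit_iff_degree)
        then show False using p P unfolding Spec_A_iff by (metis dvdE mult.commute)
      qed
      then have "degree q1 < degree q" "q1 \<noteq> 0"
        using q1 less.prems by (auto simp: degree_mult_eq)
      then obtain k c d where "d \<notin> P" "q1 * c = b ^ k * d" using less.hyps less.prems by blast
      then have "q * (c * b1) = b ^ Suc k * d"
        by (simp add: q1) (metis b1 mult.assoc mult.commute)
      then show ?thesis using \<open>d \<notin> P\<close> by blast
    qed
  qed
  have "\<exists>k. Fract b 1 ^ k * f \<in> local_set (Fin P)" for f
  proof (cases "b = 0")
    case True
    then have "Fract b 1 ^ 1 * f = 0" by (simp add: Zero_fract_def)
    then show ?thesis using local_set_const[of "Fin P"] P Fin_in_P1 by metis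
  next
    case False
    obtain a q where f: "f = Fract a q" "q \<noteq> 0" by (cases f)
    then obtain k c d where d: "d \<notin> P" "q * c = b ^ k * d" using * False by blast
    have "d \<noteq> 0" using d P by auto
    have pow: "Fract b 1 ^ k = Fract (b ^ k) 1" for k
      by (induction k) (simp_all add: One_fract_def)
    have "Fract b 1 ^ k * f = Fract (a * c) d"
      using f(2) \<open>d \<noteq> 0\<close> d(2) by (simp add: f pow eq_fract) (metis mult.assoc mult.commute)
    then show ?thesis using d(1) by auto
  qed
  then show ?thesis
    unfolding absorbs_poles_def using Fract_in_local_set[OF P] by blast
qed

section \<open>Stalks as modules over the local rings\<close>

definition local_ring :: "'k::field point \<Rightarrow> 'k poly fract ring" where
  "local_ring p = \<lparr>carrier = local_set p, mult = (*), one = 1, zero = 0, add = (+)\<rparr>"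

lemma cring_local_ring:
  assumes "p \<in> P1"
  shows "cring (local_ring p)"
proof (intro cringI abelian_groupI comm_monoidI)
  fix x assume "x \<in> carrier (local_ring p)"
  then show "\<exists>y\<in>carrier (local_ring p). y \<oplus>\<^bsub>local_ring p\<^esub> x = \<zero>\<^bsub>local_ring p\<^esub>"
    by (intro bexI[of _ "- x"]) (simp_all add: local_ring_def local_set_uminus[OF assms])
qed (simp_all add: local_ring_def algebra_simps local_set_add[OF assms] local_set_mult[OF assms]
      local_set_const[OF assms])

locale module_presheaf =
  fixes E :: "('k::field, 's) omod"
  assumes presheaf: "O_presheaf E"
begin

lemma sec_module: "P1_open U \<Longrightarrow> Module.module (O_ring U) (sec E U)"
  using presheaf by (simp add: O_presheaf_def)

lemma res_closed:
  "P1_open U \<Longrightarrow> P1_open W \<Longrightarrow> W \<subseteq> U \<Longrightarrow> s \<in> carrier (sec E U) \<Longrightarrow> res E U W s \<in> carrier (sec E W)"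
  using presheaf by (simp add: O_presheaf_def)

lemma res_add:
  "P1_open U \<Longrightarrow> P1_open W \<Longrightarrow> W \<subseteq> U \<Longrightarrow> s \<in> carrier (sec E U) \<Longrightarrow> t \<in> carrier (sec E U) \<Longrightarrow>
   res E U W (s \<oplus>\<^bsub>sec E U\<^esub> t) = res E U W s \<oplus>\<^bsub>sec E W\<^esub> res E U W t"
  using presheaf by (simp add: O_presheaf_def)

text \<open>On a nonempty \<open>W\<close> the restriction of a scalar is the same element of K.
  Over the empty set the scalar would become 0.\<close>

lemma res_smult:
  "P1_open U \<Longrightarrow> P1_open W \<Longrightarrow> W \<subseteq> U \<Longrightarrow> W \<noteq> {} \<Longrightarrow> s \<in> carrier (sec E U) \<Longrightarrow> f \<in> carrier (O_ring U) \<Longrightarrow>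
   res E U W (f \<odot>\<^bsub>sec E U\<^esub> s) = f \<odot>\<^bsub>sec E W\<^esub> res E U W s"
  using presheaf by (simp add: O_presheaf_def K_restr_def)

lemma res_id: "P1_open U \<Longrightarrow> s \<in> carrier (sec E U) \<Longrightarrow> res E U U s = s"
  using presheaf by (simp add: O_presheaf_def)

lemma res_res:
  "P1_open U \<Longrightarrow> P1_open W \<Longrightarrow> P1_open X \<Longrightarrow> X \<subseteq> W \<Longrightarrow> W \<subseteq> U \<Longrightarrow> s \<in> carrier (sec E U) \<Longrightarrow>
   res E W X (res E U W s) = res E U X s"
  using presheaf by (simp add: O_presheaf_def)

lemma sec_add_closed:
  assumes "P1_open U" "s \<in> carrier (sec E U)" "t \<in> carrier (sec E U)"
  shows "s \<oplus>\<^bsub>sec E U\<^esub> t \<in> carrier (sec E U)"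
proof -
  interpret Module.module "O_ring U" "sec E U" using assms(1) by (rule sec_module)
  show ?thesis using assms by simp
qed

lemma sec_zero_closed:
  assumes "P1_open U"
  shows "\<zero>\<^bsub>sec E U\<^esub> \<in> carrier (sec E U)"
proof -
  interpret Module.module "O_ring U" "sec E U" using assms(1) by (rule sec_module)
  show ?thesis using assms by simp
qed

lemma sec_smult_closed:
  assumes "P1_open U" "s \<in> carrier (sec E U)" "f \<in> carrier (O_ring U)"
  shows "f \<odot>\<^bsub>sec E U\<^esub> s \<in> carrier (sec E U)"
proof -
  interpret Module.module "O_ring U" "sec E U" using assms(1) by (rule sec_module)
  show ?thesis using assms by simp
qed

lemma sec_smult_assoc:
  assumes "P1_open U" "s \<in> carrier (sec E U)" "f \<in> carrier (O_ring U)" "g \<in> carrier (O_ring U)"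
  shows "(f * g) \<odot>\<^bsub>sec E U\<^esub> s = f \<odot>\<^bsub>sec E U\<^esub> (g \<odot>\<^bsub>sec E U\<^esub> s)"
proof -
  interpret Module.module "O_ring U" "sec E U" using assms(1) by (rule sec_module)
  show ?thesis using smult_assoc1[of f g s] assms by (simp add: O_ring_def)
qed

lemma sec_smult_one:
  assumes "P1_open U" "U \<noteq> {}" "s \<in> carrier (sec E U)"
  shows "1 \<odot>\<^bsub>sec E U\<^esub> s = s"
proof -
  interpret Module.module "O_ring U" "sec E U" using assms(1) by (rule sec_module)
  show ?thesis using smult_one[of s] assms by (simp add: O_ring_def K_restr_def)
qed

text \<open>Additivity makes the image z of 0 satisfy z + z = z.\<close>

lemma res_zero:
  assumes "P1_open U" "P1_open W" "W \<subseteq> U"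
  shows "res E U W \<zero>\<^bsub>sec E U\<^esub> = \<zero>\<^bsub>sec E W\<^esub>"
proof -
  interpret U: Module.module "O_ring U" "sec E U" using assms(1) by (rule sec_module)
  interpret W: Module.module "O_ring W" "sec E W" using assms(2) by (rule sec_module)
  let ?z = "res E U W \<zero>\<^bsub>sec E U\<^esub>"
  have z: "?z \<in> carrier (sec E W)" by (rule res_closed[OF assms]) simp
  have "?z \<oplus>\<^bsub>sec E W\<^esub> ?z = res E U W (\<zero>\<^bsub>sec E U\<^esub> \<oplus>\<^bsub>sec E U\<^esub> \<zero>\<^bsub>sec E U\<^esub>)"
    by (rule res_add[OF assms, symmetric]) simp_all
  then have "?z \<oplus>\<^bsub>sec E W\<^esub> ?z = ?z" by simp
  then show ?thesis using z W.M.add.r_cancel_one by blast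
qed

text \<open>A germ is the class of all sections agreeing with the given one near p; transitivity of
  this relation holds because two neighbourhoods of agreement may be intersected.\<close>

lemma germ_eq_iff:
  assumes U: "P1_open U" "p \<in> U" "s \<in> carrier (sec E U)"
    and W: "P1_open W" "p \<in> W" "t \<in> carrier (sec E W)"
  shows "germ E p U s = germ E p W t \<longleftrightarrow>
    (\<exists>X. P1_open X \<and> p \<in> X \<and> X \<subseteq> U \<inter> W \<and> res E U X s = res E W X t)" (is "?L \<longleftrightarrow> ?R")
proof
  assume ?L
  moreover have "(W, t) \<in> germ E p W t" using W by (auto simp: germ_def)
  ultimately have "(W, t) \<in> germ E p U s" by simp
  then show ?R by (auto simp: germ_def)
next
  have *: "germ E p W t \<subseteq> germ E p U s"
    if U: "P1_open U" "p \<in> U" "s \<in> carrier (sec E U)"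
    and W: "P1_open W" "p \<in> W" "t \<in> carrier (sec E W)"
    and X: "P1_open X" "p \<in> X" "X \<subseteq> U \<inter> W" "res E U X s = res E W X t" for U W s t X
  proof
    fix x assume "x \<in> germ E p W t"
    then obtain V r Y where x: "x = (V, r)" and V: "P1_open V" "p \<in> V" "r \<in> carrier (sec E V)"
      and Y: "P1_open Y" "p \<in> Y" "Y \<subseteq> W \<inter> V" "res E W Y t = res E V Y r"
      by (auto simp: germ_def)
    have o: "P1_open (X \<inter> Y)" using X Y by blast
    have "res E U (X \<inter> Y) s = res E X (X \<inter> Y) (res E U X s)"
      using res_res[of U X "X \<inter> Y" s] X(1-3) U o by simp
    also have "\<dots> = res E W (X \<inter> Y) t"
      unfolding X(4) using res_res[of W X "X \<inter> Y"] X W o by simp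
    also have "\<dots> = res E Y (X \<inter> Y) (res E W Y t)"
      using res_res[of W Y "X \<inter> Y" t] Y(1-3) W o by simp
    also have "\<dots> = res E V (X \<inter> Y) r"
      unfolding Y(4) using res_res[of V Y "X \<inter> Y"] Y V o by simp
    finally show "x \<in> germ E p U s"
      unfolding germ_def x using V o X Y by blast
  qed
  assume ?R
  then obtain X where X: "P1_open X" "p \<in> X" "X \<subseteq> U \<inter> W" "res E U X s = res E W X t" by blast
  then show ?L using *[OF U W X] *[OF W U, of X] by (simp add: Int_commute)
qed

lemma germ_eqI:
  assumes "P1_open U" "s \<in> carrier (sec E U)" "P1_open W" "t \<in> carrier (sec E W)"
    "P1_open X" "p \<in> X" "X \<subseteq> U" "X \<subseteq> W" "res E U X s = res E W X t"
  shows "germ E p U s = germ E p W t"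
proof -
  have "p \<in> U" "p \<in> W" using assms by auto
  then show ?thesis using assms germ_eq_iff[of U p s W t] by blast
qed

lemma germ_res:
  assumes "P1_open U" "P1_open W" "W \<subseteq> U" "p \<in> W" "s \<in> carrier (sec E U)"
  shows "germ E p W (res E U W s) = germ E p U s"
proof -
  have "res E W W (res E U W s) = res E U W s" using assms by (intro res_id res_closed)
  then show ?thesis using assms by (intro germ_eqI[where X = W] res_closed) simp_all
qed

lemma germ_in_stalk:
  "P1_open U \<Longrightarrow> p \<in> U \<Longrightarrow> s \<in> carrier (sec E U) \<Longrightarrow> germ E p U s \<in> carrier (stalk E p)"
  by (auto simp: stalk_def)

lemma stalkE:
  assumes "x \<in> carrier (stalk E p)"
  obtains U s where "P1_open U" "p \<in> U" "s \<in> carrier (sec E U)" "x = germ E p U s"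
  using assms by (auto simp: stalk_def)

lemma stalk_common:
  assumes "x \<in> carrier (stalk E p)" "P1_open W" "p \<in> W"
  obtains U s where "P1_open U" "p \<in> U" "U \<subseteq> W" "s \<in> carrier (sec E U)" "x = germ E p U s"
proof -
  obtain U s where U: "P1_open U" "p \<in> U" "s \<in> carrier (sec E U)" "x = germ E p U s"
    using assms(1) by (rule stalkE)
  have "germ E p (U \<inter> W) (res E U (U \<inter> W) s) = x"
    unfolding U(4) by (rule germ_res) (use U assms in auto)
  then show thesis
    using that[of "U \<inter> W" "res E U (U \<inter> W) s"] U assms by (auto intro: res_closed)
qed

lemma stalk_common2:
  assumes "x \<in> carrier (stalk E p)" "y \<in> carrier (stalk E p)" "P1_open W" "p \<in> W"
  obtains U s t where "P1_open U" "p \<in> U" "U \<subseteq> W" "s \<in> carrier (sec E U)" "t \<in> carrier (sec E U)"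
    "x = germ E p U s" "y = germ E p U t"
proof -
  obtain U s where U: "P1_open U" "p \<in> U" "U \<subseteq> W" "s \<in> carrier (sec E U)" "x = germ E p U s"
    using assms(1,3,4) by (rule stalk_common)
  obtain V t where V: "P1_open V" "p \<in> V" "V \<subseteq> U" "t \<in> carrier (sec E V)" "y = germ E p V t"
    using assms(2) U(1,2) by (rule stalk_common)
  have "germ E p V (res E U V s) = x"
    unfolding U(5) by (rule germ_res) (use U V in auto)
  then show thesis
    using that[of V "res E U V s" t] U V by (auto intro: res_closed)
qed

text \<open>Resolves the \<open>THE\<close> in the addition of germs: two choices of representatives
  coincide on the common neighbourhood \<open>X \<inter> Y\<close>, and restriction is
  additive.\<close>

lemma stalk_add:
  assumes "P1_open U" "p \<in> U" "s \<in> carrier (sec E U)" "t \<in> carrier (sec E U)"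
  shows "germ E p U s \<oplus>\<^bsub>stalk E p\<^esub> germ E p U t = germ E p U (s \<oplus>\<^bsub>sec E U\<^esub> t)"
proof -
  have "(THE z. \<exists>W s' t'. P1_open W \<and> p \<in> W \<and> s' \<in> carrier (sec E W) \<and> t' \<in> carrier (sec E W) \<and>
      germ E p U s = germ E p W s' \<and> germ E p U t = germ E p W t' \<and>
      z = germ E p W (s' \<oplus>\<^bsub>sec E W\<^esub> t')) = germ E p U (s \<oplus>\<^bsub>sec E U\<^esub> t)"
  proof (rule the_equality)
    fix z assume "\<exists>W s' t'. P1_open W \<and> p \<in> W \<and> s' \<in> carrier (sec E W) \<and> t' \<in> carrier (sec E W) \<and>
      germ E p U s = germ E p W s' \<and> germ E p U t = germ E p W t' \<and>
      z = germ E p W (s' \<oplus>\<^bsub>sec E W\<^esub> t')"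
    then obtain W s' t' where W: "P1_open W" "p \<in> W" "s' \<in> carrier (sec E W)" "t' \<in> carrier (sec E W)"
      and eq: "germ E p U s = germ E p W s'" "germ E p U t = germ E p W t'"
      and z: "z = germ E p W (s' \<oplus>\<^bsub>sec E W\<^esub> t')" by blast
    obtain X where X: "P1_open X" "p \<in> X" "X \<subseteq> U \<inter> W" "res E U X s = res E W X s'"
      using eq(1) germ_eq_iff[of U p s W s'] assms W by auto
    obtain Y where Y: "P1_open Y" "p \<in> Y" "Y \<subseteq> U \<inter> W" "res E U Y t = res E W Y t'"
      using eq(2) germ_eq_iff[of U p t W t'] assms W by auto
    let ?Z = "X \<inter> Y"
    have Z: "P1_open ?Z" "p \<in> ?Z" "?Z \<subseteq> U" "?Z \<subseteq> W" using X Y by auto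
    have "res E U ?Z s = res E W ?Z s'"
      using res_res[of U X ?Z s] res_res[of W X ?Z s'] X Z assms W by simp
    moreover have "res E U ?Z t = res E W ?Z t'"
      using res_res[of U Y ?Z t] res_res[of W Y ?Z t'] Y Z assms W by simp
    ultimately have "res E U ?Z (s \<oplus>\<^bsub>sec E U\<^esub> t) = res E W ?Z (s' \<oplus>\<^bsub>sec E W\<^esub> t')"
      using res_add[of U ?Z s t] res_add[of W ?Z s' t'] Z assms W by simp
    then show "z = germ E p U (s \<oplus>\<^bsub>sec E U\<^esub> t)"
      unfolding z using Z assms W by (intro germ_eqI[where X = ?Z] sec_add_closed) simp_all
  qed (use assms in blast)
  then show ?thesis by (simp add: stalk_def)
qed

lemma stalk_smult:
  assumes "P1_open U" "p \<in> U" "s \<in> carrier (sec E U)" "f \<in> carrier (O_ring U)"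
  shows "f \<odot>\<^bsub>stalk E p\<^esub> germ E p U s = germ E p U (f \<odot>\<^bsub>sec E U\<^esub> s)"
proof -
  have "(THE z. \<exists>W s'. P1_open W \<and> p \<in> W \<and> s' \<in> carrier (sec E W) \<and> f \<in> carrier (O_ring W) \<and>
      germ E p U s = germ E p W s' \<and> z = germ E p W (f \<odot>\<^bsub>sec E W\<^esub> s')) = germ E p U (f \<odot>\<^bsub>sec E U\<^esub> s)"
  proof (rule the_equality)
    fix z assume "\<exists>W s'. P1_open W \<and> p \<in> W \<and> s' \<in> carrier (sec E W) \<and> f \<in> carrier (O_ring W) \<and>
      germ E p U s = germ E p W s' \<and> z = germ E p W (f \<odot>\<^bsub>sec E W\<^esub> s')"
    then obtain W s' where W: "P1_open W" "p \<in> W" "s' \<in> carrier (sec E W)" "f \<in> carrier (O_ring W)"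
      and eq: "germ E p U s = germ E p W s'"
      and z: "z = germ E p W (f \<odot>\<^bsub>sec E W\<^esub> s')" by blast
    obtain X where X: "P1_open X" "p \<in> X" "X \<subseteq> U \<inter> W" "res E U X s = res E W X s'"
      using eq germ_eq_iff[of U p s W s'] assms W by auto
    then have "res E U X (f \<odot>\<^bsub>sec E U\<^esub> s) = res E W X (f \<odot>\<^bsub>sec E W\<^esub> s')"
      using res_smult[of U X s f] res_smult[of W X s' f] assms W by fastforce
    then show "z = germ E p U (f \<odot>\<^bsub>sec E U\<^esub> s)"
      unfolding z using X assms W by (intro germ_eqI[where X = X] sec_smult_closed) simp_all
  qed (use assms in blast)
  then show ?thesis by (simp add: stalk_def)
qed

lemma stalk_zero:
  assumes "P1_open U" "p \<in> U"
  shows "\<zero>\<^bsub>stalk E p\<^esub> = germ E p U \<zero>\<^bsub>sec E U\<^esub>"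
proof -
  have "U \<subseteq> P1" using assms by (simp add: P1_open_subset)
  then have "germ E p U (res E P1 U \<zero>\<^bsub>sec E P1\<^esub>) = germ E p P1 \<zero>\<^bsub>sec E P1\<^esub>"
    using assms by (intro germ_res) (auto intro: sec_zero_closed)
  then show ?thesis using \<open>U \<subseteq> P1\<close> assms by (simp add: res_zero stalk_def)
qed

lemma abelian_group_stalk:
  assumes p: "p \<in> P1"
  shows "abelian_group (stalk E p)"
proof (rule abelian_groupI)
  fix x y z assume x: "x \<in> carrier (stalk E p)" and y: "y \<in> carrier (stalk E p)"
  obtain U s t where U: "P1_open U" "p \<in> U" "s \<in> carrier (sec E U)" "t \<in> carrier (sec E U)"
    "x = germ E p U s" "y = germ E p U t"
    using stalk_common2[OF x y P1_open_P1 p] by metis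
  interpret Module.module "O_ring U" "sec E U" using U(1) by (rule sec_module)
  show "x \<oplus>\<^bsub>stalk E p\<^esub> y \<in> carrier (stalk E p)"
    using U by (simp add: stalk_add germ_in_stalk)
  show "x \<oplus>\<^bsub>stalk E p\<^esub> y = y \<oplus>\<^bsub>stalk E p\<^esub> x"
    using U by (simp add: stalk_add M.a_comm)
  assume z: "z \<in> carrier (stalk E p)"
  obtain W r where W: "P1_open W" "p \<in> W" "W \<subseteq> U" "r \<in> carrier (sec E W)" "z = germ E p W r"
    using stalk_common[OF z U(1,2)] by metis
  interpret W: Module.module "O_ring W" "sec E W" using W(1) by (rule sec_module)
  have "x = germ E p W (res E U W s)" "y = germ E p W (res E U W t)"
    using U W by (simp_all add: germ_res)
  then show "x \<oplus>\<^bsub>stalk E p\<^esub> y \<oplus>\<^bsub>stalk E p\<^esub> z = x \<oplus>\<^bsub>stalk E p\<^esub> (y \<oplus>\<^bsub>stalk E p\<^esub> z)"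
    using U W res_closed[of U W s] res_closed[of U W t]
    by (simp add: stalk_add W.M.a_assoc)
next
  fix x assume x: "x \<in> carrier (stalk E p)"
  obtain U s where U: "P1_open U" "p \<in> U" "s \<in> carrier (sec E U)" "x = germ E p U s"
    using x by (rule stalkE)
  interpret Module.module "O_ring U" "sec E U" using U(1) by (rule sec_module)
  show "\<zero>\<^bsub>stalk E p\<^esub> \<oplus>\<^bsub>stalk E p\<^esub> x = x"
    using U by (simp add: stalk_zero[OF U(1,2)] stalk_add)
  have "germ E p U (\<ominus>\<^bsub>sec E U\<^esub> s) \<oplus>\<^bsub>stalk E p\<^esub> x = \<zero>\<^bsub>stalk E p\<^esub>"
    using U by (simp add: stalk_zero[OF U(1,2)] stalk_add M.l_neg)
  then show "\<exists>y\<in>carrier (stalk E p). y \<oplus>\<^bsub>stalk E p\<^esub> x = \<zero>\<^bsub>stalk E p\<^esub>"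
    using U germ_in_stalk[of U p "\<ominus>\<^bsub>sec E U\<^esub> s"] by (metis M.a_inv_closed)
next
  show "\<zero>\<^bsub>stalk E p\<^esub> \<in> carrier (stalk E p)"
    using p by (subst stalk_zero[of P1]) (auto intro!: germ_in_stalk sec_zero_closed)
qed

lemma stalk_common_regular:
  assumes "x \<in> carrier (stalk E p)" "f \<in> local_set p" "g \<in> local_set p" "p \<in> P1"
  obtains U s where "P1_open U" "p \<in> U" "s \<in> carrier (sec E U)" "x = germ E p U s"
    "f \<in> carrier (O_ring U)" "g \<in> carrier (O_ring U)"
proof -
  obtain W where W: "P1_open W" "p \<in> W" "\<forall>h\<in>{f, g}. h \<in> carrier (O_ring W)"
    using ex_open_regular[of "{f, g}" p "\<lambda>x. x"] assms by auto
  obtain U s where U: "P1_open U" "p \<in> U" "U \<subseteq> W" "s \<in> carrier (sec E U)" "x = germ E p U s"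
    using stalk_common[OF assms(1) W(1,2)] by metis
  moreover have "f \<in> carrier (O_ring U)" "g \<in> carrier (O_ring U)"
    using carrier_O_ring_mono[of _ W U] U W(3) by auto
  ultimately show thesis using that by blast
qed

text \<open>Each axiom is checked over a single open set on which all the germs have representatives
  and the scalars are regular; regular loci being open, such a set exists.\<close>

lemma module_stalk:
  assumes p: "p \<in> P1"
  shows "Module.module (local_ring p) (stalk E p)"
proof (rule moduleI)
  show "cring (local_ring p)" using p by (rule cring_local_ring)
  show "abelian_group (stalk E p)" using p by (rule abelian_group_stalk)
next
  fix a x y assume a: "a \<in> carrier (local_ring p)" and x: "x \<in> carrier (stalk E p)"
  have a': "a \<in> local_set p" using a by (simp add: local_ring_def)
  obtain U s where U: "P1_open U" "p \<in> U" "s \<in> carrier (sec E U)" "x = germ E p U s"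
    "a \<in> carrier (O_ring U)" using stalk_common_regular[OF x a' a' p] by metis
  then show "a \<odot>\<^bsub>stalk E p\<^esub> x \<in> carrier (stalk E p)"
    by (simp add: stalk_smult germ_in_stalk sec_smult_closed)
  assume y: "y \<in> carrier (stalk E p)"
  obtain W r where W: "P1_open W" "p \<in> W" "W \<subseteq> U" "r \<in> carrier (sec E W)" "y = germ E p W r"
    using stalk_common[OF y U(1,2)] by metis
  interpret W: Module.module "O_ring W" "sec E W" using W(1) by (rule sec_module)
  have "x = germ E p W (res E U W s)" "a \<in> carrier (O_ring W)" "res E U W s \<in> carrier (sec E W)"
    using U W carrier_O_ring_mono[of a U W] by (auto simp: germ_res res_closed)
  then show "a \<odot>\<^bsub>stalk E p\<^esub> (x \<oplus>\<^bsub>stalk E p\<^esub> y) =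
      a \<odot>\<^bsub>stalk E p\<^esub> x \<oplus>\<^bsub>stalk E p\<^esub> a \<odot>\<^bsub>stalk E p\<^esub> y"
    using W by (simp add: stalk_add stalk_smult W.smult_r_distr)
next
  fix a b x assume a: "a \<in> carrier (local_ring p)" and b: "b \<in> carrier (local_ring p)"
    and x: "x \<in> carrier (stalk E p)"
  have ab: "a \<in> local_set p" "b \<in> local_set p" using a b by (simp_all add: local_ring_def)
  obtain U s where U: "P1_open U" "p \<in> U" "s \<in> carrier (sec E U)" "x = germ E p U s"
    "a \<in> carrier (O_ring U)" "b \<in> carrier (O_ring U)"
    using stalk_common_regular[OF x ab p] by metis
  interpret Module.module "O_ring U" "sec E U" using U(1) by (rule sec_module)
  have c: "a + b \<in> carrier (O_ring U)" "a * b \<in> carrier (O_ring U)"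
    using R.a_closed[OF U(5,6)] R.m_closed[OF U(5,6)] by (simp_all add: O_ring_def)
  show "(a \<oplus>\<^bsub>local_ring p\<^esub> b) \<odot>\<^bsub>stalk E p\<^esub> x =
      a \<odot>\<^bsub>stalk E p\<^esub> x \<oplus>\<^bsub>stalk E p\<^esub> b \<odot>\<^bsub>stalk E p\<^esub> x"
    using U c smult_l_distr[OF U(5,6,3)]
    by (simp add: local_ring_def stalk_smult stalk_add) (simp add: O_ring_def)
  show "(a \<otimes>\<^bsub>local_ring p\<^esub> b) \<odot>\<^bsub>stalk E p\<^esub> x = a \<odot>\<^bsub>stalk E p\<^esub> (b \<odot>\<^bsub>stalk E p\<^esub> x)"
    using U c by (simp add: local_ring_def stalk_smult sec_smult_assoc)
next
  fix x assume x: "x \<in> carrier (stalk E p)"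
  have 1: "1 \<in> local_set p" using p by (rule local_set_const)
  obtain U s where U: "P1_open U" "p \<in> U" "s \<in> carrier (sec E U)" "x = germ E p U s"
    "1 \<in> carrier (O_ring U)" using stalk_common_regular[OF x 1 1 p] by metis
  then have "U \<noteq> {}" by blast
  then show "\<one>\<^bsub>local_ring p\<^esub> \<odot>\<^bsub>stalk E p\<^esub> x = x"
    using U by (simp add: local_ring_def stalk_smult sec_smult_one)
qed

end

section \<open>Sections of vector bundles\<close>

locale vector_bundle_P1 =
  fixes E :: "('k::field, 's) omod"
  assumes is_bundle: "vector_bundle E"
begin

sublocale module_presheaf E
  using is_bundle by unfold_locales (simp add: vector_bundle_def O_sheaf_def)

lemma sheaf_condition:
  "(\<forall>U\<in>C. P1_open U) \<longrightarrow>
     (\<forall>s \<in> carrier (sec E (\<Union>C)). \<forall>t \<in> carrier (sec E (\<Union>C)).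
        (\<forall>U\<in>C. res E (\<Union>C) U s = res E (\<Union>C) U t) \<longrightarrow> s = t) \<and>
     (\<forall>\<sigma>. (\<forall>U\<in>C. \<sigma> U \<in> carrier (sec E U)) \<and>
          (\<forall>U\<in>C. \<forall>W\<in>C. res E U (U \<inter> W) (\<sigma> U) = res E W (U \<inter> W) (\<sigma> W)) \<longrightarrow>
          (\<exists>s \<in> carrier (sec E (\<Union>C)). \<forall>U\<in>C. res E (\<Union>C) U s = \<sigma> U))"
  using is_bundle unfolding vector_bundle_def O_sheaf_def by (elim conjE allE[of _ C])

lemma sheaf_eqI:
  assumes "\<And>U. U \<in> C \<Longrightarrow> P1_open U" "V = \<Union>C"
    "s \<in> carrier (sec E V)" "t \<in> carrier (sec E V)"
    "\<And>U. U \<in> C \<Longrightarrow> res E V U s = res E V U t"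
  shows "s = t"
  using sheaf_condition[of C] assms by simp

lemma sheaf_glue:
  assumes "\<And>U. U \<in> C \<Longrightarrow> P1_open U" "V = \<Union>C"
    "\<And>U. U \<in> C \<Longrightarrow> \<sigma> U \<in> carrier (sec E U)"
    "\<And>U W. U \<in> C \<Longrightarrow> W \<in> C \<Longrightarrow> res E U (U \<inter> W) (\<sigma> U) = res E W (U \<inter> W) (\<sigma> W)"
  shows "\<exists>s\<in>carrier (sec E V). \<forall>U\<in>C. res E V U s = \<sigma> U"
proof -
  have "\<exists>s\<in>carrier (sec E (\<Union>C)). \<forall>U\<in>C. res E (\<Union>C) U s = \<sigma> U"
    by (rule sheaf_condition[of C, THEN mp, THEN conjunct2, THEN spec, of \<sigma>, THEN mp])
      (use assms in auto)
  then show ?thesis unfolding assms(2) .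
qed

text \<open>The empty set has the empty cover, for which any two sections agree vacuously.\<close>

lemma sec_empty: "carrier (sec E {}) = {\<zero>\<^bsub>sec E {}\<^esub>}"
  using sheaf_eqI[of "{}" "{}"] sec_zero_closed[of "{}"] by auto

text \<open>\<open>\<kappa> W s\<close> is the tuple of rational functions that describes
  \<open>s\<close> in a local frame. Over nonempty sets restriction leaves rational functions as
  they are, so a section and its restrictions have the same tuple.\<close>

lemma trivialization:
  assumes "p \<in> P1"
  obtains U and r :: nat and \<kappa> where "P1_open U" "p \<in> U"
    "\<And>W. P1_open W \<Longrightarrow> W \<subseteq> U \<Longrightarrow> W \<noteq> {} \<Longrightarrow>
       bij_betw (\<kappa> W) (carrier (sec E W)) (\<Pi>\<^sub>E i\<in>{..<r}. carrier (O_ring W))"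
    "\<And>W f s. P1_open W \<Longrightarrow> W \<subseteq> U \<Longrightarrow> W \<noteq> {} \<Longrightarrow> f \<in> carrier (O_ring W) \<Longrightarrow> s \<in> carrier (sec E W) \<Longrightarrow>
       \<kappa> W (f \<odot>\<^bsub>sec E W\<^esub> s) = (\<lambda>i\<in>{..<r}. f * \<kappa> W s i)"
    "\<And>W X s. P1_open W \<Longrightarrow> W \<subseteq> U \<Longrightarrow> P1_open X \<Longrightarrow> X \<subseteq> W \<Longrightarrow> X \<noteq> {} \<Longrightarrow> s \<in> carrier (sec E W) \<Longrightarrow>
       \<kappa> X (res E W X s) = \<kappa> W s"
proof -
  let ?S = "\<lambda>r. direct_sum r (\<lambda>_. structure_sheaf)"
  obtain U r where U: "P1_open U" "p \<in> U" and "iso_on U E (direct_sum r (\<lambda>_. structure_sheaf))"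
    using is_bundle assms unfolding vector_bundle_def by blast
  then obtain \<kappa> where
    \<kappa>: "(\<forall>W. P1_open W \<and> W \<subseteq> U \<longrightarrow>
       bij_betw (\<kappa> W) (carrier (sec E W)) (carrier (sec (?S r) W)) \<and>
       (\<forall>s \<in> carrier (sec E W). \<forall>t \<in> carrier (sec E W).
          \<kappa> W (s \<oplus>\<^bsub>sec E W\<^esub> t) = \<kappa> W s \<oplus>\<^bsub>sec (?S r) W\<^esub> \<kappa> W t) \<and>
       (\<forall>f \<in> carrier (O_ring W). \<forall>s \<in> carrier (sec E W).
          \<kappa> W (f \<odot>\<^bsub>sec E W\<^esub> s) = f \<odot>\<^bsub>sec (?S r) W\<^esub> \<kappa> W s)) \<and>
     (\<forall>W X. P1_open W \<and> P1_open X \<and> X \<subseteq> W \<and> W \<subseteq> U \<longrightarrow>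
       (\<forall>s \<in> carrier (sec E W). \<kappa> X (res E W X s) = res (?S r) W X (\<kappa> W s)))"
    unfolding iso_on_def by (elim exE)
  have bij: "bij_betw (\<kappa> W) (carrier (sec E W)) (carrier (sec (?S r) W))"
    if "P1_open W" "W \<subseteq> U" for W using \<kappa> that by simp
  have smult: "\<kappa> W (f \<odot>\<^bsub>sec E W\<^esub> s) = f \<odot>\<^bsub>sec (?S r) W\<^esub> \<kappa> W s"
    if "P1_open W" "W \<subseteq> U" "f \<in> carrier (O_ring W)" "s \<in> carrier (sec E W)" for W f s
    using \<kappa> that by simp
  have res: "\<kappa> X (res E W X s) = res (?S r) W X (\<kappa> W s)"
    if "P1_open W" "P1_open X" "X \<subseteq> W" "W \<subseteq> U" "s \<in> carrier (sec E W)" for W X s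
    using \<kappa> that by simp
  have carrier: "carrier (sec (direct_sum r (\<lambda>_. structure_sheaf)) W) = (\<Pi>\<^sub>E i\<in>{..<r}. carrier (O_ring W))" for W
    by (simp add: direct_sum_def structure_sheaf_def K_subsheaf_def O_ring_def)
  show thesis
  proof (rule that[OF U])
    fix W assume W: "P1_open W" "W \<subseteq> U" "W \<noteq> {}"
    show "bij_betw (\<kappa> W) (carrier (sec E W)) (\<Pi>\<^sub>E i\<in>{..<r}. carrier (O_ring W))"
      using bij[OF W(1,2)] unfolding carrier .
    fix f s assume "f \<in> carrier (O_ring W)" "s \<in> carrier (sec E W)"
    then show "\<kappa> W (f \<odot>\<^bsub>sec E W\<^esub> s) = (\<lambda>i\<in>{..<r}. f * \<kappa> W s i)"
      using smult[OF W(1,2)] by (simp add: direct_sum_def structure_sheaf_def K_subsheaf_def)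
  next
    fix W X s assume W: "P1_open W" "W \<subseteq> U" and X: "P1_open X" "X \<subseteq> W" "X \<noteq> {}"
      and s: "s \<in> carrier (sec E W)"
    have "\<kappa> X (res E W X s) = (\<lambda>i\<in>{..<r}. \<kappa> W s i)"
      using res[OF W(1) X(1,2) W(2) s] X(3)
      by (simp add: direct_sum_def structure_sheaf_def K_subsheaf_def K_restr_def)
    moreover have "\<kappa> W s \<in> (\<Pi>\<^sub>E i\<in>{..<r}. carrier (O_ring W))"
      using bij_betwE[OF bij[OF W]] s unfolding carrier by blast
    ultimately show "\<kappa> X (res E W X s) = \<kappa> W s"
      by (metis PiE_restrict)
  qed
qed

text \<open>Identity principle: near any point of \<open>U\<close> both sections have the same tuple
  in a local frame, because the frame's domain meets \<open>W\<close>. The sheaf property passes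
  from local to global equality.\<close>

lemma res_inj:
  assumes U: "P1_open U" and W: "P1_open W" "W \<subseteq> U" "W \<noteq> {}"
    and s: "s \<in> carrier (sec E U)" and t: "t \<in> carrier (sec E U)"
    and eq: "res E U W s = res E U W t"
  shows "s = t"
proof -
  let ?C = "{X. P1_open X \<and> X \<subseteq> U \<and> res E U X s = res E U X t}"
  have "\<exists>X\<in>?C. p \<in> X" if p: "p \<in> U" for p
  proof -
    have p1: "p \<in> P1" using p U P1_open_subset by blast
    obtain V and r :: nat and \<kappa> where V: "P1_open V" "p \<in> V"
      and bij: "\<And>W. P1_open W \<Longrightarrow> W \<subseteq> V \<Longrightarrow> W \<noteq> {} \<Longrightarrow>
        bij_betw (\<kappa> W) (carrier (sec E W)) (\<Pi>\<^sub>E i\<in>{..<r}. carrier (O_ring W))"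
      and res: "\<And>W X s. P1_open W \<Longrightarrow> W \<subseteq> V \<Longrightarrow> P1_open X \<Longrightarrow> X \<subseteq> W \<Longrightarrow> X \<noteq> {} \<Longrightarrow>
        s \<in> carrier (sec E W) \<Longrightarrow> \<kappa> X (res E W X s) = \<kappa> W s"
      by (rule trivialization[OF p1]) (rule that; assumption)
    let ?X = "V \<inter> U"
    have X: "P1_open ?X" "?X \<noteq> {}" "?X \<subseteq> U" "?X \<subseteq> V" using U V p by auto
    let ?Y = "?X \<inter> W"
    have Y: "P1_open ?Y" "?Y \<noteq> {}" "?Y \<subseteq> ?X" "?Y \<subseteq> W"
      using X W open_Int_nonempty[of ?X W] by auto
    have c: "res E U ?X s \<in> carrier (sec E ?X)" "res E U ?X t \<in> carrier (sec E ?X)"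
      using s t X U res_closed by auto
    have "res E ?X ?Y (res E U ?X s) = res E W ?Y (res E U W s)"
      using res_res[OF U X(1) Y(1,3) X(3) s] res_res[OF U W(1) Y(1,4) W(2) s] by simp
    also have "\<dots> = res E ?X ?Y (res E U ?X t)"
      using res_res[OF U X(1) Y(1,3) X(3) t] res_res[OF U W(1) Y(1,4) W(2) t] eq by simp
    finally have "\<kappa> ?X (res E U ?X s) = \<kappa> ?X (res E U ?X t)"
      using res[OF X(1,4) Y(1,3,2)] c by metis
    then have "res E U ?X s = res E U ?X t"
      using bij_betw_imp_inj_on[OF bij[OF X(1,4,2)]] c by (auto dest: inj_onD)
    then show ?thesis using X V p by (intro bexI[of _ ?X]) auto
  qed
  then have "U = \<Union>?C" by blast
  then show ?thesis
    by (rule sheaf_eqI[of ?C, rotated]) (use s t in auto)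
qed

text \<open>Local extensions of \<open>s\<close> automatically agree on overlaps: they agree with
  \<open>s\<close> on the dense set \<open>D\<close>, and \<open>res_inj\<close> applies. The cover
  consists of all nonempty open subsets of \<open>V\<close> over which an extension exists, with one
  chosen for each; \<open>D\<close> is among them, so the glued section restricts to
  \<open>s\<close>.\<close>

lemma glue_extension:
  assumes V: "P1_open V" and D: "P1_open D" "D \<subseteq> V" "D \<noteq> {}" and s: "s \<in> carrier (sec E D)"
    and ext: "\<And>p. p \<in> V \<Longrightarrow> \<exists>U t. P1_open U \<and> p \<in> U \<and> U \<subseteq> V \<and> t \<in> carrier (sec E U) \<and>
      res E U (U \<inter> D) t = res E D (U \<inter> D) s"
  shows "\<exists>t\<in>carrier (sec E V). res E V D t = s"
proof -
  define Q where "Q = (\<lambda>U t. t \<in> carrier (sec E U) \<and> res E U (U \<inter> D) t = res E D (U \<inter> D) s)"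
  define C where "C = {U. P1_open U \<and> U \<noteq> {} \<and> U \<subseteq> V \<and> (\<exists>t. Q U t)}"
  define \<sigma> where "\<sigma> = (\<lambda>U. SOME t. Q U t)"
  have Q: "Q U (\<sigma> U)" if "U \<in> C" for U
    using that unfolding C_def \<sigma>_def by (auto intro: someI)
  have DC: "D \<in> C" unfolding C_def Q_def using D s by auto
  have "V = \<Union>C"
  proof
    show "V \<subseteq> \<Union>C"
    proof
      fix p assume "p \<in> V"
      then obtain U t where "P1_open U" "p \<in> U" "U \<subseteq> V" "Q U t"
        using ext unfolding Q_def by meson
      then have "U \<in> C" unfolding C_def by blast
      then show "p \<in> \<Union>C" using \<open>p \<in> U\<close> by blast
    qed
  qed (auto simp: C_def)
  moreover have "res E U (U \<inter> W) (\<sigma> U) = res E W (U \<inter> W) (\<sigma> W)" if "U \<in> C" "W \<in> C" for U W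
  proof -
    have U: "P1_open U" "U \<noteq> {}" and W: "P1_open W" "W \<noteq> {}"
      using that by (simp_all add: C_def)
    let ?X = "U \<inter> W" and ?Y = "U \<inter> W \<inter> D"
    have X: "P1_open ?X" "?X \<noteq> {}" using U W open_Int_nonempty by auto
    have Y: "P1_open ?Y" "?Y \<noteq> {}" using X D open_Int_nonempty by blast+
    have *: "res E Z ?Y (\<sigma> Z) = res E D ?Y s" if Z: "Z \<in> C" "?Y \<subseteq> Z" for Z
    proof -
      have oZ: "P1_open Z" "P1_open (Z \<inter> D)" using Z D by (auto simp: C_def)
      have "res E Z ?Y (\<sigma> Z) = res E (Z \<inter> D) ?Y (res E Z (Z \<inter> D) (\<sigma> Z))"
        using res_res[of Z "Z \<inter> D" ?Y "\<sigma> Z"] Q[OF Z(1)] Z oZ Y by (simp add: Q_def)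
      also have "\<dots> = res E D ?Y s"
        using res_res[of D "Z \<inter> D" ?Y s] Q[OF Z(1)] Z oZ Y D s by (simp add: Q_def)
      finally show ?thesis .
    qed
    have "res E ?X ?Y (res E U ?X (\<sigma> U)) = res E ?X ?Y (res E W ?X (\<sigma> W))"
      using res_res[of U ?X ?Y "\<sigma> U"] res_res[of W ?X ?Y "\<sigma> W"] *[of U] *[of W] that U W X Y
        Q[of U] Q[of W] by (simp add: Q_def le_infI1)
    then show ?thesis
      using res_inj[of ?X ?Y "res E U ?X (\<sigma> U)" "res E W ?X (\<sigma> W)"] X Y U W that Q[of U] Q[of W]
      by (simp add: Q_def res_closed le_infI1)
  qed
  moreover have "\<sigma> U \<in> carrier (sec E U)" "P1_open U" if "U \<in> C" for U
    using Q[OF that] that by (simp_all add: Q_def C_def)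
  ultimately obtain t where t: "t \<in> carrier (sec E V)" "\<forall>U\<in>C. res E V U t = \<sigma> U"
    using sheaf_glue[of C V \<sigma>] by blast
  have "res E D D (\<sigma> D) = res E D D s" using Q[OF DC] by (simp add: Q_def)
  moreover have "\<sigma> D \<in> carrier (sec E D)" using Q[OF DC] by (simp add: Q_def)
  ultimately have "\<sigma> D = s" using D(1) s by (simp add: res_id)
  then show ?thesis using t DC by blast
qed

text \<open>In a frame at p the section is a tuple of rational functions whose poles at p are
  cleared by a power of c; regularity at p spreads to a neighbourhood. All large exponents are
  allowed so that several points can share one.\<close>

lemma extend_near:
  assumes p: "p \<in> P1" and c: "absorbs_poles c p"
    and U: "P1_open U" "U \<noteq> {}" and s: "s \<in> carrier (sec E U)" and V: "P1_open V" "p \<in> V"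
  shows "\<exists>N. \<forall>k\<ge>N. \<exists>W t. P1_open W \<and> p \<in> W \<and> W \<subseteq> V \<and> c \<in> carrier (O_ring W) \<and> t \<in> carrier (sec E W) \<and>
    res E W (W \<inter> U) t = c ^ k \<odot>\<^bsub>sec E (W \<inter> U)\<^esub> res E U (W \<inter> U) s"
proof -
  obtain U\<^sub>p and r :: nat and \<kappa> where Up: "P1_open U\<^sub>p" "p \<in> U\<^sub>p"
    and bij: "\<And>W. P1_open W \<Longrightarrow> W \<subseteq> U\<^sub>p \<Longrightarrow> W \<noteq> {} \<Longrightarrow>
      bij_betw (\<kappa> W) (carrier (sec E W)) (\<Pi>\<^sub>E i\<in>{..<r}. carrier (O_ring W))"
    and smult: "\<And>W f s. P1_open W \<Longrightarrow> W \<subseteq> U\<^sub>p \<Longrightarrow> W \<noteq> {} \<Longrightarrow> f \<in> carrier (O_ring W) \<Longrightarrow>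
      s \<in> carrier (sec E W) \<Longrightarrow> \<kappa> W (f \<odot>\<^bsub>sec E W\<^esub> s) = (\<lambda>i\<in>{..<r}. f * \<kappa> W s i)"
    and res: "\<And>W X s. P1_open W \<Longrightarrow> W \<subseteq> U\<^sub>p \<Longrightarrow> P1_open X \<Longrightarrow> X \<subseteq> W \<Longrightarrow> X \<noteq> {} \<Longrightarrow>
      s \<in> carrier (sec E W) \<Longrightarrow> \<kappa> X (res E W X s) = \<kappa> W s"
    by (rule trivialization[OF p]) (rule that; assumption)
  let ?Y = "U\<^sub>p \<inter> U"
  have Y: "P1_open ?Y" "?Y \<noteq> {}" using Up U open_Int_nonempty by blast+
  define f where "f = \<kappa> ?Y (res E U ?Y s)"
  have "\<exists>k. c ^ k * f i \<in> local_set p" for i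
    using c by (simp add: absorbs_poles_def)
  then obtain k where k: "\<And>i. c ^ k i * f i \<in> local_set p" by metis
  have cp: "c \<in> local_set p" using c by (simp add: absorbs_poles_def)
  have "\<exists>W t. P1_open W \<and> p \<in> W \<and> W \<subseteq> V \<and> c \<in> carrier (O_ring W) \<and> t \<in> carrier (sec E W) \<and>
    res E W (W \<inter> U) t = c ^ m \<odot>\<^bsub>sec E (W \<inter> U)\<^esub> res E U (W \<inter> U) s"
    if m: "(\<Sum>i<r. k i) \<le> m" for m
  proof -
    have loc: "c ^ m * f i \<in> local_set p" if "i < r" for i
    proof -
      have "k i \<le> (\<Sum>i<r. k i)" using that by (intro member_le_sum) auto
      then have "c ^ m * f i = c ^ (m - k i) * (c ^ k i * f i)"
        using m by (simp flip: mult.assoc power_add)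
      then show ?thesis using local_set_mult[OF p local_set_power[OF p cp] k, of "m - k i" i] by (simp only:)
    qed
    \<comment> \<open>The additional index r carries c, which makes c regular on the same
      neighbourhood as the tuple.\<close>
    have "\<exists>W0. P1_open W0 \<and> p \<in> W0 \<and>
        (\<forall>i\<in>{..r}. (if i < r then c ^ m * f i else c) \<in> carrier (O_ring W0))"
      by (rule ex_open_regular) (use p loc cp in auto)
    then obtain W0 where W0: "P1_open W0" "p \<in> W0"
      "\<forall>i\<in>{..r}. (if i < r then c ^ m * f i else c) \<in> carrier (O_ring W0)"
      by blast
    let ?W = "W0 \<inter> (U\<^sub>p \<inter> V)"
    have W: "P1_open ?W" "p \<in> ?W" "?W \<subseteq> V" "?W \<subseteq> U\<^sub>p" using W0 V Up by auto
    have Wne: "?W \<noteq> {}" using W(2) by blast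
    have mono: "g \<in> carrier (O_ring ?W)" if "g \<in> carrier (O_ring W0)" for g
      by (rule carrier_O_ring_mono[OF that _ Wne]) blast
    have regc: "c \<in> carrier (O_ring ?W)"
      by (rule mono) (use W0(3)[THEN bspec, of r] in simp)
    have regf: "c ^ m * f i \<in> carrier (O_ring ?W)" if "i < r" for i
      by (rule mono) (use W0(3)[THEN bspec, of i] that in simp)
    have "(\<lambda>i\<in>{..<r}. c ^ m * f i) \<in> (\<Pi>\<^sub>E i\<in>{..<r}. carrier (O_ring ?W))"
      using regf by (simp add: PiE_iff)
    then obtain t where t: "t \<in> carrier (sec E ?W)" "\<kappa> ?W t = (\<lambda>i\<in>{..<r}. c ^ m * f i)"
      unfolding bij_betw_imp_surj_on[OF bij[OF W(1,4) Wne], symmetric] by (rule imageE) (rule that, simp_all)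
    let ?X = "?W \<inter> U"
    have X: "P1_open ?X" "?X \<noteq> {}" "?X \<subseteq> ?W" "?X \<subseteq> U" "?X \<subseteq> U\<^sub>p" "?X \<subseteq> ?Y"
      using W U Wne open_Int_nonempty[of ?W U] by auto
    have cX: "c ^ m \<in> carrier (O_ring ?X)"
      using regc X Wne P1_open_subset[OF X(1)] by (auto simp: carrier_O_ring intro!: local_set_power)
    have sX: "res E U ?X s \<in> carrier (sec E ?X)" using s U X by (intro res_closed) auto
    have "\<kappa> ?X (res E U ?X s) = \<kappa> ?X (res E ?Y ?X (res E U ?Y s))"
      using res_res[of U ?Y ?X s] U X Y s by simp
    also have "\<dots> = f"
      unfolding f_def using X Y U s by (intro res res_closed) auto
    finally have "\<kappa> ?X (c ^ m \<odot>\<^bsub>sec E ?X\<^esub> res E U ?X s) = (\<lambda>i\<in>{..<r}. c ^ m * f i)"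
      using smult[OF X(1,5,2) cX sX] by simp
    moreover have "\<kappa> ?X (res E ?W ?X t) = (\<lambda>i\<in>{..<r}. c ^ m * f i)"
      using res[OF W(1,4) X(1,3,2) t(1)] t(2) by simp
    ultimately have "res E ?W ?X t = c ^ m \<odot>\<^bsub>sec E ?X\<^esub> res E U ?X s"
      using bij_betw_imp_inj_on[OF bij[OF X(1,5,2)]] res_closed[OF W(1) X(1,3) t(1)]
        sec_smult_closed[OF X(1) sX cX] by (metis inj_onD)
    then show ?thesis using W regc t(1) by blast
  qed
  then show ?thesis by blast
qed

text \<open>Outside D(b) there are only finitely many points of Spec A, so the sum of their
  exponents serves all of them at once. Sections over D(b) thereby become fractions of sections over
  Spec A with powers of b as denominators.\<close>

lemma clear_denominators:
  assumes b: "(b :: 'k poly) \<noteq> 0" and s: "s \<in> carrier (sec E (basic_open b))"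
  shows "\<exists>N. \<exists>t\<in>carrier (sec E affine_line).
    res E affine_line (basic_open b) t = Fract b 1 ^ N \<odot>\<^bsub>sec E (basic_open b)\<^esub> s"
proof -
  let ?D = "basic_open b" and ?c = "Fract b 1"
  have D: "P1_open ?D" "?D \<noteq> {}" using generic_in_basic_open[OF b] by auto
  define F where "F = {P \<in> Spec_A. b \<in> P}"
  have "\<forall>P\<in>F. \<exists>N. \<forall>k\<ge>N. \<exists>W t. P1_open W \<and> Fin P \<in> W \<and> W \<subseteq> affine_line \<and> ?c \<in> carrier (O_ring W) \<and>
    t \<in> carrier (sec E W) \<and> res E W (W \<inter> ?D) t = ?c ^ k \<odot>\<^bsub>sec E (W \<inter> ?D)\<^esub> res E ?D (W \<inter> ?D) s"
    using s D by (intro ballI extend_near)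
      (auto simp: F_def Fin_in_P1 Fin_in_affine_line intro: absorbs_poles_Fin)
  then obtain N where N: "\<And>P k. P \<in> F \<Longrightarrow> N P \<le> k \<Longrightarrow>
    \<exists>W t. P1_open W \<and> Fin P \<in> W \<and> W \<subseteq> affine_line \<and> ?c \<in> carrier (O_ring W) \<and>
    t \<in> carrier (sec E W) \<and> res E W (W \<inter> ?D) t = ?c ^ k \<odot>\<^bsub>sec E (W \<inter> ?D)\<^esub> res E ?D (W \<inter> ?D) s"
    by metis
  define k where "k = (\<Sum>P\<in>F. N P)"
  have k: "N P \<le> k" if "P \<in> F" for P
    unfolding k_def using finite_zeros[OF b] that by (intro member_le_sum) (auto simp: F_def)
  have pow: "?c ^ k \<in> carrier (O_ring X)" if "X \<subseteq> affine_line" "X \<noteq> {}" for X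
  proof -
    have "?c \<in> local_set p \<and> p \<in> P1" if "p \<in> affine_line" for p
      using that Fract_in_local_set affine_line_subset unfolding affine_line_def by blast
    then show ?thesis
      using that by (subst carrier_O_ring) (auto intro!: local_set_power)
  qed
  define s' where "s' = ?c ^ k \<odot>\<^bsub>sec E ?D\<^esub> s"
  have s': "s' \<in> carrier (sec E ?D)"
    unfolding s'_def using D s basic_open_subset by (intro sec_smult_closed pow)
  have "\<exists>t\<in>carrier (sec E affine_line). res E affine_line ?D t = s'"
  proof (rule glue_extension)
    fix p :: "'k point" assume "p \<in> affine_line"
    then obtain P where P: "p = Fin P" "P \<in> Spec_A" by (auto simp: affine_line_def)
    show "\<exists>U t. P1_open U \<and> p \<in> U \<and> U \<subseteq> affine_line \<and> t \<in> carrier (sec E U) \<and>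
      res E U (U \<inter> ?D) t = res E ?D (U \<inter> ?D) s'"
    proof (cases "b \<in> P")
      case False
      then show ?thesis
        using P D s' basic_open_subset[of b]
        by (intro exI[of _ ?D] exI[of _ s']) (simp add: Fin_in_basic_open)
    next
      case True
      then obtain W t where W: "P1_open W" "Fin P \<in> W" "W \<subseteq> affine_line" "t \<in> carrier (sec E W)"
        "res E W (W \<inter> ?D) t = ?c ^ k \<odot>\<^bsub>sec E (W \<inter> ?D)\<^esub> res E ?D (W \<inter> ?D) s"
        using N[of P k] k[of P] P by (auto simp: F_def)
      have "W \<inter> ?D \<noteq> {}" using W D open_Int_nonempty by blast
      then have "res E ?D (W \<inter> ?D) s' = ?c ^ k \<odot>\<^bsub>sec E (W \<inter> ?D)\<^esub> res E ?D (W \<inter> ?D) s"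
        unfolding s'_def using W D s basic_open_subset by (intro res_smult pow) auto
      then show ?thesis using W P by metis
    qed
  qed (use D s' basic_open_subset in auto)
  then show ?thesis unfolding s'_def by blast
qed

end

section \<open>The completion at infinity\<close>

lemma truncate_0 [simp]: "truncate 0 c = 0"
  by (simp add: truncate_def)

lemma truncate_Suc: "truncate (Suc n) c = truncate n c + Fract [:fps_nth c n:] 1 * unif ^ n"
  by (simp add: truncate_def)

lemma unif_in_local_set: "unif \<in> local_set Infty"
  using absorbs_poles_unif unfolding absorbs_poles_def by (rule conjunct1)

lemma unif_power_in_local_set: "unif ^ n \<in> local_set Infty"
  by (rule local_set_power[OF Infty_in_P1 unif_in_local_set])

lemma const_in_local_set: "Fract [:c:] 1 \<in> local_set Infty"
  by (simp add: fract_to_fls_poly poly_to_fls_const)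

lemma truncate_in_local_set: "truncate n c \<in> local_set Infty"
proof (induction n)
  case 0
  then show ?case using local_set_const[OF Infty_in_P1] by (simp only: truncate_0)
next
  case (Suc n)
  show ?case
    unfolding truncate_Suc
    by (intro local_set_add[OF Infty_in_P1] local_set_mult[OF Infty_in_P1] Suc
        const_in_local_set unif_power_in_local_set)
qed

text \<open>Hence \<open>fps_X ^ k\<close> acts as zero on level k of the completion, the quotient
  by \<pi>^k.\<close>

lemma truncate_X_power: "truncate k (fps_X ^ k :: 'k::field fps) = 0"
proof -
  have "n \<le> k \<Longrightarrow> truncate n (fps_X ^ k :: 'k fps) = 0" for n
    by (induction n) (simp_all add: truncate_Suc fps_X_power_nth flip: Zero_fract_def)
  then show ?thesis by simp
qed

locale infty_module = Module.module "local_ring Infty" M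
  for M :: "('k::field poly fract, 'm) module"
begin

lemma carrier_local_ring: "carrier (local_ring Infty) = local_set (Infty :: 'k point)"
  by (simp only: local_ring_def partial_object.simps)

lemma smult_mult:
  "a \<in> local_set Infty \<Longrightarrow> b \<in> local_set Infty \<Longrightarrow> x \<in> carrier M \<Longrightarrow>
   (a * b) \<odot>\<^bsub>M\<^esub> x = a \<odot>\<^bsub>M\<^esub> (b \<odot>\<^bsub>M\<^esub> x)"
  using smult_assoc1[of a b x] unfolding carrier_local_ring by (simp add: local_ring_def)

lemma smult_add:
  "a \<in> local_set Infty \<Longrightarrow> b \<in> local_set Infty \<Longrightarrow> x \<in> carrier M \<Longrightarrow>
   (a + b) \<odot>\<^bsub>M\<^esub> x = a \<odot>\<^bsub>M\<^esub> x \<oplus>\<^bsub>M\<^esub> b \<odot>\<^bsub>M\<^esub> x"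
  using smult_l_distr[of a b x] unfolding carrier_local_ring by (simp add: local_ring_def)

lemma smult_zero: "x \<in> carrier M \<Longrightarrow> 0 \<odot>\<^bsub>M\<^esub> x = \<zero>\<^bsub>M\<^esub>"
  using smult_l_null[of x] by (simp add: local_ring_def)

lemma smult_in_carrier: "a \<in> local_set Infty \<Longrightarrow> x \<in> carrier M \<Longrightarrow> a \<odot>\<^bsub>M\<^esub> x \<in> carrier M"
  using smult_closed[of a x] unfolding carrier_local_ring .

lemma unif_mult_subset: "unif_mult M n \<subseteq> carrier M"
  using smult_in_carrier[OF unif_power_in_local_set] by (auto simp: unif_mult_def)

lemma smult_unif_mult:
  assumes "a \<in> local_set Infty" "u \<in> unif_mult M n"
  shows "a \<odot>\<^bsub>M\<^esub> u \<in> unif_mult M n"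
proof -
  obtain m where m: "m \<in> carrier M" "u = unif ^ n \<odot>\<^bsub>M\<^esub> m"
    using assms(2) by (auto simp: unif_mult_def)
  have "a \<odot>\<^bsub>M\<^esub> u = (a * unif ^ n) \<odot>\<^bsub>M\<^esub> m"
    using m by (simp only: smult_mult assms(1) unif_power_in_local_set)
  also have "\<dots> = unif ^ n \<odot>\<^bsub>M\<^esub> (a \<odot>\<^bsub>M\<^esub> m)"
    using m by (simp only: mult.commute[of a] smult_mult assms(1) unif_power_in_local_set)
  finally show ?thesis
    unfolding unif_mult_def using smult_in_carrier[OF assms(1) m(1)] by blast
qed

lemma subgroup_unif_mult: "subgroup (unif_mult M n) (add_monoid M)"
proof (rule M.add.subgroupI)
  show "unif_mult M n \<subseteq> carrier M" by (rule unif_mult_subset)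
  show "unif_mult M n \<noteq> {}" by (auto simp: unif_mult_def)
next
  fix a b assume "a \<in> unif_mult M n" "b \<in> unif_mult M n"
  then obtain x y where "x \<in> carrier M" "y \<in> carrier M" "a = unif ^ n \<odot>\<^bsub>M\<^esub> x" "b = unif ^ n \<odot>\<^bsub>M\<^esub> y"
    by (auto simp: unif_mult_def)
  moreover from this have "a \<oplus>\<^bsub>M\<^esub> b = unif ^ n \<odot>\<^bsub>M\<^esub> (x \<oplus>\<^bsub>M\<^esub> y)"
    using smult_r_distr[of "unif ^ n" x y] by (simp only: carrier_local_ring unif_power_in_local_set)
  ultimately show "a \<oplus>\<^bsub>M\<^esub> b \<in> unif_mult M n" by (auto simp: unif_mult_def)
next
  fix a assume a: "a \<in> unif_mult M n"
  have "- 1 \<in> local_set (Infty :: 'k point)" "1 \<in> local_set (Infty :: 'k point)"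
    by (rule local_set_const[OF Infty_in_P1])+
  note c = this
  have aM: "a \<in> carrier M" using a unif_mult_subset by blast
  have "1 \<odot>\<^bsub>M\<^esub> a = a" using smult_one[OF aM] by (simp add: local_ring_def)
  then have "(- 1) \<odot>\<^bsub>M\<^esub> a \<oplus>\<^bsub>M\<^esub> a = (- 1 + 1) \<odot>\<^bsub>M\<^esub> a"
    using smult_add[OF c aM] by (simp only:)
  then have "(- 1) \<odot>\<^bsub>M\<^esub> a \<oplus>\<^bsub>M\<^esub> a = \<zero>\<^bsub>M\<^esub>"
    using smult_zero[OF aM] by simp
  then have "\<ominus>\<^bsub>M\<^esub> a = (- 1) \<odot>\<^bsub>M\<^esub> a"
    using M.minus_equality smult_in_carrier[OF c(1) aM] aM by blast
  then show "\<ominus>\<^bsub>M\<^esub> a \<in> unif_mult M n"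
    using smult_unif_mult[OF c(1) a] by simp
qed

lemma unif_mult_Suc: "unif_mult M (Suc n) \<subseteq> unif_mult M n"
proof
  fix u assume "u \<in> unif_mult M (Suc n)"
  then obtain m where m: "m \<in> carrier M" "u = unif ^ Suc n \<odot>\<^bsub>M\<^esub> m" by (auto simp: unif_mult_def)
  then have "u = unif ^ n \<odot>\<^bsub>M\<^esub> (unif \<odot>\<^bsub>M\<^esub> m)"
    by (simp only: power_Suc2 smult_mult unif_in_local_set unif_power_in_local_set)
  then show "u \<in> unif_mult M n"
    using smult_in_carrier[OF unif_in_local_set m(1)] by (auto simp: unif_mult_def)
qed

lemma in_coset_iff: "x \<in> unif_mult M n +>\<^bsub>M\<^esub> m \<longleftrightarrow> (\<exists>u\<in>unif_mult M n. x = u \<oplus>\<^bsub>M\<^esub> m)"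
  by (auto simp: a_r_coset_def')

lemma in_coset_self: "m \<in> carrier M \<Longrightarrow> m \<in> unif_mult M n +>\<^bsub>M\<^esub> m"
  unfolding in_coset_iff using subgroup.one_closed[OF subgroup_unif_mult]
  by (intro bexI[of _ "\<zero>\<^bsub>M\<^esub>"]) simp_all

lemma coset_eq:
  "m' \<in> unif_mult M n +>\<^bsub>M\<^esub> m \<Longrightarrow> m \<in> carrier M \<Longrightarrow>
   unif_mult M n +>\<^bsub>M\<^esub> m' = unif_mult M n +>\<^bsub>M\<^esub> m"
  using M.a_repr_independence[OF _ _ subgroup_unif_mult] by metis

lemma to_completion_in_carrier:
  assumes "m \<in> carrier M"
  shows "to_completion M m \<in> carrier (completion M)"
  using assms unif_mult_Suc
  by (auto simp: to_completion_def completion_def A_RCOSETS_def' a_r_coset_def')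

text \<open>Multiplication by the truncated series preserves \<pi>^n M, so all cosets in the union
  over the representatives coincide.\<close>

lemma completion_smult:
  assumes x: "x \<in> carrier (completion M)" and m: "m \<in> x n"
  shows "m \<in> carrier M"
    "(c \<odot>\<^bsub>completion M\<^esub> x) n = unif_mult M n +>\<^bsub>M\<^esub> (truncate n c \<odot>\<^bsub>M\<^esub> m)"
proof -
  have "x n \<in> a_rcosets\<^bsub>M\<^esub> (unif_mult M n)" using x by (simp add: completion_def)
  then obtain m0 where m0: "m0 \<in> carrier M" "x n = unif_mult M n +>\<^bsub>M\<^esub> m0"
    by (auto simp: A_RCOSETS_def')
  show mM: "m \<in> carrier M"
    using m unif_mult_subset m0 unfolding m0(2) in_coset_iff by auto
  have xn: "x n = unif_mult M n +>\<^bsub>M\<^esub> m"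
    using coset_eq[of m n m0] m m0 by simp
  let ?t = "truncate n c"
  have "unif_mult M n +>\<^bsub>M\<^esub> (?t \<odot>\<^bsub>M\<^esub> m') = unif_mult M n +>\<^bsub>M\<^esub> (?t \<odot>\<^bsub>M\<^esub> m)"
    if m'x: "m' \<in> x n" for m'
  proof (rule coset_eq)
    obtain u where u: "u \<in> unif_mult M n" "m' = u \<oplus>\<^bsub>M\<^esub> m"
      using m'x unfolding xn in_coset_iff by blast
    have uM: "u \<in> carrier M" using u(1) unif_mult_subset by blast
    have "?t \<odot>\<^bsub>M\<^esub> m' = ?t \<odot>\<^bsub>M\<^esub> u \<oplus>\<^bsub>M\<^esub> ?t \<odot>\<^bsub>M\<^esub> m"
      unfolding u(2) using uM mM truncate_in_local_set[of n c]
      by (intro smult_r_distr) (simp_all only: carrier_local_ring)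
    then show "?t \<odot>\<^bsub>M\<^esub> m' \<in> unif_mult M n +>\<^bsub>M\<^esub> (?t \<odot>\<^bsub>M\<^esub> m)"
      unfolding in_coset_iff using smult_unif_mult[OF truncate_in_local_set u(1)] by blast
    show "?t \<odot>\<^bsub>M\<^esub> m \<in> carrier M" by (rule smult_in_carrier[OF truncate_in_local_set mM])
  qed
  then have "(\<Union>m'\<in>x n. unif_mult M n +>\<^bsub>M\<^esub> (?t \<odot>\<^bsub>M\<^esub> m')) = unif_mult M n +>\<^bsub>M\<^esub> (?t \<odot>\<^bsub>M\<^esub> m)"
    using m by blast
  then show "(c \<odot>\<^bsub>completion M\<^esub> x) n = unif_mult M n +>\<^bsub>M\<^esub> (?t \<odot>\<^bsub>M\<^esub> m)"
    by (simp add: completion_def)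
qed

lemma completion_nonempty:
  assumes "x \<in> carrier (completion M)"
  obtains m where "m \<in> x n"
proof -
  have "x n \<in> a_rcosets\<^bsub>M\<^esub> (unif_mult M n)" using assms by (simp add: completion_def)
  then obtain m where "m \<in> carrier M" "x n = unif_mult M n +>\<^bsub>M\<^esub> m"
    by (auto simp: A_RCOSETS_def')
  then show thesis using that in_coset_self by blast
qed

text \<open>Consecutive truncations differ by a multiple of \<pi>^n, which keeps the sequence of
  cosets compatible.\<close>

lemma completion_smult_closed:
  assumes x: "x \<in> carrier (completion M)"
  shows "c \<odot>\<^bsub>completion M\<^esub> x \<in> carrier (completion M)"
proof -
  let ?y = "c \<odot>\<^bsub>completion M\<^esub> x"
  have "?y n \<in> a_rcosets\<^bsub>M\<^esub> (unif_mult M n) \<and> ?y (Suc n) \<subseteq> ?y n" for n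
  proof
    obtain m where m: "m \<in> x (Suc n)" using completion_nonempty[OF x] by blast
    have "x (Suc n) \<subseteq> x n" using x by (simp add: completion_def)
    then have m': "m \<in> x n" using m by blast
    have mM: "m \<in> carrier M" by (rule completion_smult(1)[OF x m])
    let ?t = "truncate n c" and ?r = "Fract [:fps_nth c n:] 1"
    have tM: "?t \<odot>\<^bsub>M\<^esub> m \<in> carrier M" by (rule smult_in_carrier[OF truncate_in_local_set mM])
    then show "?y n \<in> a_rcosets\<^bsub>M\<^esub> (unif_mult M n)"
      unfolding completion_smult(2)[OF x m'] by (auto simp: A_RCOSETS_def')
    have "?r * unif ^ n = unif ^ n * ?r" by (rule mult.commute)
    then have "truncate (Suc n) c \<odot>\<^bsub>M\<^esub> m = ?t \<odot>\<^bsub>M\<^esub> m \<oplus>\<^bsub>M\<^esub> unif ^ n \<odot>\<^bsub>M\<^esub> (?r \<odot>\<^bsub>M\<^esub> m)"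
      unfolding truncate_Suc using mM
      by (simp only: smult_add smult_mult truncate_in_local_set const_in_local_set
          unif_power_in_local_set local_set_mult[OF Infty_in_P1])
    moreover have rM: "?r \<odot>\<^bsub>M\<^esub> m \<in> carrier M" by (rule smult_in_carrier[OF const_in_local_set mM])
    moreover have "unif ^ n \<odot>\<^bsub>M\<^esub> (?r \<odot>\<^bsub>M\<^esub> m) \<in> carrier M"
      by (rule smult_in_carrier[OF unif_power_in_local_set rM])
    ultimately have "truncate (Suc n) c \<odot>\<^bsub>M\<^esub> m \<in> unif_mult M n +>\<^bsub>M\<^esub> (?t \<odot>\<^bsub>M\<^esub> m)"
      unfolding in_coset_iff using tM by (auto simp: unif_mult_def M.a_comm)
    then have eq: "?y n = unif_mult M n +>\<^bsub>M\<^esub> (truncate (Suc n) c \<odot>\<^bsub>M\<^esub> m)"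
      unfolding completion_smult(2)[OF x m'] using coset_eq tM by blast
    show "?y (Suc n) \<subseteq> ?y n"
      unfolding eq completion_smult(2)[OF x m] using unif_mult_Suc[of n] by (fastforce simp: in_coset_iff)
  qed
  then show ?thesis by (simp add: completion_def)
qed

text \<open>Brings divisibility down from the completion to the module: at level k the right-hand
  side is the zero coset, so m lies in \<pi>^k M.\<close>

lemma to_completion_eq_smult_X_power:
  assumes m: "m \<in> carrier M" and x: "x \<in> carrier (completion M)"
    and eq: "to_completion M m = (fps_X ^ k) \<odot>\<^bsub>completion M\<^esub> x"
  shows "m \<in> unif_mult M k"
proof -
  obtain m' where m': "m' \<in> x k" using completion_nonempty[OF x] by blast
  have "m \<in> to_completion M m k" unfolding to_completion_def by (rule in_coset_self[OF m])
  also have "to_completion M m k = unif_mult M k +>\<^bsub>M\<^esub> \<zero>\<^bsub>M\<^esub>"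
    unfolding eq completion_smult(2)[OF x m'] truncate_X_power
    by (simp only: smult_zero completion_smult(1)[OF x m'])
  finally obtain u where "u \<in> unif_mult M k" "m = u \<oplus>\<^bsub>M\<^esub> \<zero>\<^bsub>M\<^esub>"
    unfolding in_coset_iff by blast
  then show ?thesis using unif_mult_subset[of k] by (simp add: subset_iff)
qed

end

section \<open>The splitting of the associated bundle\<close>

lemma Fract_poly_power: "Fract (b :: 'k::field poly) 1 ^ n = Fract (b ^ n) 1"
  by (induction n) (simp_all add: One_fract_def)

lemma Fract_poly_regular:
  assumes "U \<subseteq> affine_line" "U \<noteq> {}"
  shows "Fract a 1 \<in> carrier (O_ring U)"
proof -
  have "Fract a 1 \<in> local_set p" if "p \<in> U" for p
    using that assms Fract_in_local_set unfolding affine_line_def by blast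
  then show ?thesis using assms by (simp add: carrier_O_ring)
qed

lemma Fract_inverse_regular:
  assumes "b \<noteq> 0"
  shows "Fract 1 b \<in> carrier (O_ring (basic_open b))"
proof -
  have "basic_open b \<noteq> {}" using generic_in_basic_open[OF assms] by blast
  moreover have "Fract 1 b \<in> local_set p" if "p \<in> basic_open b" for p
    using that unfolding basic_open_def by fastforce
  ultimately show ?thesis by (simp add: carrier_O_ring)
qed

lemma common_denominator:
  assumes "finite I" "P \<in> Spec_A" "\<And>i. i \<in> I \<Longrightarrow> f i \<in> local_set (Fin P)"
  shows "\<exists>b. b \<notin> P \<and> (\<forall>i\<in>I. \<exists>a. f i = Fract a b)"
  using assms
proof (induction rule: finite_induct)
  case empty
  then show ?case using Spec_A_1 by blast
next
  case (insert j I)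
  then obtain b where b: "b \<notin> P" "\<forall>i\<in>I. \<exists>a. f i = Fract a b" by blast
  have "f j \<in> local_set (Fin P)" using insert.prems by blast
  then obtain a c where c: "f j = Fract a c" "c \<notin> P" by auto
  have nz: "b \<noteq> 0" "c \<noteq> 0" using b c insert.prems(1) by auto
  have "\<exists>a. f i = Fract a (b * c)" if i: "i \<in> insert j I" for i
  proof (cases "i = j")
    case True
    then have "f i = Fract (a * b) (b * c)" using nz by (simp add: c eq_fract)
    then show ?thesis ..
  next
    case False
    then obtain e where "f i = Fract e b" using b i by blast
    then have "f i = Fract (e * c) (b * c)" using nz by (simp add: eq_fract)
    then show ?thesis ..
  qed
  moreover have "b * c \<notin> P" using b(1) c(2) insert.prems(1) by (simp add: Spec_A_mult)
  ultimately show ?case by (intro exI[of _ "b * c"]) simp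
qed

locale associated_pair = vector_bundle_P1 E + fls_space scale
  for E :: "('k::field, 's) omod" and scale :: "'k fls \<Rightarrow> 'v::ab_group_add \<Rightarrow> 'v" +
  fixes d :: nat and w :: "nat \<Rightarrow> 'v" and n :: "nat \<Rightarrow> int"
    and L Linf :: "'v set"
    and g :: "('k, 's) germ \<Rightarrow> 'v" and h :: "(nat \<Rightarrow> ('k, 's) germ set) \<Rightarrow> 'v"
  assumes w: "indep d w"
    and L: "L = combs (range poly_to_fls) d w"
    and Linf: "Linf = combs O_inf d (\<lambda>i. scale (fls_X powi - n i) (w i))"
    and g: "linear_to UNIV (stalk E generic) (\<lambda>f. scale (fract_to_fls f)) g"
    and h: "linear_to UNIV (completed_stalk E) (scale_O scale) h"
    and compatible: "\<And>U t. P1_open U \<Longrightarrow> Infty \<in> U \<Longrightarrow> t \<in> carrier (sec E U) \<Longrightarrow>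
      h (to_completion (stalk E Infty) (germ E Infty U t)) = g (germ E generic U t)"
    and bij_L: "bij_betw (\<lambda>s. g (germ E generic affine_line s)) (carrier (sec E affine_line)) L"
    and bij_Linf: "bij_betw h (carrier (completed_stalk E)) Linf"
begin

text \<open>The image of a section in V, taken through the generic stalk so that sections over
  different open sets have comparable images.\<close>

definition gam :: "'k point set \<Rightarrow> 's \<Rightarrow> 'v" where
  "gam U s = g (germ E generic U s)"

text \<open>These vectors form the K-subspace of V generated by the A-lattice.\<close>

definition vec :: "(nat \<Rightarrow> 'k poly fract) \<Rightarrow> 'v" where
  "vec f = comb d (\<lambda>i. fract_to_fls (f i)) w"

lemma vec_unique: "vec f = vec f' \<Longrightarrow> i < d \<Longrightarrow> f i = f' i"
  using comb_unique[OF w] unfolding vec_def by (metis fract_to_fls_inject)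

lemma vec_cong: "(\<And>i. i < d \<Longrightarrow> f i = f' i) \<Longrightarrow> vec f = vec f'"
  unfolding vec_def by (rule comb_cong) simp

lemma vec_smult: "vec (\<lambda>i. c * f i) = scale (fract_to_fls c) (vec f)"
  unfolding vec_def by (simp only: fract_to_fls_mult comb_scale)

lemma vec_add: "vec (\<lambda>i. f i + f' i) = vec f + vec f'"
  unfolding vec_def by (simp only: fract_to_fls_add comb_add)

lemma vec_poly: "vec (\<lambda>i. Fract (a i) 1) \<in> L"
  unfolding vec_def L fract_to_fls_poly by (rule combsI) blast

lemma ex_poly_coords:
  assumes "x \<in> L"
  shows "\<exists>a. x = vec (\<lambda>i. Fract (a i) 1)"
proof -
  obtain c where c: "x = comb d c w" "\<forall>i<d. c i \<in> range poly_to_fls"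
    using assms unfolding L combs_def by blast
  then have "\<forall>i. \<exists>a. i < d \<longrightarrow> c i = poly_to_fls a" by blast
  then obtain a where "\<And>i. i < d \<Longrightarrow> c i = poly_to_fls (a i)" by metis
  then have "x = vec (\<lambda>i. Fract (a i) 1)"
    unfolding vec_def c(1) fract_to_fls_poly by (intro comb_cong)
  then show ?thesis by blast
qed

text \<open>The lattice at infinity has the basis v_i with w_i = \<pi>^(n_i) v_i, so the coordinate
  f_i at w_i becomes \<pi>^(n_i) f_i at v_i. This is where the local condition of \<O>(n_i) at
  infinity arises.\<close>

lemma vec_in_Linf_iff: "vec f \<in> Linf \<longleftrightarrow> (\<forall>i<d. unif powi n i * f i \<in> local_set Infty)"
proof -
  let ?v = "\<lambda>i. scale (fls_X powi - n i) (w i)"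
  have v: "indep d ?v" by (rule indep_rescale[OF w fls_X_powi_nonzero])
  have "vec f = comb d (\<lambda>i. fract_to_fls (unif powi n i * f i)) ?v"
    unfolding vec_def comb_rescale
    by (rule comb_cong)
      (simp add: fract_to_fls_mult fract_to_fls_unif_power_int power_int_minus del: fls_X_power_int)
  then have "vec f \<in> Linf \<longleftrightarrow> (\<forall>i<d. fract_to_fls (unif powi n i * f i) \<in> O_inf)"
    unfolding Linf combs_def using comb_unique[OF v] by (smt (verit) mem_Collect_eq)
  then show ?thesis by (simp only: local_set_Infty mem_Collect_eq)
qed

lemma gam_res:
  assumes "P1_open U" "P1_open W" "W \<subseteq> U" "W \<noteq> {}" "s \<in> carrier (sec E U)"
  shows "gam W (res E U W s) = gam U s"
  unfolding gam_def using assms generic_in_open by (subst germ_res) auto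

lemma gam_add:
  assumes "P1_open U" "U \<noteq> {}" "s \<in> carrier (sec E U)" "t \<in> carrier (sec E U)"
  shows "gam U (s \<oplus>\<^bsub>sec E U\<^esub> t) = gam U s + gam U t"
proof -
  have "generic \<in> U" using assms generic_in_open by blast
  then show ?thesis
    using g assms germ_in_stalk[of U generic] unfolding gam_def linear_to_def
    by (simp flip: stalk_add)
qed

lemma gam_smult:
  assumes "P1_open U" "U \<noteq> {}" "s \<in> carrier (sec E U)" "f \<in> carrier (O_ring U)"
  shows "gam U (f \<odot>\<^bsub>sec E U\<^esub> s) = scale (fract_to_fls f) (gam U s)"
proof -
  have "generic \<in> U" using assms generic_in_open by blast
  then show ?thesis
    using g assms germ_in_stalk[of U generic] unfolding gam_def linear_to_def
    by (simp flip: stalk_smult)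
qed

lemma gam_zero:
  assumes "P1_open U" "U \<noteq> {}"
  shows "gam U \<zero>\<^bsub>sec E U\<^esub> = 0"
proof -
  interpret Module.module "O_ring U" "sec E U" using assms(1) by (rule sec_module)
  have "gam U (\<zero>\<^bsub>sec E U\<^esub> \<oplus>\<^bsub>sec E U\<^esub> \<zero>\<^bsub>sec E U\<^esub>) = gam U \<zero>\<^bsub>sec E U\<^esub> + gam U \<zero>\<^bsub>sec E U\<^esub>"
    using assms by (intro gam_add) simp_all
  then show ?thesis by simp
qed

lemma gam_affine: "s \<in> carrier (sec E affine_line) \<Longrightarrow> gam affine_line s \<in> L"
  using bij_betwE[OF bij_L] unfolding gam_def by blast

lemma ex_gam_affine: "x \<in> L \<Longrightarrow> \<exists>s\<in>carrier (sec E affine_line). gam affine_line s = x"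
  using bij_betw_imp_surj_on[OF bij_L] unfolding gam_def by blast

lemma affine_line_nonempty [simp]: "affine_line \<noteq> {}"
  using generic_in_open[of affine_line] Fin_in_affine_line zero_ideal_in_Spec_A by blast

lemma gam_denominator:
  assumes U: "P1_open U" "basic_open b \<subseteq> U" "b \<noteq> 0" and s: "s \<in> carrier (sec E U)"
  obtains N t where "t \<in> carrier (sec E affine_line)"
    "res E affine_line (basic_open b) t =
      Fract b 1 ^ N \<odot>\<^bsub>sec E (basic_open b)\<^esub> res E U (basic_open b) s"
    "gam affine_line t = scale (fract_to_fls (Fract b 1 ^ N)) (gam U s)"
proof -
  let ?D = "basic_open b"
  have D: "P1_open ?D" "?D \<noteq> {}" "?D \<subseteq> affine_line"
    using generic_in_basic_open[OF U(3)] basic_open_subset by auto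
  have sD: "res E U ?D s \<in> carrier (sec E ?D)" using U D s by (intro res_closed)
  obtain N t where t: "t \<in> carrier (sec E affine_line)"
    "res E affine_line ?D t = Fract b 1 ^ N \<odot>\<^bsub>sec E ?D\<^esub> res E U ?D s"
    using clear_denominators[OF U(3) sD] by blast
  have "gam affine_line t = gam ?D (res E affine_line ?D t)"
    by (rule gam_res[symmetric]) (use D t in simp_all)
  also have "\<dots> = scale (fract_to_fls (Fract b 1 ^ N)) (gam ?D (res E U ?D s))"
    unfolding t(2) using D sD
    by (intro gam_smult) (simp_all add: Fract_poly_power Fract_poly_regular)
  also have "gam ?D (res E U ?D s) = gam U s"
    using U D s by (simp add: gam_res)
  finally show thesis using that t by blast
qed

text \<open>Injectivity is inherited from the bijection of sections over Spec A with the A-lattice: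
  b^N s extends to Spec A with image 0, so it vanishes on D(b). There b is invertible, so s vanishes
  on D(b), and on \<open>U\<close> by \<open>res_inj\<close>.\<close>

lemma gam_eq_0_imp:
  assumes U: "P1_open U" "U \<noteq> {}" and s: "s \<in> carrier (sec E U)" and 0: "gam U s = 0"
  shows "s = \<zero>\<^bsub>sec E U\<^esub>"
proof -
  have "generic \<in> U" using U generic_in_open by blast
  then obtain b where b: "b \<noteq> 0" "basic_open b \<subseteq> U" using ex_basic_open[OF U(1), of "{0}"] by blast
  let ?D = "basic_open b"
  have D: "P1_open ?D" "?D \<noteq> {}" "?D \<subseteq> affine_line"
    using generic_in_basic_open[OF b(1)] basic_open_subset by auto
  interpret D: Module.module "O_ring ?D" "sec E ?D" using D(1) by (rule sec_module)
  obtain N t where t: "t \<in> carrier (sec E affine_line)"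
    "res E affine_line ?D t = Fract b 1 ^ N \<odot>\<^bsub>sec E ?D\<^esub> res E U ?D s"
    "gam affine_line t = scale (fract_to_fls (Fract b 1 ^ N)) (gam U s)"
    using gam_denominator[OF U(1) b(2,1) s] by blast
  have sD: "res E U ?D s \<in> carrier (sec E ?D)" using U D s b by (intro res_closed)
  have "gam affine_line t = gam affine_line \<zero>\<^bsub>sec E affine_line\<^esub>"
    using t(3) 0 by (simp add: gam_zero)
  then have "t = \<zero>\<^bsub>sec E affine_line\<^esub>"
    using bij_betw_imp_inj_on[OF bij_L] t(1) sec_zero_closed[of affine_line]
    unfolding gam_def by (auto dest: inj_onD)
  then have *: "Fract b 1 ^ N \<odot>\<^bsub>sec E ?D\<^esub> res E U ?D s = \<zero>\<^bsub>sec E ?D\<^esub>"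
    using t(2) D by (simp add: res_zero)
  have "Fract 1 b * Fract b 1 = 1"
    using b(1) by (simp add: One_fract_def eq_fract)
  then have "Fract 1 b ^ N * Fract b 1 ^ N = 1" by (simp flip: power_mult_distrib)
  moreover have "Fract 1 b ^ N \<in> carrier (O_ring ?D)"
  proof -
    have "Fract 1 b \<in> local_set p \<and> p \<in> P1" if "p \<in> ?D" for p
      using that Fract_inverse_regular[OF b(1)] D(2) P1_open_subset[OF D(1)]
      by (auto simp: carrier_O_ring simp del: local_set.simps)
    then show ?thesis using D(2) by (auto simp: carrier_O_ring intro!: local_set_power)
  qed
  moreover have "Fract b 1 ^ N \<in> carrier (O_ring ?D)"
    using D by (simp add: Fract_poly_power Fract_poly_regular)
  ultimately have "res E U ?D s = \<zero>\<^bsub>sec E ?D\<^esub>"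
    using sec_smult_assoc[OF D(1) sD, of "Fract 1 b ^ N" "Fract b 1 ^ N"] sec_smult_one[OF D(1,2) sD] *
    by simp
  then have "res E U ?D s = res E U ?D \<zero>\<^bsub>sec E U\<^esub>" using U D b by (simp add: res_zero)
  then show ?thesis
    using res_inj[OF U(1) D(1) b(2) D(2) s sec_zero_closed[OF U(1)]] by blast
qed

lemma gam_inj:
  assumes U: "P1_open U" "U \<noteq> {}" and s: "s \<in> carrier (sec E U)" "t \<in> carrier (sec E U)"
    and eq: "gam U s = gam U t"
  shows "s = t"
proof -
  interpret Module.module "O_ring U" "sec E U" using U(1) by (rule sec_module)
  let ?u = "s \<ominus>\<^bsub>sec E U\<^esub> t"
  have u: "?u \<in> carrier (sec E U)" using s by simp
  have st: "?u \<oplus>\<^bsub>sec E U\<^esub> t = s" using s by (simp add: M.minus_eq M.a_assoc M.l_neg)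
  then have "gam U ?u + gam U t = gam U s" using gam_add[OF U u s(2)] by simp
  then have "?u = \<zero>\<^bsub>sec E U\<^esub>" using eq u by (intro gam_eq_0_imp[OF U]) simp_all
  then show ?thesis using st s by simp
qed

text \<open>On some D(b) around P inside \<open>U\<close>, a multiple b^N s comes from Spec A and
  has polynomial coordinates; dividing by b^N keeps them regular at P. Taking P = 0 shows that all
  images have coordinates in K.\<close>

lemma gam_coords_Fin:
  assumes U: "P1_open U" "Fin P \<in> U" and s: "s \<in> carrier (sec E U)"
  shows "\<exists>f. gam U s = vec f \<and> (\<forall>i<d. f i \<in> local_set (Fin P))"
proof -
  obtain b where b: "b \<notin> P" "basic_open b \<subseteq> U" using ex_basic_open[OF U] by blast
  have P: "P \<in> Spec_A" using U P1_open_subset Fin_in_P1 by blast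
  then have b0: "b \<noteq> 0" using b(1) by auto
  obtain N t where t: "t \<in> carrier (sec E affine_line)"
    "gam affine_line t = scale (fract_to_fls (Fract b 1 ^ N)) (gam U s)"
    using gam_denominator[OF U(1) b(2) b0 s] by blast
  obtain a where a: "gam affine_line t = vec (\<lambda>i. Fract (a i) 1)"
    using ex_poly_coords[OF gam_affine[OF t(1)]] by blast
  define f where "f = (\<lambda>i. Fract (a i) (b ^ N))"
  have "Fract b 1 ^ N * f i = Fract (a i) 1" for i
    using b0 by (simp add: f_def Fract_poly_power eq_fract)
  then have "scale (fract_to_fls (Fract b 1 ^ N)) (vec f) = scale (fract_to_fls (Fract b 1 ^ N)) (gam U s)"
    using t(2) a by (simp flip: vec_smult)
  moreover have "Fract b 1 \<noteq> 0" using b0 by (simp add: Zero_fract_def eq_fract)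
  ultimately have "gam U s = vec f" by simp
  moreover have "b ^ N \<notin> P"
    by (induction N) (use b P in \<open>simp_all add: Spec_A_mult\<close>)
  then have "f i \<in> local_set (Fin P)" for i by (auto simp: f_def)
  ultimately show ?thesis by blast
qed

text \<open>Over a common denominator b outside P, the numerators define an element of the
  A-lattice, hence a section over Spec A, which can be divided by b on D(b).\<close>

lemma ex_section_Fin:
  assumes P: "P \<in> Spec_A" and f: "\<And>i. i < d \<Longrightarrow> f i \<in> local_set (Fin P)"
  shows "\<exists>W t. P1_open W \<and> Fin P \<in> W \<and> W \<subseteq> affine_line \<and> t \<in> carrier (sec E W) \<and> gam W t = vec f"
proof -
  obtain b where b: "b \<notin> P" "\<forall>i\<in>{..<d}. \<exists>a. f i = Fract a b"
    using common_denominator[of "{..<d}" P f] P f by auto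
  then have "\<forall>i. \<exists>a. i < d \<longrightarrow> f i = Fract a b" by auto
  then obtain a where a: "\<And>i. i < d \<Longrightarrow> f i = Fract (a i) b" by metis
  have b0: "b \<noteq> 0" using b(1) P by auto
  let ?D = "basic_open b"
  have PD: "Fin P \<in> ?D" using b(1) P by (simp add: Fin_in_basic_open)
  then have D: "P1_open ?D" "?D \<noteq> {}" "?D \<subseteq> affine_line" using basic_open_subset by auto
  obtain s where s: "s \<in> carrier (sec E affine_line)" "gam affine_line s = vec (\<lambda>i. Fract (a i) 1)"
    using ex_gam_affine[OF vec_poly] by blast
  define t where "t = Fract 1 b \<odot>\<^bsub>sec E ?D\<^esub> res E affine_line ?D s"
  have r: "res E affine_line ?D s \<in> carrier (sec E ?D)" using D s by (intro res_closed) simp_all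
  have "t \<in> carrier (sec E ?D)"
    unfolding t_def using D r Fract_inverse_regular[OF b0] by (intro sec_smult_closed)
  moreover have "gam ?D t = scale (fract_to_fls (Fract 1 b)) (gam affine_line s)"
    unfolding t_def using D r s Fract_inverse_regular[OF b0] by (simp add: gam_smult gam_res)
  moreover have "vec f = vec (\<lambda>i. Fract 1 b * Fract (a i) 1)"
    by (rule vec_cong) (simp add: a)
  ultimately have "t \<in> carrier (sec E ?D) \<and> gam ?D t = vec f"
    using s(2) by (simp only: vec_smult)
  then show ?thesis using D PD by blast
qed

lemma module_stalk_Infty: "infty_module (stalk E Infty)"
  unfolding infty_module_def by (rule module_stalk[OF Infty_in_P1])

text \<open>The germ at infinity maps to the completed stalk, where \<open>h\<close> takes values in
  the lattice; \<open>compatible\<close> identifies this value with the one given by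
  \<open>g\<close>.\<close>

lemma gam_Infty:
  assumes "P1_open U" "Infty \<in> U" "s \<in> carrier (sec E U)"
  shows "gam U s \<in> Linf"
proof -
  interpret infty_module "stalk E Infty" by (rule module_stalk_Infty)
  have "to_completion (stalk E Infty) (germ E Infty U s) \<in> carrier (completed_stalk E)"
    unfolding completed_stalk_def using assms by (intro to_completion_in_carrier germ_in_stalk)
  then have "h (to_completion (stalk E Infty) (germ E Infty U s)) \<in> Linf"
    using bij_betwE[OF bij_Linf] by blast
  then show ?thesis using compatible[OF assms] by (simp add: gam_def)
qed

text \<open>
  A section with a pole at infinity is multiplied into a regular one by a power of \<open>\<pi>\<close>; that its germ
  is divisible by that power is seen in the completion, where \<open>h\<close> is injective.
\<close>

lemma ex_section_Infty:
  assumes f: "vec f \<in> Linf"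
  shows "\<exists>W t. P1_open W \<and> Infty \<in> W \<and> t \<in> carrier (sec E W) \<and> gam W t = vec f"
proof -
  interpret infty_module "stalk E Infty" by (rule module_stalk_Infty)
  \<comment> \<open>At the generic point every rational function is regular, so a section with this
    image exists over some nonempty open set, possibly with a pole at infinity.\<close>
  obtain D s where D: "P1_open D" "generic \<in> D" and s: "s \<in> carrier (sec E D)" "gam D s = vec f"
    using ex_section_Fin[of "{0}" f] by (auto simp del: local_set.simps)
  have Dne: "D \<noteq> {}" using D by blast
  obtain k W t where W: "P1_open W" "Infty \<in> W" "unif \<in> carrier (O_ring W)"
    and t: "t \<in> carrier (sec E W)"
      "res E W (W \<inter> D) t = unif ^ k \<odot>\<^bsub>sec E (W \<inter> D)\<^esub> res E D (W \<inter> D) s"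
    using extend_near[OF Infty_in_P1 absorbs_poles_unif D(1) Dne s(1) P1_open_P1 Infty_in_P1] by blast
  let ?X = "W \<inter> D"
  have X: "P1_open ?X" "?X \<noteq> {}" "?X \<subseteq> W" "?X \<subseteq> D"
    using W D Dne open_Int_nonempty[of W D] by auto
  have unif_pow: "unif ^ k \<in> carrier (O_ring Y)" if "Y \<subseteq> W" "Y \<noteq> {}" for Y
  proof -
    have "unif \<in> local_set p \<and> p \<in> P1" if "p \<in> Y" for p
      using W P1_open_subset[OF W(1)] that \<open>Y \<subseteq> W\<close> by (subst (asm) carrier_O_ring) blast+
    then show ?thesis using \<open>Y \<noteq> {}\<close> by (auto simp: carrier_O_ring intro!: local_set_power)
  qed
  let ?c = "fract_to_fls (unif ^ k)"
  have c: "?c = fps_to_fls (fps_X ^ k)"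
    by (simp add: fract_to_fls_power fract_to_fls_unif fps_to_fls_power)
  have c0: "?c \<noteq> 0" unfolding c by simp
  have "gam W t = gam ?X (res E W ?X t)"
    by (rule gam_res[symmetric]) (use W X t in simp_all)
  also have "\<dots> = scale ?c (gam ?X (res E D ?X s))"
    unfolding t(2) using X D s unif_pow[OF X(3,2)] by (intro gam_smult res_closed)
  also have "gam ?X (res E D ?X s) = vec f" using X D s by (simp add: gam_res)
  finally have gt: "gam W t = scale ?c (vec f)" .
  \<comment> \<open>\<open>fps_X ^ k\<close> times x and the completed germ of t have the same image
    under the injective map \<open>h\<close>, so they are equal.\<close>
  obtain x where x: "x \<in> carrier (completed_stalk E)" "h x = vec f"
    using bij_betw_imp_surj_on[OF bij_Linf] f by (metis imageE)
  let ?m = "germ E Infty W t"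
  have m: "?m \<in> carrier (stalk E Infty)" using W t by (intro germ_in_stalk)
  have "h ((fps_X ^ k) \<odot>\<^bsub>completed_stalk E\<^esub> x) = scale ?c (vec f)"
    using h x unfolding linear_to_def scale_O_def c by simp
  also have "\<dots> = h (to_completion (stalk E Infty) ?m)"
    using compatible[OF W(1,2) t(1)] gt by (simp add: gam_def)
  finally have "(fps_X ^ k) \<odot>\<^bsub>completed_stalk E\<^esub> x = to_completion (stalk E Infty) ?m"
    using bij_betw_imp_inj_on[OF bij_Linf] completion_smult_closed[of x "fps_X ^ k"]
      to_completion_in_carrier[OF m] x(1) unfolding completed_stalk_def by (auto dest: inj_onD)
  then have "?m \<in> unif_mult (stalk E Infty) k"
    using to_completion_eq_smult_X_power[OF m, of x k] x(1) unfolding completed_stalk_def by simp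
  then obtain m' where m': "m' \<in> carrier (stalk E Infty)" "?m = unif ^ k \<odot>\<^bsub>stalk E Infty\<^esub> m'"
    by (auto simp: unif_mult_def)
  obtain Y r where Y: "P1_open Y" "Infty \<in> Y" "Y \<subseteq> W" "r \<in> carrier (sec E Y)" "m' = germ E Infty Y r"
    using stalk_common[OF m'(1) W(1,2)] by blast
  have Yne: "Y \<noteq> {}" using Y by blast
  have cr: "unif ^ k \<odot>\<^bsub>sec E Y\<^esub> r \<in> carrier (sec E Y)"
    using Y unif_pow[OF Y(3) Yne] by (intro sec_smult_closed)
  have "?m = germ E Infty Y (unif ^ k \<odot>\<^bsub>sec E Y\<^esub> r)"
    using m'(2) Y unif_pow[OF Y(3) Yne] by (simp add: stalk_smult)
  then obtain Z where Z: "P1_open Z" "Infty \<in> Z" "Z \<subseteq> W \<inter> Y"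
    "res E W Z t = res E Y Z (unif ^ k \<odot>\<^bsub>sec E Y\<^esub> r)"
    using germ_eq_iff[OF W(1,2) t(1) Y(1,2) cr] by blast
  have Zne: "Z \<noteq> {}" using Z by blast
  have "gam W t = gam Z (res E W Z t)"
    by (rule gam_res[symmetric]) (use W Z t Zne in simp_all)
  also have "\<dots> = gam Y (unif ^ k \<odot>\<^bsub>sec E Y\<^esub> r)"
    unfolding Z(4) using Y Z Zne cr by (simp add: gam_res)
  also have "\<dots> = scale ?c (gam Y r)"
    using Y Yne unif_pow[OF Y(3) Yne] by (intro gam_smult)
  finally have "scale ?c (gam Y r) = scale ?c (vec f)" using gt by simp
  then have "gam Y r = vec f" using c0 by simp
  then show ?thesis using Y by blast
qed

text \<open>The pointwise conditions that define \<O>(n_i) inside the constant sheaf K.\<close>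

definition twisted_local_set :: "nat \<Rightarrow> 'k point \<Rightarrow> 'k poly fract set" where
  "twisted_local_set i p =
     (if p = Infty then {f. unif powi n i * f \<in> local_set Infty} else local_set p)"

text \<open>The argument at each finite point provides its own coordinates, but independence of
  \<open>w\<close> makes them all equal to those found at the generic point. So one tuple satisfies
  the conditions at all points of \<open>U\<close>.\<close>

lemma ex_coords:
  assumes U: "P1_open U" "U \<noteq> {}" and s: "s \<in> carrier (sec E U)"
  shows "\<exists>f. gam U s = vec f \<and> (\<forall>i<d. \<forall>p\<in>U. f i \<in> twisted_local_set i p)"
proof -
  have "generic \<in> U" using U generic_in_open by blast
  then obtain f where f: "gam U s = vec f" using gam_coords_Fin[OF U(1) _ s] by blast
  have "f i \<in> twisted_local_set i p" if i: "i < d" and p: "p \<in> U" for i p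
  proof (cases p)
    case (Fin P)
    then obtain f' where "gam U s = vec f'" "f' i \<in> local_set (Fin P)"
      using gam_coords_Fin[OF U(1) _ s] p i by blast
    then have "f i \<in> local_set (Fin P)" using vec_unique[of f f' i] f i by simp
    then show ?thesis unfolding twisted_local_set_def Fin by simp
  next
    case Infty
    then have "vec f \<in> Linf" using gam_Infty[OF U(1) _ s] p f by simp
    then show ?thesis
      using i Infty vec_in_Linf_iff[of f] by (simp add: twisted_local_set_def del: local_set_Infty)
  qed
  then show ?thesis using f by blast
qed

text \<open>Near every point some section has the prescribed image; by \<open>gam_inj\<close> such
  sections agree on overlaps with the one near the generic point, and \<open>glue_extension\<close>
  applies.\<close>

lemma ex_section:
  assumes U: "P1_open U" "U \<noteq> {}" and f: "\<And>i p. i < d \<Longrightarrow> p \<in> U \<Longrightarrow> f i \<in> twisted_local_set i p"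
  shows "\<exists>s\<in>carrier (sec E U). gam U s = vec f"
proof -
  have gU: "generic \<in> U" using U generic_in_open by blast
  have local: "\<exists>W t. P1_open W \<and> p \<in> W \<and> W \<subseteq> U \<and> t \<in> carrier (sec E W) \<and> gam W t = vec f"
    if p: "p \<in> U" for p
  proof -
    have "\<exists>W t. P1_open W \<and> p \<in> W \<and> t \<in> carrier (sec E W) \<and> gam W t = vec f"
    proof (cases p)
      case (Fin P)
      then have "P \<in> Spec_A" using p U P1_open_subset Fin_in_P1 by blast
      moreover have "f i \<in> local_set (Fin P)" if "i < d" for i
        using f[OF that p] Fin by (simp add: twisted_local_set_def)
      ultimately show ?thesis using ex_section_Fin[of P f] Fin by blast
    next
      case Infty
      then have "vec f \<in> Linf"
        using f[OF _ p] vec_in_Linf_iff[of f]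
        by (simp add: twisted_local_set_def del: local_set_Infty)
      then show ?thesis using ex_section_Infty Infty by blast
    qed
    then obtain W t where W: "P1_open W" "p \<in> W" "t \<in> carrier (sec E W)" "gam W t = vec f" by blast
    let ?X = "W \<inter> U"
    have X: "P1_open ?X" "p \<in> ?X" "?X \<subseteq> W" "?X \<noteq> {}" using W U p by auto
    have "res E W ?X t \<in> carrier (sec E ?X)" "gam ?X (res E W ?X t) = vec f"
      using W X by (simp_all add: res_closed gam_res)
    then show ?thesis using X by blast
  qed
  obtain D t where D: "P1_open D" "generic \<in> D" "D \<subseteq> U" and t: "t \<in> carrier (sec E D)" "gam D t = vec f"
    using local[OF gU] by blast
  have Dne: "D \<noteq> {}" using D by blast
  have "\<exists>s\<in>carrier (sec E U). res E U D s = t"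
  proof (rule glue_extension[OF U(1) D(1,3) Dne t(1)])
    fix p assume "p \<in> U"
    then obtain W r where W: "P1_open W" "p \<in> W" "W \<subseteq> U" and r: "r \<in> carrier (sec E W)" "gam W r = vec f"
      using local by blast
    let ?X = "W \<inter> D"
    have X: "P1_open ?X" "?X \<noteq> {}" "?X \<subseteq> W" "?X \<subseteq> D"
      using W D Dne open_Int_nonempty[of W D] by auto
    have "res E W ?X r = res E D ?X t"
      by (rule gam_inj[OF X(1,2)]) (use W D X r t in \<open>simp_all add: res_closed gam_res\<close>)
    then show "\<exists>W r. P1_open W \<and> p \<in> W \<and> W \<subseteq> U \<and> r \<in> carrier (sec E W) \<and>
        res E W (W \<inter> D) r = res E D (W \<inter> D) t"
      using W r by blast
  qed
  then obtain s where s: "s \<in> carrier (sec E U)" "res E U D s = t" by blast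
  then have "gam U s = vec f" using gam_res[OF U(1) D(1,3) Dne s(1)] t(2) by simp
  then show ?thesis using s by blast
qed

text \<open>Restricted to the indices below \<open>d\<close> to land in the extensional product of
  \<open>direct_sum\<close>. The empty set does not contain the generic point, so its only section
  gets the zero tuple by decree.\<close>

definition coords :: "'k point set \<Rightarrow> 's \<Rightarrow> nat \<Rightarrow> 'k poly fract" where
  "coords U s = (restrict (if U = {} then (\<lambda>_. 0) else (SOME f. gam U s = vec f)) {..<d})"

lemma coords_eqI:
  assumes "P1_open U" "U \<noteq> {}" "s \<in> carrier (sec E U)" "gam U s = vec f"
  shows "coords U s = restrict f {..<d}"
proof -
  have "gam U s = vec (SOME f. gam U s = vec f)"
    using assms(4) by (rule someI[of "\<lambda>f. gam U s = vec f"])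
  then have "(SOME f. gam U s = vec f) i = f i" if "i < d" for i
    using vec_unique that assms(4) by simp
  then show ?thesis unfolding coords_def using assms(2) by (auto simp: restrict_def)
qed

lemma vec_coords:
  assumes "P1_open U" "U \<noteq> {}" "s \<in> carrier (sec E U)"
  shows "vec (coords U s) = gam U s"
proof -
  obtain f where f: "gam U s = vec f" using ex_coords[OF assms] by blast
  then show ?thesis using coords_eqI[OF assms f] vec_cong[of "coords U s" f] by simp
qed

lemma bij_coords:
  assumes U: "P1_open U"
  shows "bij_betw (coords U) (carrier (sec E U)) (\<Pi>\<^sub>E i\<in>{..<d}. K_sections (twisted_local_set i) U)"
proof (cases "U = {}")
  case True
  have "(\<Pi>\<^sub>E i\<in>{..<d}. {0 :: 'k poly fract}) = {\<lambda>i\<in>{..<d}. 0}"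
    by (auto simp: PiE_iff extensional_def restrict_def fun_eq_iff)
  then show ?thesis using True by (simp add: sec_empty K_sections_def coords_def bij_betw_def)
next
  case False
  note U = U False
  show ?thesis
  proof (rule bij_betwI')
    fix s t assume "s \<in> carrier (sec E U)" "t \<in> carrier (sec E U)"
    then show "coords U s = coords U t \<longleftrightarrow> s = t"
      using vec_coords[OF U] gam_inj[OF U] by metis
  next
    fix s assume s: "s \<in> carrier (sec E U)"
    obtain f where f: "gam U s = vec f" "\<forall>i<d. \<forall>p\<in>U. f i \<in> twisted_local_set i p"
      using ex_coords[OF U s] by blast
    then show "coords U s \<in> (\<Pi>\<^sub>E i\<in>{..<d}. K_sections (twisted_local_set i) U)"
      using False by (simp add: coords_eqI[OF U s] K_sections_def PiE_iff)
  next
    fix f assume f: "f \<in> (\<Pi>\<^sub>E i\<in>{..<d}. K_sections (twisted_local_set i) U)"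
    then have "f i \<in> twisted_local_set i p" if "i < d" "p \<in> U" for i p
      using that False by (auto simp: PiE_iff K_sections_def)
    then obtain s where s: "s \<in> carrier (sec E U)" "gam U s = vec f"
      using ex_section[OF U] by blast
    have "coords U s = restrict f {..<d}" by (rule coords_eqI[OF U s])
    also have "\<dots> = f" using f by (rule PiE_restrict)
    finally show "\<exists>s\<in>carrier (sec E U). f = coords U s" using s by blast
  qed
qed

text \<open>\<open>coords\<close> is the isomorphism. Since a tuple is determined by its vector,
  linearity and compatibility with restriction follow from those of \<open>gam\<close>; the empty
  set is handled by the zero conventions.\<close>

lemma splitting: "omod_iso E (direct_sum d (\<lambda>i. O_twist (n i)))"
  unfolding omod_iso_def iso_on_def
proof (intro exI[of _ coords] conjI allI impI ballI; (elim conjE)?)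
  fix W :: "'k point set" assume W: "P1_open W"
  show "bij_betw (coords W) (carrier (sec E W)) (carrier (sec (direct_sum d (\<lambda>i. O_twist (n i))) W))"
    using bij_coords[OF W]
    by (simp add: direct_sum_def O_twist_def K_subsheaf_def twisted_local_set_def[abs_def])
  fix s assume s: "s \<in> carrier (sec E W)"
  show "coords W (s \<oplus>\<^bsub>sec E W\<^esub> t) =
      coords W s \<oplus>\<^bsub>sec (direct_sum d (\<lambda>i. O_twist (n i))) W\<^esub> coords W t"
    if t: "t \<in> carrier (sec E W)" for t
  proof (cases "W = {}")
    case False
    have "gam W (s \<oplus>\<^bsub>sec E W\<^esub> t) = vec (\<lambda>i. coords W s i + coords W t i)"
      using False W s t by (simp add: gam_add vec_add vec_coords)
    then have "coords W (s \<oplus>\<^bsub>sec E W\<^esub> t) = (\<lambda>i\<in>{..<d}. coords W s i + coords W t i)"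
      using False W s t by (intro coords_eqI sec_add_closed)
    then show ?thesis by (simp add: direct_sum_def O_twist_def K_subsheaf_def)
  qed (simp add: coords_def direct_sum_def O_twist_def K_subsheaf_def restrict_def fun_eq_iff)
  show "coords W (f \<odot>\<^bsub>sec E W\<^esub> s) =
      f \<odot>\<^bsub>sec (direct_sum d (\<lambda>i. O_twist (n i))) W\<^esub> coords W s"
    if f: "f \<in> carrier (O_ring W)" for f
  proof (cases "W = {}")
    case False
    have "gam W (f \<odot>\<^bsub>sec E W\<^esub> s) = vec (\<lambda>i. f * coords W s i)"
      using False W s f by (simp add: gam_smult vec_smult vec_coords)
    then have "coords W (f \<odot>\<^bsub>sec E W\<^esub> s) = (\<lambda>i\<in>{..<d}. f * coords W s i)"
      using False W s f by (intro coords_eqI sec_smult_closed)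
    then show ?thesis by (simp add: direct_sum_def O_twist_def K_subsheaf_def)
  qed (simp add: coords_def direct_sum_def O_twist_def K_subsheaf_def restrict_def fun_eq_iff)
  show "coords X (res E W X s) = res (direct_sum d (\<lambda>i. O_twist (n i))) W X (coords W s)"
    if X: "P1_open X" "X \<subseteq> W" for X
  proof (cases "X = {}")
    case False
    then have "W \<noteq> {}" using X by blast
    have "gam X (res E W X s) = vec (coords W s)"
      using False \<open>W \<noteq> {}\<close> W X s by (simp add: gam_res vec_coords)
    then have "coords X (res E W X s) = restrict (coords W s) {..<d}"
      using False W X s by (intro coords_eqI res_closed)
    then show ?thesis
      using False by (simp add: direct_sum_def O_twist_def K_subsheaf_def K_restr_def)
  qed (simp add: coords_def direct_sum_def O_twist_def K_subsheaf_def K_restr_def)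
qed

end

theorem theorem2p1:
  fixes scale :: "'k::field fls \<Rightarrow> 'v::ab_group_add \<Rightarrow> 'v"
    and Basis :: "'v set" and d :: nat and L Linf :: "'v set"
  assumes "finite_dimensional_vector_space scale Basis"
    and "card Basis = d"
    and "A_lattice scale L"
    and "O_lattice scale Linf"
  shows "\<exists>(v :: nat \<Rightarrow> 'v) (n :: nat \<Rightarrow> int).
           family_basis (scale_O scale) d v Linf \<and>
           family_basis (scale_A scale) d (\<lambda>i. scale (fls_X powi n i) (v i)) L \<and>
           (\<forall>E :: ('k, 's) omod. associated_bundle scale L Linf E \<longrightarrow>
              omod_iso E (direct_sum d (\<lambda>i. O_twist (n i))))"
proof -
  interpret finite_dimensional_vector_space scale Basis by fact
  interpret fls_space scale by unfold_locales
  obtain w n where w: "indep d w" and L: "L = combs (range poly_to_fls) d w"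
    and Linf: "Linf = combs O_inf d (\<lambda>i. scale (fls_X powi - n i) (w i))"
    using exists_adapted_basis[OF assms] by blast
  define v where "v = (\<lambda>i. scale (fls_X powi - n i) (w i))"
  have "indep d v" unfolding v_def by (rule indep_rescale[OF w fls_X_powi_nonzero])
  then have "family_basis (scale_O scale) d v Linf"
    unfolding Linf v_def by (rule family_basis_O)
  moreover have "(\<lambda>i. scale (fls_X powi n i) (v i)) = w"
    by (simp add: v_def power_int_minus fun_eq_iff del: fls_X_power_int)
  then have "family_basis (scale_A scale) d (\<lambda>i. scale (fls_X powi n i) (v i)) L"
    using family_basis_A[OF w] L by simp
  moreover have "omod_iso E (direct_sum d (\<lambda>i. O_twist (n i)))"
    if E: "associated_bundle scale L Linf E" for E :: "('k, 's) omod"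
  proof -
    obtain g h where gh: "linear_to UNIV (stalk E generic) (\<lambda>f. scale (fract_to_fls f)) g"
      "linear_to UNIV (completed_stalk E) (scale_O scale) h"
      "\<forall>U t. P1_open U \<and> Infty \<in> U \<and> t \<in> carrier (sec E U) \<longrightarrow>
        h (to_completion (stalk E Infty) (germ E Infty U t)) = g (germ E generic U t)"
      "bij_betw (\<lambda>s. g (germ E generic affine_line s)) (carrier (sec E affine_line)) L"
      "bij_betw h (carrier (completed_stalk E)) Linf"
      using E unfolding associated_bundle_def by (elim conjE exE)
    have "vector_bundle E" using E by (simp add: associated_bundle_def)
    then interpret associated_pair E scale d w n L Linf g h
      by unfold_locales (use w L Linf gh in blast)+
    show ?thesis by (rule splitting)
  qed
  ultimately show ?thesis by blast
qed

end
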